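(* (1) Let $d_n'$ denote the expected value of $d_H(\pi,\rho)$ when $\pi,\rho$ are two independent uniformly random elements of $\mathrm{NC}(n)$, i.e. $d_n'=\frac{1}{\mathrm{Cat}_n^2}\sum_{\pi,\rho\in\mathrm{NC}(n)}d_H(\pi,\rho)$. Then for any $\varepsilon>0$ and all large enough $n$, $$(0.5-\varepsilon)\,n\le d_n'\le 0.83\,n.$$ (2) Let $c_n'$ denote the expected number of components of a uniformly random meandric system of order $n$. Then for any $\varepsilon>0$ and all large enough $n$, $$0.17\,n\le c_n'\le(0.5+\varepsilon)\,n.$$
   Context: For a positive integer $n$, a partition $\pi$ of $\{1,\ldots,n\}$ is non-crossing if there are no two distinct blocks $V,W$ of $\pi$ and numbers $a<b<c<d$ with $a,c\in V$ and $b,d\in W$. $\mathrm{NC}(n)$ is the set of non-crossing partitions of $\{1,\ldots,n\}$, partially ordered by $\pi\le\rho$ iff every block of $\pi$ is contained in a block of $\rho$; $|\mathrm{NC}(n)|=\mathrm{Cat}_n=\frac{(2n)!}{n!(n+1)!}$. The Hasse diagram $\mathcal{H}_n$ is the undirected graph with vertex set $\mathrm{NC}(n)$ in which $\pi_1,\pi_2$ are joined by an edge iff one of them covers the other; $d_H$ is the graph distance in $\mathcal{H}_n$. Meandric systems: fix an oriented line $L$ in the plane $\mathbb{R}^2$ with $2n$ marked points $p_1,\ldots,p_{2n}$ in order. A (closed) meandric system of order $n$ is an equivalence class of non-self-intersecting, not necessarily connected, closed curves $C\subseteq\mathbb{R}^2$ intersecting $L$ transversely at precisely $p_1,\ldots,p_{2n}$,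 where two curves are equivalent if they can be deformed into each other by an isotopy of the plane fixing $L$ pointwise. The number of components of the system is the number of connected components of $C$. Equivalently, a meandric system of order $n$ is an ordered pair of non-crossing perfect matchings of $\{p_1,\ldots,p_{2n}\}$ (one drawn by arcs above $L$, the other below $L$), and its components are the closed curves formed by the union of the arcs of the two matchings; hence there are $\mathrm{Cat}_n^2$ meandric systems of order $n$. *)

theory Defs
  imports "HOL-Probability.Probability"
begin

definition noncrossing :: "nat set set \<Rightarrow> bool" where
  "noncrossing \<pi> \<longleftrightarrow>
     \<not> (\<exists>V\<in>\<pi>. \<exists>W\<in>\<pi>. V \<noteq> W \<and>
          (\<exists>a b c d. a < b \<and> b < c \<and> c < d \<and> a \<in> V \<and> c \<in> V \<and> b \<in> W \<and> d \<in> W))"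

definition NC :: "nat \<Rightarrow> nat set set set" where
  "NC n = {\<pi>. partition_on {1..n} \<pi> \<and> noncrossing \<pi>}"

definition nc_less :: "nat \<Rightarrow> nat set set \<Rightarrow> nat set set \<Rightarrow> bool" where
  "nc_less n \<pi> \<rho> \<longleftrightarrow> refines {1..n} \<pi> \<rho> \<and> \<pi> \<noteq> \<rho>"

definition nc_covers :: "nat \<Rightarrow> nat set set \<Rightarrow> nat set set \<Rightarrow> bool" where
  "nc_covers n \<rho> \<pi> \<longleftrightarrow>
     nc_less n \<pi> \<rho> \<and> \<not> (\<exists>\<sigma>\<in>NC n. nc_less n \<pi> \<sigma> \<and> nc_less n \<sigma> \<rho>)"

text \<open>The undirected Hasse diagram of \<open>NC n\<close>, as a symmetric edge relation.\<close>

definition hasse :: "nat \<Rightarrow> (nat set set \<times> nat set set) set" where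
  "hasse n = {(\<pi>, \<rho>). \<pi> \<in> NC n \<and> \<rho> \<in> NC n \<and> (nc_covers n \<rho> \<pi> \<or> nc_covers n \<pi> \<rho>)}"

text \<open>
  Graph distance is the length of a shortest walk. The \<open>LEAST\<close> is meaningful because the
  finite poset \<open>NC n\<close> has a least element, so that \<open>hasse n\<close> is connected.
\<close>

definition hasse_dist :: "nat \<Rightarrow> nat set set \<Rightarrow> nat set set \<Rightarrow> nat" where
  "hasse_dist n \<pi> \<rho> = (LEAST k. (\<pi>, \<rho>) \<in> hasse n ^^ k)"

definition expected_hasse_dist :: "nat \<Rightarrow> real" where
  "expected_hasse_dist n =
     measure_pmf.expectation (pair_pmf (pmf_of_set (NC n)) (pmf_of_set (NC n)))
       (\<lambda>(\<pi>, \<rho>). real (hasse_dist n \<pi> \<rho>))"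

definition nc_matchings :: "nat \<Rightarrow> nat set set set" where
  "nc_matchings n = {\<mu> \<in> NC (2 * n). \<forall>e\<in>\<mu>. card e = 2}"

text \<open>
  A meandric system of order \<open>n\<close> is encoded, up to isotopy, by its upper and lower arcs:
  an ordered pair of non-crossing perfect matchings of the marked points \<open>1, \<dots>, 2 * n\<close>.
\<close>

definition meandric_systems :: "nat \<Rightarrow> (nat set set \<times> nat set set) set" where
  "meandric_systems n = nc_matchings n \<times> nc_matchings n"

text \<open>
  Every closed curve of a meandric system passes through at least one marked point, and two
  marked points lie on the same curve iff they are joined by a chain of arcs. A component is
  therefore represented by the set of marked points on it.
\<close>

definition arc_rel :: "nat set set \<times> nat set set \<Rightarrow> (nat \<times> nat) set" where
  "arc_rel M = {(i, j). \<exists>e \<in> fst M \<union> snd M. i \<in> e \<and> j \<in> e}"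

definition components_of :: "nat \<Rightarrow> nat set set \<times> nat set set \<Rightarrow> nat set set" where
  "components_of n M = {1..2 * n} // (arc_rel M)\<^sup>*"

definition expected_components :: "nat \<Rightarrow> real" where
  "expected_components n =
     measure_pmf.expectation (pmf_of_set (meandric_systems n))
       (\<lambda>M. real (card (components_of n M)))"

text \<open>\<open>pmf_of_set\<close> is the uniform distribution only on finite nonempty sets.\<close>

lemma finite_NC: "finite (NC n)"
  by (rule finite_subset[of _ "Pow (Pow {1..n})"]) (auto simp: NC_def partition_on_def)

lemma NC_nonempty: "NC n \<noteq> {}"
proof -
  have "(\<lambda>i. {i}) ` {1..n} \<in> NC n"
    by (auto simp: NC_def noncrossing_def partition_on_def disjoint_def)
  then show ?thesis by blast
qed

lemma finite_meandric_systems: "finite (meandric_systems n)"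
  unfolding meandric_systems_def nc_matchings_def using finite_NC[of "2 * n"] by simp

lemma meandric_systems_nonempty: "meandric_systems n \<noteq> {}"
proof -
  let ?\<mu> = "(\<lambda>i. {2 * i + 1, 2 * i + 2}) ` {..<n}"
  have "\<exists>i<n. x = 2 * i + 1 \<or> x = 2 * i + 2" if "1 \<le> x" "x \<le> 2 * n" for x
    using that by presburger
  then have "\<Union>?\<mu> = {1..2 * n}"
    by fastforce
  moreover have "disjoint ?\<mu>"
    unfolding disjoint_def by (auto; presburger)
  ultimately have "partition_on {1..2 * n} ?\<mu>"
    by (auto simp: partition_on_def)
  moreover have "noncrossing ?\<mu>"
    unfolding noncrossing_def by (auto; presburger)
  ultimately have "?\<mu> \<in> nc_matchings n"
    by (auto simp: nc_matchings_def NC_def)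
  then show ?thesis by (auto simp: meandric_systems_def)
qed

lemma expected_hasse_dist_eq:
  "expected_hasse_dist n =
     (\<Sum>\<pi>\<in>NC n. \<Sum>\<rho>\<in>NC n. real (hasse_dist n \<pi> \<rho>)) / real (card (NC n)) ^ 2"
proof -
  have "pair_pmf (pmf_of_set (NC n)) (pmf_of_set (NC n)) = pmf_of_set (NC n \<times> NC n)"
    using finite_NC NC_nonempty
    by (intro pmf_eqI) (auto simp: pmf_pair indicator_def split: prod.splits)
  then show ?thesis
    using finite_NC[of n] NC_nonempty[of n]
    by (simp add: expected_hasse_dist_def integral_pmf_of_set sum.cartesian_product
        card_cartesian_product power2_eq_square split_def)
qed

end

(*
  Let Cat_n^2 = A_n be the number of pairs of non-crossing partitions of n points. Going from pi to rho in the Hasse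
  diagram through the meet takes 2 |pi meet rho| - |pi| - |rho| steps. On average |pi| is (n + 1) / 2. A pair together
  with a point that is not the least one of its block in the meet can be cut between this point and its predecessor
  in that block; this expresses the mean of |pi meet rho| by the numbers B_s in A(z) = 1 / (1 - B(z)), and
  asymptotically it is (1 - B(1/16)) n < 0.915 n because A(1/16) = 16 / Pi - 4.

  Fattening identifies NC(n) with the non-crossing matchings of 2n points. A matching paired with itself has n
  components, and a step in the Hasse diagram re-glues two arcs, hence changes the number of components by at most 1,
  so (components) + (distance) >= n. The leftmost point of a component opens an arc in both matchings. A given point
  opens an arc of a random matching with probability close to 1/2 unless it is near the ends, so the
  mean number of components is at most 2n (1/4 + o(1)). These three estimates give all four bounds.
*)

theory Submission
  imports Defs "HOL-Real_Asymp.Real_Asymp"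
begin

section \<open>Non-crossing equivalence relations\<close>

text \<open>Partitions are handled as equivalence relations: refinement becomes inclusion, and the
  meet of \<open>NC n\<close> is plain intersection, as in the lattice of all partitions. A join of
  non-crossing partitions may cross, so the path between two of them is led through the meet. The
  ground set is an arbitrary finite set of numbers because cutting off a segment leaves a remainder
  that need not be an interval. The bound on the distance leaves little room: the limit 0.08508...
  is compared with 0.085 = (1 - 0.83) / 2. This is done without infinite series. A truncated form of
  A = 1 / (1 - B) bounds the partial sums of B from below, the partial sums of A have a closed form,
  and for the fixed number of 59 terms the passage to large n is a termwise limit. The inequality
  (components) + (distance) >= n turns upper bounds into lower ones: 0.17 = 1 - 0.83 and 0.5 -
  \<epsilon> = 1 - (0.5 + \<epsilon>).\<close>

definition nceq :: "nat set \<Rightarrow> (nat \<times> nat) set set" where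
  "nceq A = {R. equiv A R \<and>
     (\<forall>a b c d. a < b \<and> b < c \<and> c < d \<and> (a, c) \<in> R \<and> (b, d) \<in> R \<longrightarrow> (a, b) \<in> R)}"

text \<open>Merging of two classes. It serves twice: as a step up in the Hasse diagram, and for
  identifying two marked points when components are counted.\<close>

definition glue :: "('a \<times> 'a) set \<Rightarrow> 'a \<Rightarrow> 'a \<Rightarrow> ('a \<times> 'a) set" where
  "glue R x y = R \<union> R `` {x} \<times> R `` {y} \<union> R `` {y} \<times> R `` {x}"

lemma nceqI:
  assumes "R \<subseteq> A \<times> A" "\<And>x. x \<in> A \<Longrightarrow> (x, x) \<in> R"
    "\<And>x y. (x, y) \<in> R \<Longrightarrow> (y, x) \<in> R"
    "\<And>x y z. (x, y) \<in> R \<Longrightarrow> (y, z) \<in> R \<Longrightarrow> (x, z) \<in> R"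
    "\<And>a b c d. a < b \<Longrightarrow> b < c \<Longrightarrow> c < d \<Longrightarrow> (a, c) \<in> R \<Longrightarrow> (b, d) \<in> R \<Longrightarrow> (a, b) \<in> R"
  shows "R \<in> nceq A"
proof -
  have "trans R" using assms(4) by (rule transI)
  then show ?thesis
    using assms(1-3) assms(5) unfolding nceq_def equiv_def refl_on_def sym_def by blast
qed

lemma nceq_equivI:
  assumes "equiv A R"
    "\<And>a b c d. a < b \<Longrightarrow> b < c \<Longrightarrow> c < d \<Longrightarrow> (a, c) \<in> R \<Longrightarrow> (b, d) \<in> R \<Longrightarrow> (a, b) \<in> R"
  shows "R \<in> nceq A"
  using assms unfolding nceq_def by blast

lemma nceq_equiv: "R \<in> nceq A \<Longrightarrow> equiv A R"
  by (simp add: nceq_def)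

lemma nceq_subset: "R \<in> nceq A \<Longrightarrow> (x, y) \<in> R \<Longrightarrow> x \<in> A \<and> y \<in> A"
  unfolding nceq_def equiv_def by blast

lemma nceq_refl: "R \<in> nceq A \<Longrightarrow> x \<in> A \<Longrightarrow> (x, x) \<in> R"
  unfolding nceq_def equiv_def refl_on_def by blast

lemma nceq_sym: "R \<in> nceq A \<Longrightarrow> (x, y) \<in> R \<Longrightarrow> (y, x) \<in> R"
  unfolding nceq_def equiv_def sym_def by blast

lemma nceq_trans: "R \<in> nceq A \<Longrightarrow> (x, y) \<in> R \<Longrightarrow> (y, z) \<in> R \<Longrightarrow> (x, z) \<in> R"
  unfolding nceq_def equiv_def trans_def by blast

lemma nceq_noncrossing:
  "R \<in> nceq A \<Longrightarrow> (a, c) \<in> R \<Longrightarrow> (b, d) \<in> R \<Longrightarrow> a < b \<Longrightarrow> b < c \<Longrightarrow> c < d \<Longrightarrow> (a, b) \<in> R"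
  unfolding nceq_def by blast

lemma finite_nceq: "finite A \<Longrightarrow> finite (nceq A)"
  by (rule finite_subset[of _ "Pow (A \<times> A)"]) (auto dest: nceq_subset)

lemma Id_on_nceq: "Id_on A \<in> nceq A"
  by (rule nceqI) auto

lemma nceq_nonempty: "nceq A \<noteq> {}"
  using Id_on_nceq by blast

lemma card_nceq_pos: "finite A \<Longrightarrow> card (nceq A) > 0"
  by (simp add: card_gt_0_iff finite_nceq nceq_nonempty)

lemma Int_nceq:
  assumes R: "R \<in> nceq A" and Q: "Q \<in> nceq A"
  shows "R \<inter> Q \<in> nceq A"
proof (rule nceqI)
  show "R \<inter> Q \<subseteq> A \<times> A"
    using nceq_subset[OF R] by auto
  show "(x, x) \<in> R \<inter> Q" if "x \<in> A" for x
    using that nceq_refl[OF R] nceq_refl[OF Q] by blast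
  show "(y, x) \<in> R \<inter> Q" if "(x, y) \<in> R \<inter> Q" for x y
    using that nceq_sym[OF R] nceq_sym[OF Q] by blast
  show "(x, z) \<in> R \<inter> Q" if "(x, y) \<in> R \<inter> Q" "(y, z) \<in> R \<inter> Q" for x y z
    using that nceq_trans[OF R] nceq_trans[OF Q] by blast
  show "(a, b) \<in> R \<inter> Q"
    if "a < b" "b < c" "c < d" "(a, c) \<in> R \<inter> Q" "(b, d) \<in> R \<inter> Q" for a b c d
    using that nceq_noncrossing[OF R] nceq_noncrossing[OF Q] by blast
qed

lemma glue_mem: "R \<in> nceq A \<Longrightarrow> x \<in> A \<Longrightarrow> y \<in> A \<Longrightarrow> (x, y) \<in> glue R x y"
  by (auto simp: glue_def nceq_refl)

lemma subset_glue: "R \<subseteq> glue R x y"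
  by (auto simp: glue_def)

lemma glue_least:
  assumes "R \<subseteq> Q" "Q \<in> nceq A" "(x, y) \<in> Q"
  shows "glue R x y \<subseteq> Q"
proof -
  have "(a, b) \<in> Q" if "(x, a) \<in> R" "(y, b) \<in> R" for a b
    using assms that nceq_sym nceq_trans by (meson subsetD)
  then show ?thesis
    using assms(1) nceq_sym[OF assms(2)] by (auto simp: glue_def)
qed

lemma equiv_glue:
  assumes "equiv A R" "x \<in> A" "y \<in> A"
  shows "equiv A (glue R x y)"
proof (rule equivI)
  note [dest] = equiv_type[OF assms(1), THEN subsetD]
  have s: "(b, a) \<in> R" if "(a, b) \<in> R" for a b
    using assms(1) that by (auto simp: equiv_def sym_def)
  have t: "(a, c) \<in> R" if "(a, b) \<in> R" "(b, c) \<in> R" for a b c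
    using assms(1) that unfolding equiv_def trans_def by blast
  show "glue R x y \<subseteq> A \<times> A"
    by (auto simp: glue_def)
  show "refl_on A (glue R x y)"
    using assms unfolding glue_def equiv_def refl_on_def by blast
  have J: "(a, b) \<in> glue R x y \<longleftrightarrow>
      (a, b) \<in> R \<or> (x, a) \<in> R \<and> (y, b) \<in> R \<or> (y, a) \<in> R \<and> (x, b) \<in> R" for a b
    by (auto simp: glue_def)
  show "sym (glue R x y)"
    unfolding sym_def J using s by blast
  show "trans (glue R x y)"
    unfolding trans_def J by (meson s t)
qed

text \<open>By \<open>sep\<close>, no class leaves the interval [x, y] from a point strictly inside.
  A pair outside the merged class therefore lies entirely inside or entirely outside (x, y) and
  cannot separate \<open>x\<close> from \<open>y\<close>. It separates no class of \<open>R\<close>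
  either, so the whole merged class lies on one side of it (\<open>key\<close>).\<close>

lemma glue_nceq:
  assumes R: "R \<in> nceq A" and xy: "x \<in> A" "y \<in> A" "x < y"
    and sep: "\<And>a b. (a, b) \<in> R \<Longrightarrow> x < a \<Longrightarrow> a < y \<Longrightarrow> x \<le> b \<and> b \<le> y"
  shows "glue R x y \<in> nceq A"
proof -
  let ?J = "glue R x y"
  have e: "equiv A ?J"
    using equiv_glue[OF nceq_equiv[OF R]] xy by blast
  have s: "(b, a) \<in> R" if "(a, b) \<in> R" for a b
    using R that by (rule nceq_sym)
  have t: "(a, c) \<in> R" if "(a, b) \<in> R" "(b, c) \<in> R" for a b c
    using R that by (rule nceq_trans)
  have nc: "(a, b) \<in> R" if "(a, c) \<in> R" "(b, d) \<in> R" "a < b" "b < c" "c < d" for a b c d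
    using R that by (rule nceq_noncrossing)
  have r: "(x, x) \<in> R" "(y, y) \<in> R"
    using R xy by (auto intro: nceq_refl)
  define U where "U z \<longleftrightarrow> (x, z) \<in> R \<or> (y, z) \<in> R" for z
  have J: "(a, b) \<in> ?J \<longleftrightarrow> (a, b) \<in> R \<or> U a \<and> U b" for a b
    unfolding glue_def U_def by (simp; meson s t)
  have UR: "U a \<longleftrightarrow> U b" if "(a, b) \<in> R" for a b
    using that unfolding U_def by (meson s t)
  have side: "a \<noteq> x \<and> a \<noteq> y \<and> b \<noteq> x \<and> b \<noteq> y \<and> (x < a \<and> a < y \<longleftrightarrow> x < b \<and> b < y)"
    if "(a, b) \<in> R" "\<not> U a" for a b
  proof -
    have "\<not> U b" using that UR by blast
    then have ne: "a \<noteq> x" "a \<noteq> y" "b \<noteq> x" "b \<noteq> y" using that r unfolding U_def by auto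
    then show ?thesis using sep[OF that(1)] sep[OF s[OF that(1)]] by linarith
  qed
  have cross: "(a < z \<and> z < b) = (a < w \<and> w < b)"
    if ab: "(a, b) \<in> R" "\<not> U a" and zw: "(z, w) \<in> R" "U z" for a b z w
  proof -
    have w: "U w" and b: "\<not> U b" using UR ab zw by blast+
    then have ne: "z \<noteq> a" "z \<noteq> b" "w \<noteq> a" "w \<noteq> b" using ab zw by auto
    have nr: "(z, a) \<notin> R" "(w, a) \<notin> R" "(a, z) \<notin> R" "(a, w) \<notin> R"
      using UR ab zw w by blast+
    have "(b, a) \<in> R" "(w, z) \<in> R" using s ab zw by blast+
    then show ?thesis
      using nc[of a b z w] nc[of a b w z] nc[of z w a b] nc[of w z a b] nr ne ab zw
      by (metis linorder_neqE_nat)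
  qed
  have key: "(a < z \<and> z < b) = (a < x \<and> x < b)"
    if ab: "(a, b) \<in> R" "\<not> U a" and z: "U z" for a b z
  proof -
    have "(a < x \<and> x < b) = (a < y \<and> y < b)"
      using side[OF ab] xy(3) by linarith
    then show ?thesis
      using z cross[OF ab, of x z] cross[OF ab, of y z] r unfolding U_def by auto
  qed
  have "(a, b) \<in> ?J" if h: "a < b" "b < c" "c < d" "(a, c) \<in> ?J" "(b, d) \<in> ?J" for a b c d
  proof (cases "U a \<longleftrightarrow> U b")
    case True
    then show ?thesis using h nc[of a c b d] unfolding J by blast
  next
    case False
    then consider "U a" "U c" "(b, d) \<in> R" "\<not> U b" | "U b" "U d" "(a, c) \<in> R" "\<not> U a"
      using h(4,5) UR unfolding J by blast
    then have False
      using key[of b d a] key[of b d c] key[of a c b] key[of a c d] h(1-3) by cases linarith+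
    then show ?thesis ..
  qed
  then show ?thesis
    using e unfolding nceq_def by blast
qed

section \<open>Cutting out a segment\<close>

abbreviation seg :: "nat set \<Rightarrow> nat \<Rightarrow> nat \<Rightarrow> nat set" where
  "seg A i j \<equiv> {x \<in> A. i \<le> x \<and> x < j}"

lemma restrict_nceq:
  assumes R: "R \<in> nceq A" and "B \<subseteq> A"
  shows "R \<inter> B \<times> B \<in> nceq B"
proof (rule nceqI)
  show "(x, x) \<in> R \<inter> B \<times> B" if "x \<in> B" for x
    using that nceq_refl[OF R] assms(2) by blast
  show "(y, x) \<in> R \<inter> B \<times> B" if "(x, y) \<in> R \<inter> B \<times> B" for x y
    using that nceq_sym[OF R] by blast
  show "(x, z) \<in> R \<inter> B \<times> B" if "(x, y) \<in> R \<inter> B \<times> B" "(y, z) \<in> R \<inter> B \<times> B" for x y z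
    using that nceq_trans[OF R] by blast
  show "(a, b) \<in> R \<inter> B \<times> B"
    if "a < b" "b < c" "c < d" "(a, c) \<in> R \<inter> B \<times> B" "(b, d) \<in> R \<inter> B \<times> B" for a b c d
    using that nceq_noncrossing[OF R] by blast
qed blast

text \<open>Of two interleaving pairs, each has a point between the two points of the other. Since
  \<open>seg A i j\<close> consists of all points of \<open>A\<close> in an interval, both pairs lie
  on the same side of the cut.\<close>

lemma Un_nceq:
  assumes S: "S \<in> nceq (seg A i j)" and T: "T \<in> nceq (A - seg A i j)"
  shows "S \<union> T \<in> nceq A"
proof (rule nceqI)
  note sub = nceq_subset[OF S] nceq_subset[OF T]
  show "S \<union> T \<subseteq> A \<times> A"
    using sub by auto
  show "(x, x) \<in> S \<union> T" if "x \<in> A" for x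
    using that nceq_refl[OF S, of x] nceq_refl[OF T, of x] by blast
  show "(y, x) \<in> S \<union> T" if "(x, y) \<in> S \<union> T" for x y
    using that nceq_sym[OF S] nceq_sym[OF T] by blast
  show "(x, z) \<in> S \<union> T" if "(x, y) \<in> S \<union> T" "(y, z) \<in> S \<union> T" for x y z
    using that nceq_trans[OF S, of x y z] nceq_trans[OF T, of x y z] sub[of x y] sub[of y z] by blast
  show "(a, b) \<in> S \<union> T"
    if "a < b" "b < c" "c < d" and ac: "(a, c) \<in> S \<union> T" and bd: "(b, d) \<in> S \<union> T" for a b c d
  proof -
    have "(a, c) \<in> S \<and> (b, d) \<in> S \<or> (a, c) \<in> T \<and> (b, d) \<in> T"
      using ac bd sub[of a c] sub[of b d] that(1-3) by auto
    then show ?thesis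
      using that(1-3) nceq_noncrossing[OF S, of a c b d] nceq_noncrossing[OF T, of a c b d] by blast
  qed
qed

text \<open>The half-open interval puts \<open>i\<close> into the segment and \<open>j\<close> into
  the remainder, so \<open>glue\<close> adds only pairs across the cut and leaves both restrictions
  unchanged.\<close>

lemma glue_segment:
  assumes S: "S \<in> nceq (seg A i j)" and T: "T \<in> nceq (A - seg A i j)"
    and ij: "i \<in> A" "j \<in> A" "i < j"
  shows "glue (S \<union> T) i j \<in> nceq A"
    "(i, j) \<in> glue (S \<union> T) i j"
    "glue (S \<union> T) i j \<inter> seg A i j \<times> seg A i j = S"
    "glue (S \<union> T) i j \<inter> (A - seg A i j) \<times> (A - seg A i j) = T"
proof -
  note sub = nceq_subset[OF S] nceq_subset[OF T]
  note U = Un_nceq[OF S T]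
  show "glue (S \<union> T) i j \<in> nceq A"
  proof (rule glue_nceq[OF U])
    fix a b assume "(a, b) \<in> S \<union> T" "i < a" "a < j"
    then show "i \<le> b \<and> b \<le> j"
      using sub[of a b] by auto
  qed (use ij in auto)
  show "(i, j) \<in> glue (S \<union> T) i j"
    using glue_mem[OF U] ij by blast
  have i: "(S \<union> T) `` {i} \<subseteq> seg A i j"
  proof
    fix b assume "b \<in> (S \<union> T) `` {i}"
    then show "b \<in> seg A i j" using sub[of i b] ij by auto
  qed
  have j: "(S \<union> T) `` {j} \<subseteq> A - seg A i j"
  proof
    fix b assume "b \<in> (S \<union> T) `` {j}"
    then show "b \<in> A - seg A i j" using sub[of j b] ij by auto
  qed
  have S': "S \<subseteq> seg A i j \<times> seg A i j" and T': "T \<subseteq> (A - seg A i j) \<times> (A - seg A i j)"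
    using sub by auto
  show "glue (S \<union> T) i j \<inter> seg A i j \<times> seg A i j = S"
    unfolding glue_def using S' T' i j by blast
  show "glue (S \<union> T) i j \<inter> (A - seg A i j) \<times> (A - seg A i j) = T"
    unfolding glue_def using S' T' i j by blast
qed

text \<open>A related pair across the cut belongs to the class of \<open>i\<close> and
  \<open>j\<close>, since its chord would otherwise cross the chord from \<open>i\<close> to
  \<open>j\<close>. Hence a single merging restores everything that the cut destroys.\<close>

lemma glue_restrictions:
  assumes R: "R \<in> nceq A" and ij: "(i, j) \<in> R" "i < j"
  shows "glue (R \<inter> seg A i j \<times> seg A i j \<union> R \<inter> (A - seg A i j) \<times> (A - seg A i j)) i j = R"
    (is "glue ?U i j = R")
proof
  show "glue ?U i j \<subseteq> R"
    by (rule glue_least[OF _ R ij(1)]) auto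
  have A: "i \<in> A" "j \<in> A" using nceq_subset[OF R ij(1)] by auto
  have cross: "(a, i) \<in> R \<and> (b, j) \<in> R"
    if ab: "(a, b) \<in> R" "a \<in> seg A i j" "b \<in> A - seg A i j" for a b
  proof -
    have "(a, i) \<in> R"
    proof (cases "a = i \<or> b = j")
      case True
      then show ?thesis using ab ij nceq_refl[OF R] nceq_sym[OF R] nceq_trans[OF R] A by meson
    next
      case False
      then consider "b < i" "i < a" "a < j" | "i < a" "a < j" "j < b" using ab by fastforce
      then show ?thesis
      proof cases
        case 1
        then have "(b, i) \<in> R"
          using nceq_noncrossing[OF R, of b a i j] nceq_sym[OF R] ab(1) ij by blast
        then show ?thesis using nceq_trans[OF R] ab(1) by blast
      next
        case 2
        then show ?thesis
          using nceq_noncrossing[OF R, of i j a b] nceq_sym[OF R] ab(1) ij by blast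
      qed
    qed
    then show ?thesis using nceq_trans[OF R] nceq_sym[OF R] ab(1) ij(1) by meson
  qed
  show "R \<subseteq> glue ?U i j"
  proof clarify
    fix a b assume ab: "(a, b) \<in> R"
    then have m: "a \<in> A" "b \<in> A" using nceq_subset[OF R] by auto
    have iA: "i \<in> seg A i j" "j \<in> A - seg A i j" using A ij by auto
    consider "a \<in> seg A i j" "b \<in> seg A i j" | "a \<in> seg A i j" "b \<in> A - seg A i j"
      | "a \<in> A - seg A i j" "b \<in> seg A i j" | "a \<in> A - seg A i j" "b \<in> A - seg A i j"
      using m by blast
    then show "(a, b) \<in> glue ?U i j"
    proof cases
      case 2
      then have "(a, i) \<in> R" "(b, j) \<in> R" using cross[OF ab] by auto
      then have "(i, a) \<in> ?U" "(j, b) \<in> ?U" using nceq_sym[OF R] 2 iA by blast+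
      then show ?thesis by (auto simp: glue_def)
    next
      case 3
      then have "(b, i) \<in> R" "(a, j) \<in> R" using cross[of b a] nceq_sym[OF R ab] by auto
      then have "(i, b) \<in> ?U" "(j, a) \<in> ?U" using nceq_sym[OF R] 3 iA by blast+
      then show ?thesis by (auto simp: glue_def)
    qed (use ab in \<open>auto simp: glue_def\<close>)
  qed
qed

text \<open>The independence of the two factors makes the later counts convolutions; the two ground
  sets partition \<open>A\<close>, so their sizes add up.\<close>

lemma bij_betw_split:
  assumes "i \<in> A" "j \<in> A" "i < j"
  shows "bij_betw (\<lambda>R. (R \<inter> seg A i j \<times> seg A i j, R \<inter> (A - seg A i j) \<times> (A - seg A i j)))
    {R \<in> nceq A. (i, j) \<in> R} (nceq (seg A i j) \<times> nceq (A - seg A i j))"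
proof (rule bij_betw_byWitness[where f' = "\<lambda>(S, T). glue (S \<union> T) i j"])
  show "\<forall>R\<in>{R \<in> nceq A. (i, j) \<in> R}.
      (case (R \<inter> seg A i j \<times> seg A i j, R \<inter> (A - seg A i j) \<times> (A - seg A i j)) of
        (S, T) \<Rightarrow> glue (S \<union> T) i j) = R"
    using glue_restrictions assms(3) by auto
  show "\<forall>a'\<in>nceq (seg A i j) \<times> nceq (A - seg A i j).
       ((case a' of (S, T) \<Rightarrow> glue (S \<union> T) i j) \<inter> seg A i j \<times> seg A i j,
        (case a' of (S, T) \<Rightarrow> glue (S \<union> T) i j) \<inter> (A - seg A i j) \<times> (A - seg A i j)) = a'"
  proof
    fix p assume "p \<in> nceq (seg A i j) \<times> nceq (A - seg A i j)"
    then obtain S T where p: "p = (S, T)" "S \<in> nceq (seg A i j)" "T \<in> nceq (A - seg A i j)"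
      by blast
    show "((case p of (S, T) \<Rightarrow> glue (S \<union> T) i j) \<inter> seg A i j \<times> seg A i j,
        (case p of (S, T) \<Rightarrow> glue (S \<union> T) i j) \<inter> (A - seg A i j) \<times> (A - seg A i j)) = p"
      unfolding p(1) using glue_segment(3,4)[OF p(2,3) assms] by (simp only: prod.case)
  qed
  show "(\<lambda>R. (R \<inter> seg A i j \<times> seg A i j, R \<inter> (A - seg A i j) \<times> (A - seg A i j))) `
      {R \<in> nceq A. (i, j) \<in> R} \<subseteq> nceq (seg A i j) \<times> nceq (A - seg A i j)"
    using restrict_nceq[of _ A "seg A i j"] restrict_nceq[of _ A "A - seg A i j"] by blast
  show "(\<lambda>(S, T). glue (S \<union> T) i j) ` (nceq (seg A i j) \<times> nceq (A - seg A i j))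
      \<subseteq> {R \<in> nceq A. (i, j) \<in> R}"
    using glue_segment(1,2)[of _ A i j] assms by auto
qed

definition isolated :: "nat set \<Rightarrow> (nat \<times> nat) set set" where
  "isolated A = {R \<in> nceq A. \<forall>k. (Min A, k) \<in> R \<longrightarrow> k = Min A}"

text \<open>Cutting a pair of relations at the elements of the class of the minimum in the meet decomposes it uniquely
  into pairs whose minimum is isolated. For generating functions \<open>A\<close> of all pairs and \<open>B\<close> of the isolated ones
  this is \<open>A = 1 / (1 - B)\<close>.\<close>

definition isolated2 :: "nat set \<Rightarrow> ((nat \<times> nat) set \<times> (nat \<times> nat) set) set" where
  "isolated2 A = {(R, Q) \<in> nceq A \<times> nceq A. \<forall>k. (Min A, k) \<in> R \<inter> Q \<longrightarrow> k = Min A}"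

lemma Min_seg: "finite A \<Longrightarrow> i \<in> A \<Longrightarrow> i < j \<Longrightarrow> Min (seg A i j) = i"
  by (rule Min_eqI) auto

definition consecutive :: "('a::linorder \<times> 'a) set \<Rightarrow> 'a \<Rightarrow> 'a \<Rightarrow> bool" where
  "consecutive R i j \<longleftrightarrow> (i, j) \<in> R \<and> i < j \<and> (\<forall>k. i < k \<and> k < j \<longrightarrow> (i, k) \<notin> R)"

text \<open>As \<open>i\<close> is the minimum of the segment and \<open>j\<close> lies just
  outside, having no relative of \<open>i\<close> between them means that \<open>i\<close> is alone
  in its class within the segment.\<close>

lemma consecutive_seg_iff:
  assumes "R \<in> nceq A" "finite A" "i \<in> A" "i < j" "(i, j) \<in> R"
  shows "consecutive R i j \<longleftrightarrow>
    (\<forall>k. (Min (seg A i j), k) \<in> R \<inter> seg A i j \<times> seg A i j \<longrightarrow> k = Min (seg A i j))"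
  using assms nceq_subset[OF assms(1), of i] unfolding Min_seg[OF assms(2-4)] consecutive_def
  by (auto simp: le_less)

lemma card_consecutive:
  assumes A: "finite A" "i \<in> A" "j \<in> A" "i < j"
  shows "card {R \<in> nceq A. consecutive R i j} =
    card (isolated (seg A i j)) * card (nceq (A - seg A i j))"
proof -
  let ?f = "\<lambda>R. (R \<inter> seg A i j \<times> seg A i j, R \<inter> (A - seg A i j) \<times> (A - seg A i j))"
  note bij = bij_betw_split[OF A(2-4)]
  have "?f ` {R \<in> nceq A. consecutive R i j} = isolated (seg A i j) \<times> nceq (A - seg A i j)"
    (is "?f ` ?P = ?Q")
  proof
    show "?f ` ?P \<subseteq> ?Q"
    proof
      fix p assume "p \<in> ?f ` ?P"
      then obtain R where R: "R \<in> nceq A" "consecutive R i j" "p = ?f R" by blast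
      then have ij: "(i, j) \<in> R" by (simp add: consecutive_def)
      show "p \<in> ?Q"
        using bij_betwE[OF bij, rule_format, of R] R ij consecutive_seg_iff[OF R(1) A(1,2,4) ij]
        by (simp add: isolated_def)
    qed
    show "?Q \<subseteq> ?f ` ?P"
    proof
      fix p assume p: "p \<in> ?Q"
      then have "p \<in> nceq (seg A i j) \<times> nceq (A - seg A i j)"
        by (auto simp: isolated_def)
      then obtain R where R: "R \<in> nceq A" "(i, j) \<in> R" "p = ?f R"
        using bij_betw_imp_surj_on[OF bij] by blast
      then have "consecutive R i j"
        using p consecutive_seg_iff[OF R(1) A(1,2,4) R(2)] by (simp add: isolated_def)
      then show "p \<in> ?f ` ?P"
        using R by blast
    qed
  qed
  moreover have "inj_on ?f ?P"
    by (rule inj_on_subset[OF bij_betw_imp_inj_on[OF bij]]) (auto simp: consecutive_def)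
  ultimately have "card ?P = card ?Q"
    using card_image[of ?f ?P] by simp
  then show ?thesis
    by (simp add: card_cartesian_product)
qed

text \<open>A pair that is consecutive in the meet lies in both relations, so both are split at the
  same place. The condition on intermediate points concerns the two segment factors jointly and
  gives \<open>isolated2\<close>; the two remainders are free, whence the square.\<close>

lemma card_consecutive2:
  assumes A: "finite A" "i \<in> A" "j \<in> A" "i < j"
  shows "card {(R, Q) \<in> nceq A \<times> nceq A. consecutive (R \<inter> Q) i j} =
    card (isolated2 (seg A i j)) * card (nceq (A - seg A i j)) ^ 2"
proof -
  let ?I = "seg A i j" and ?K = "A - seg A i j"
  let ?f = "\<lambda>R. (R \<inter> ?I \<times> ?I, R \<inter> ?K \<times> ?K)"
  let ?g = "\<lambda>(R, Q). ((R \<inter> ?I \<times> ?I, Q \<inter> ?I \<times> ?I), (R \<inter> ?K \<times> ?K, Q \<inter> ?K \<times> ?K))"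
  note bij = bij_betw_split[OF A(2-4)]
  have iff: "consecutive (R \<inter> Q) i j \<longleftrightarrow> (\<forall>k. (Min ?I, k) \<in> (R \<inter> ?I \<times> ?I) \<inter> (Q \<inter> ?I \<times> ?I) \<longrightarrow> k = Min ?I)"
    if "R \<in> nceq A" "Q \<in> nceq A" "(i, j) \<in> R" "(i, j) \<in> Q" for R Q
    using consecutive_seg_iff[OF Int_nceq[OF that(1,2)] A(1,2,4)] that(3,4) by auto
  have "?g ` {(R, Q) \<in> nceq A \<times> nceq A. consecutive (R \<inter> Q) i j} = isolated2 ?I \<times> (nceq ?K \<times> nceq ?K)"
    (is "?g ` ?P = ?Q")
  proof
    show "?g ` ?P \<subseteq> ?Q"
    proof
      fix p assume "p \<in> ?g ` ?P"
      then obtain R Q where R: "R \<in> nceq A" "Q \<in> nceq A" "consecutive (R \<inter> Q) i j" "p = ?g (R, Q)"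
        by blast
      then have ij: "(i, j) \<in> R" "(i, j) \<in> Q" by (simp_all add: consecutive_def)
      show "p \<in> ?Q"
        using bij_betwE[OF bij, rule_format, of R] bij_betwE[OF bij, rule_format, of Q] R ij iff[OF R(1,2) ij]
        by (simp add: isolated2_def)
    qed
    show "?Q \<subseteq> ?g ` ?P"
    proof
      fix p assume p: "p \<in> ?Q"
      obtain S S' T T' where pe: "p = ((S, S'), (T, T'))"
        by (metis surj_pair)
      have p': "(S, S') \<in> isolated2 ?I" "T \<in> nceq ?K" "T' \<in> nceq ?K"
        using p unfolding pe by blast+
      then have "(S, T) \<in> nceq ?I \<times> nceq ?K" "(S', T') \<in> nceq ?I \<times> nceq ?K"
        by (auto simp: isolated2_def)
      then have "(S, T) \<in> ?f ` {R \<in> nceq A. (i, j) \<in> R}" "(S', T') \<in> ?f ` {R \<in> nceq A. (i, j) \<in> R}"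
        unfolding bij_betw_imp_surj_on[OF bij] by blast+
      then obtain R Q where R: "R \<in> nceq A" "(i, j) \<in> R" "(S, T) = ?f R"
        and Q: "Q \<in> nceq A" "(i, j) \<in> Q" "(S', T') = ?f Q"
        by blast
      then have "consecutive (R \<inter> Q) i j"
        using p'(1) iff[OF R(1) Q(1) R(2) Q(2)] by (simp add: isolated2_def)
      moreover have "p = ?g (R, Q)"
        using pe R(3) Q(3) by simp
      ultimately show "p \<in> ?g ` ?P"
        using R(1) Q(1) by blast
    qed
  qed
  moreover have "inj_on ?g ?P"
  proof (rule inj_onI)
    fix p q assume p: "p \<in> ?P" and q: "q \<in> ?P" and eq: "?g p = ?g q"
    obtain R Q R' Q' where pq: "p = (R, Q)" "q = (R', Q')" by (metis surj_pair)
    have "?f R = ?f R'" "?f Q = ?f Q'" using eq unfolding pq by simp_all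
    moreover have "R \<in> {R \<in> nceq A. (i, j) \<in> R}" "R' \<in> {R \<in> nceq A. (i, j) \<in> R}"
      "Q \<in> {R \<in> nceq A. (i, j) \<in> R}" "Q' \<in> {R \<in> nceq A. (i, j) \<in> R}"
      using p q unfolding pq by (auto simp: consecutive_def)
    ultimately have "R = R'" "Q = Q'"
      using inj_onD[OF bij_betw_imp_inj_on[OF bij], of R R']
        inj_onD[OF bij_betw_imp_inj_on[OF bij], of Q Q'] by simp_all
    then show "p = q" using pq by simp
  qed
  ultimately have "card ?P = card ?Q"
    using card_image[of ?g ?P] by simp
  then show ?thesis
    by (simp add: card_cartesian_product power2_eq_square)
qed

fun catalan :: "nat \<Rightarrow> nat" where
  "catalan 0 = 1"
| "catalan (Suc n) = (\<Sum>k\<le>n. catalan k * catalan (n - k))"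

lemma bij_betw_rank:
  fixes A :: "nat set"
  assumes "finite A"
  shows "bij_betw (\<lambda>j. card {x \<in> A. x < j}) A {..<card A}"
proof -
  have less: "card {x \<in> A. x < i} < card {x \<in> A. x < j}" if "i \<in> A" "j \<in> A" "i < j" for i j
  proof (rule psubset_card_mono)
    show "{x \<in> A. x < i} \<subset> {x \<in> A. x < j}"
      using that by auto
  qed (use assms in auto)
  then have inj: "inj_on (\<lambda>j. card {x \<in> A. x < j}) A"
    by (intro inj_onI) (metis (no_types, lifting) less_irrefl linorder_neqE_nat)
  moreover have "(\<lambda>j. card {x \<in> A. x < j}) ` A \<subseteq> {..<card A}"
  proof clarify
    fix j assume "j \<in> A"
    then have "{x \<in> A. x < j} \<subset> A" by auto
    then show "card {x \<in> A. x < j} < card A"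
      using assms psubset_card_mono by blast
  qed
  ultimately have "(\<lambda>j. card {x \<in> A. x < j}) ` A = {..<card A}"
    by (intro card_subset_eq) (auto simp: card_image)
  with inj show ?thesis
    by (auto simp: bij_betw_def)
qed

text \<open>The segment from the minimum to \<open>j\<close> has as many elements as
  \<open>A\<close> has below \<open>j\<close>, and this rank takes every value once.\<close>

lemma sum_over_seg_Min:
  fixes f :: "nat \<Rightarrow> nat"
  assumes "finite A" "A \<noteq> {}"
  shows "(\<Sum>j\<in>A - {Min A}. f (card (seg A (Min A) j))) = (\<Sum>s=1..<card A. f s)"
proof -
  have e: "seg A (Min A) j = {x \<in> A. x < j}" for j
    using assms by auto
  have "{x \<in> A. x < Min A} = {}"
    using assms by auto
  then have "card {x \<in> A. x < Min A} = 0"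
    by (simp only: card.empty)
  moreover have "bij_betw (\<lambda>j. card {x \<in> A. x < j}) (A - {Min A}) ({..<card A} - {card {x \<in> A. x < Min A}})"
    using Min_in[OF assms] bij_betwE[OF bij_betw_rank[OF assms(1)]]
    by (intro bij_betw_DiffI[OF bij_betw_rank[OF assms(1)]]) (auto simp: bij_betw_singleton_iff)
  ultimately have "bij_betw (\<lambda>j. card {x \<in> A. x < j}) (A - {Min A}) ({..<card A} - {0})"
    by (simp only:)
  moreover have "{..<card A} - {0} = {1..<card A}"
    by auto
  ultimately have "bij_betw (\<lambda>j. card {x \<in> A. x < j}) (A - {Min A}) {1..<card A}"
    by (simp only:)
  then show ?thesis
    unfolding e by (rule sum.reindex_bij_betw)
qed

lemma nceq_empty: "nceq {} = {{}}"
  unfolding nceq_def by (auto simp: equiv_def refl_on_def sym_def trans_def)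

lemma card_isolated:
  assumes A: "finite A" "A \<noteq> {}"
  shows "card (isolated A) = card (nceq (A - {Min A}))"
proof -
  let ?m = "Min A"
  let ?B = "A - {?m}"
  have m: "?m \<in> A" "\<And>x. x \<in> A \<Longrightarrow> ?m \<le> x" using A by auto
  have "bij_betw (\<lambda>R. R \<inter> ?B \<times> ?B) (isolated A) (nceq ?B)"
  proof (rule bij_betw_byWitness[where f' = "\<lambda>S. insert (?m, ?m) S"])
    show "\<forall>R\<in>isolated A. insert (?m, ?m) (R \<inter> ?B \<times> ?B) = R"
    proof
      fix R assume "R \<in> isolated A"
      then have R: "R \<in> nceq A" and k: "\<And>k. (?m, k) \<in> R \<Longrightarrow> k = ?m" by (auto simp: isolated_def)
      show "insert (?m, ?m) (R \<inter> ?B \<times> ?B) = R"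
        using k nceq_subset[OF R] nceq_sym[OF R] nceq_refl[OF R m(1)] by auto
    qed
    show "\<forall>S\<in>nceq ?B. insert (?m, ?m) S \<inter> ?B \<times> ?B = S"
    proof
      fix S assume "S \<in> nceq ?B"
      then have "S \<subseteq> ?B \<times> ?B" using nceq_equiv equiv_type by blast
      then show "insert (?m, ?m) S \<inter> ?B \<times> ?B = S" by auto
    qed
    show "(\<lambda>R. R \<inter> ?B \<times> ?B) ` isolated A \<subseteq> nceq ?B"
      using restrict_nceq[of _ A ?B] unfolding isolated_def by blast
    show "insert (?m, ?m) ` nceq ?B \<subseteq> isolated A"
    proof
      fix R assume "R \<in> insert (?m, ?m) ` nceq ?B"
      then obtain S where S: "S \<in> nceq ?B" and R: "R = insert (?m, ?m) S" by blast
      note sub = nceq_subset[OF S]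
      have "R \<in> nceq A"
      proof (rule nceqI)
        show "R \<subseteq> A \<times> A" unfolding R using sub m by auto
        show "(x, x) \<in> R" if "x \<in> A" for x unfolding R using that nceq_refl[OF S] by auto
        show "(y, x) \<in> R" if "(x, y) \<in> R" for x y using that nceq_sym[OF S] unfolding R by blast
        show "(x, z) \<in> R" if "(x, y) \<in> R" "(y, z) \<in> R" for x y z
          using that nceq_trans[OF S, of x y z] sub[of x y] sub[of y z] unfolding R by auto
        show "(a, b) \<in> R" if "a < b" "b < c" "c < d" "(a, c) \<in> R" "(b, d) \<in> R" for a b c d
          using that nceq_noncrossing[OF S, of a c b d] unfolding R by auto
      qed
      then show "R \<in> isolated A"
        using sub[of ?m] unfolding R isolated_def by blast
    qed
  qed
  then show ?thesis by (rule bij_betw_same_card)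
qed

section \<open>Recursions through the successor of the minimum\<close>

lemma consecutive_ex:
  fixes m :: nat
  assumes "(m, k) \<in> R" "m < k"
  shows "\<exists>j. consecutive R m j"
proof -
  let ?j = "LEAST j. (m, j) \<in> R \<and> m < j"
  have "(m, ?j) \<in> R \<and> m < ?j" by (rule LeastI[of _ k]) (use assms in auto)
  then have "consecutive R m ?j"
    unfolding consecutive_def using not_less_Least[of _ "\<lambda>j. (m, j) \<in> R \<and> m < j"] by blast
  then show ?thesis ..
qed

lemma consecutive_unique:
  "consecutive R m i \<Longrightarrow> consecutive R m j \<Longrightarrow> i = j"
  unfolding consecutive_def by (meson linorder_less_linear)

lemma consecutive_ex_left:
  fixes m :: nat
  assumes R: "R \<in> nceq A" and "(k, m) \<in> R" "k < m"
  shows "\<exists>j. consecutive R j m"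
proof -
  let ?j = "GREATEST j. (j, m) \<in> R \<and> j < m"
  have "(?j, m) \<in> R \<and> ?j < m" by (rule GreatestI_nat[of _ k m]) (use assms in auto)
  moreover have "(?j, k) \<notin> R" if "?j < k" "k < m" for k
  proof
    assume "(?j, k) \<in> R"
    then have "(k, m) \<in> R" using calculation R nceq_sym nceq_trans by meson
    then show False
      using that Greatest_le_nat[of "\<lambda>j. (j, m) \<in> R \<and> j < m" k m] by auto
  qed
  ultimately show ?thesis unfolding consecutive_def by blast
qed

lemma consecutive_unique_left:
  assumes "R \<in> nceq A" "consecutive R i m" "consecutive R j m"
  shows "i = j"
  using assms nceq_sym[OF assms(1)] nceq_trans[OF assms(1)] unfolding consecutive_def
  by (metis linorder_neqE)

text \<open>Case distinction on the successor of the minimum in its class, if there is one; each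
  case is counted by \<open>card_consecutive\<close>.\<close>

lemma card_nceq_rec:
  assumes A: "finite A" "A \<noteq> {}"
  shows "card (nceq A) = card (isolated A) +
    (\<Sum>j\<in>A - {Min A}. card (isolated (seg A (Min A) j)) * card (nceq (A - seg A (Min A) j)))"
proof -
  let ?m = "Min A"
  let ?P = "\<lambda>j. {R \<in> nceq A. consecutive R ?m j}"
  have m: "?m \<in> A" "\<And>x. x \<in> A \<Longrightarrow> ?m \<le> x" using A by auto
  have "nceq A = isolated A \<union> (\<Union>j\<in>A - {?m}. ?P j)"
  proof
    show "nceq A \<subseteq> isolated A \<union> (\<Union>j\<in>A - {?m}. ?P j)"
    proof
      fix R assume R: "R \<in> nceq A"
      show "R \<in> isolated A \<union> (\<Union>j\<in>A - {?m}. ?P j)"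
      proof (cases "R \<in> isolated A")
        case False
        then obtain k where "(?m, k) \<in> R" "k \<noteq> ?m" using R by (auto simp: isolated_def)
        then have "?m < k" using m nceq_subset[OF R] by (metis le_neq_implies_less)
        then obtain j where j: "consecutive R ?m j" using \<open>(?m, k) \<in> R\<close> consecutive_ex by blast
        then have "j \<in> A - {?m}" using nceq_subset[OF R] by (auto simp: consecutive_def)
        then show ?thesis using j R by blast
      qed blast
    qed
  qed (auto simp: isolated_def)
  moreover have "isolated A \<inter> (\<Union>j\<in>A - {?m}. ?P j) = {}"
    by (auto simp: isolated_def consecutive_def)
  moreover have "finite (isolated A)" "finite (\<Union>j\<in>A - {?m}. ?P j)"
    using A by (auto simp: isolated_def finite_nceq)
  ultimately have "card (nceq A) = card (isolated A) + card (\<Union>j\<in>A - {?m}. ?P j)"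
    using card_Un_disjoint[of "isolated A" "\<Union>j\<in>A - {?m}. ?P j"] by (simp only:)
  also have "card (\<Union>j\<in>A - {?m}. ?P j) = (\<Sum>j\<in>A - {?m}. card (?P j))"
    using A by (intro card_UN_disjoint) (auto simp: finite_nceq dest: consecutive_unique)
  also have "\<dots> = (\<Sum>j\<in>A - {?m}. card (isolated (seg A ?m j)) * card (nceq (A - seg A ?m j)))"
    using m by (intro sum.cong card_consecutive[OF A(1) m(1)]) (auto simp: le_neq_implies_less)
  finally show ?thesis .
qed

lemma card_nceq2_rec:
  assumes A: "finite A" "A \<noteq> {}"
  shows "card (nceq A) ^ 2 = card (isolated2 A) +
    (\<Sum>j\<in>A - {Min A}. card (isolated2 (seg A (Min A) j)) * card (nceq (A - seg A (Min A) j)) ^ 2)"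
proof -
  let ?m = "Min A"
  let ?P = "\<lambda>j. {(R, Q) \<in> nceq A \<times> nceq A. consecutive (R \<inter> Q) ?m j}"
  have m: "?m \<in> A" "\<And>x. x \<in> A \<Longrightarrow> ?m \<le> x" using A by auto
  have "nceq A \<times> nceq A = isolated2 A \<union> (\<Union>j\<in>A - {?m}. ?P j)"
  proof
    show "nceq A \<times> nceq A \<subseteq> isolated2 A \<union> (\<Union>j\<in>A - {?m}. ?P j)"
    proof clarify
      fix R Q assume R: "R \<in> nceq A" and Q: "Q \<in> nceq A" and no: "(R, Q) \<notin> (\<Union>j\<in>A - {?m}. ?P j)"
      show "(R, Q) \<in> isolated2 A"
      proof (rule ccontr)
        assume "(R, Q) \<notin> isolated2 A"
        then obtain k where k: "(?m, k) \<in> R \<inter> Q" "k \<noteq> ?m" using R Q by (auto simp: isolated2_def)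
        then have "?m < k" using m nceq_subset[OF R] by (metis IntD1 le_neq_implies_less)
        then obtain j where j: "consecutive (R \<inter> Q) ?m j" using k consecutive_ex by blast
        then have "j \<in> A - {?m}" using nceq_subset[OF R] by (auto simp: consecutive_def)
        then show False using j R Q no by blast
      qed
    qed
  qed (auto simp: isolated2_def)
  moreover have "isolated2 A \<inter> (\<Union>j\<in>A - {?m}. ?P j) = {}"
    by (auto simp: isolated2_def consecutive_def)
  moreover have fin: "finite (nceq A \<times> nceq A)"
    using A by (simp add: finite_nceq)
  moreover have "finite (isolated2 A)" "finite (\<Union>j\<in>A - {?m}. ?P j)"
    by (rule finite_subset[OF _ fin]; auto simp: isolated2_def)+
  ultimately have "card (nceq A \<times> nceq A) = card (isolated2 A) + card (\<Union>j\<in>A - {?m}. ?P j)"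
    using card_Un_disjoint[of "isolated2 A" "\<Union>j\<in>A - {?m}. ?P j"] by (simp only:)
  also have "card (\<Union>j\<in>A - {?m}. ?P j) = (\<Sum>j\<in>A - {?m}. card (?P j))"
  proof (rule card_UN_disjoint)
    show "\<forall>j\<in>A - {?m}. finite (?P j)"
      by (intro ballI finite_subset[OF _ fin]) auto
  qed (use A in \<open>auto dest: consecutive_unique\<close>)
  also have "\<dots> = (\<Sum>j\<in>A - {?m}. card (isolated2 (seg A ?m j)) * card (nceq (A - seg A ?m j)) ^ 2)"
    using m by (intro sum.cong card_consecutive2[OF A(1) m(1)]) (auto simp: le_neq_implies_less)
  finally show ?thesis
    by (simp add: card_cartesian_product power2_eq_square)
qed

section \<open>Enumeration\<close>

lemma card_seg_compl:
  "finite A \<Longrightarrow> card (A - seg A i j) = card A - card (seg A i j)"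
  by (intro card_Diff_subset) auto

lemma card_seg_bounds:
  assumes "finite A" "i \<in> A" "j \<in> A" "i < j"
  shows "card (seg A i j) > 0" "card (seg A i j) < card A"
proof -
  show "card (seg A i j) > 0"
    using assms by (subst card_gt_0_iff) auto
  show "card (seg A i j) < card A"
    by (rule psubset_card_mono) (use assms in auto)
qed

lemma card_nceq: "finite A \<Longrightarrow> card (nceq A) = catalan (card A)"
proof (induction "card A" arbitrary: A rule: less_induct)
  case less
  show ?case
  proof (cases "A = {}")
    case True
    then show ?thesis by (simp add: nceq_empty)
  next
    case False
    let ?m = "Min A"
    obtain n where n: "card A = Suc n"
      using False less.prems by (metis card_gt_0_iff gr0_implies_Suc)
    have m: "?m \<in> A" "\<And>x. x \<in> A \<Longrightarrow> ?m \<le> x" using False less.prems by auto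
    have iso: "card (isolated B) = catalan (card B - 1)" if "B \<noteq> {}" "B \<subseteq> A" for B
    proof -
      have B: "finite B" using that less.prems finite_subset by blast
      have mB: "Min B \<in> B" using B that by simp
      have "card (B - {Min B}) < card A"
        using card_mono[OF less.prems that(2)] card_Diff1_less[OF B mB] by linarith
      then have "card (nceq (B - {Min B})) = catalan (card (B - {Min B}))"
        using less.hyps[of "B - {Min B}"] B by simp
      then show ?thesis
        using card_isolated[OF B that(1)] mB B by (simp add: card_Diff_singleton)
    qed
    have "card (isolated (seg A ?m j)) * card (nceq (A - seg A ?m j)) =
        catalan (card (seg A ?m j) - 1) * catalan (Suc n - card (seg A ?m j))" if "j \<in> A - {?m}" for j
    proof -
      have j: "j \<in> A" "?m < j" using that m(2)[of j] by auto
      note b = card_seg_bounds[OF less.prems m(1) j]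
      have "seg A ?m j \<noteq> {}" using m(1) j by auto
      then have "card (isolated (seg A ?m j)) = catalan (card (seg A ?m j) - 1)"
        by (intro iso) auto
      moreover have "card (nceq (A - seg A ?m j)) = catalan (Suc n - card (seg A ?m j))"
        using less.hyps[of "A - seg A ?m j"] less.prems b
        by (simp add: card_seg_compl[OF less.prems] n)
      ultimately show ?thesis by simp
    qed
    then have "card (nceq A) = catalan n + (\<Sum>j\<in>A - {?m}. catalan (card (seg A ?m j) - 1) * catalan (Suc n - card (seg A ?m j)))"
      using card_nceq_rec[OF less.prems False] iso[OF False order_refl] n by simp
    also have "\<dots> = catalan n + (\<Sum>s=1..<Suc n. catalan (s - 1) * catalan (Suc n - s))"
      using sum_over_seg_Min[OF less.prems False, of "\<lambda>s. catalan (s - 1) * catalan (Suc n - s)"] n by simp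
    also have "(\<Sum>s=1..<Suc n. catalan (s - 1) * catalan (Suc n - s)) = (\<Sum>k<n. catalan k * catalan (n - k))"
      using sum.shift_bounds_Suc_ivl[of "\<lambda>s. catalan (s - 1) * catalan (Suc n - s)" 0 n]
      by (simp add: atLeast0LessThan)
    \<comment> \<open>An isolated minimum supplies the missing summand k = n of the
      convolution.\<close>
    also have "catalan n + \<dots> = catalan (Suc n)"
      by (simp add: lessThan_Suc_atMost[symmetric])
    finally show ?thesis using n by simp
  qed
qed

lemma card_isolated_eq:
  assumes "finite A" "A \<noteq> {}"
  shows "card (isolated A) = catalan (card A - 1)"
  using card_isolated[OF assms] assms by (simp add: card_nceq card_Diff_singleton)

definition isolated2_count :: "nat \<Rightarrow> nat" where
  "isolated2_count n = card (isolated2 {1..n})"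

text \<open>\<open>card_nceq2_rec\<close> expresses \<open>card (isolated2 A)\<close> through
  smaller sets and through \<open>card (nceq A)\<close>, which depends on the size of
  \<open>A\<close> alone. So independence from the ground set and the convolution identity come out
  of one induction, without a bijection between ground sets.\<close>

lemma card_isolated2_catalan_square:
  "finite A \<Longrightarrow> A \<noteq> {} \<Longrightarrow> card (isolated2 A) = isolated2_count (card A) \<and>
    catalan (card A) ^ 2 = (\<Sum>s=1..card A. isolated2_count s * catalan (card A - s) ^ 2)"
proof (induction "card A" arbitrary: A rule: less_induct)
  case less
  have rec: "catalan (card B) ^ 2 = card (isolated2 B) + (\<Sum>s=1..<card A. isolated2_count s * catalan (card A - s) ^ 2)"
    if B: "finite B" "B \<noteq> {}" "card B = card A" for B
  proof -
    let ?m = "Min B"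
    have m: "?m \<in> B" "\<And>x. x \<in> B \<Longrightarrow> ?m \<le> x" using B by auto
    have "card (isolated2 (seg B ?m j)) * card (nceq (B - seg B ?m j)) ^ 2 =
        isolated2_count (card (seg B ?m j)) * catalan (card A - card (seg B ?m j)) ^ 2" if "j \<in> B - {?m}" for j
    proof -
      have j: "j \<in> B" "?m < j" using that m(2)[of j] by auto
      note b = card_seg_bounds[OF B(1) m(1) j]
      have "seg B ?m j \<noteq> {}" using m(1) j by auto
      then have "card (isolated2 (seg B ?m j)) = isolated2_count (card (seg B ?m j))"
        using less.hyps(1)[of "seg B ?m j"] b B by simp
      then show ?thesis
        using B by (simp add: card_nceq card_seg_compl)
    qed
    then show ?thesis
      using card_nceq2_rec[OF B(1,2)] sum_over_seg_Min[OF B(1,2), of "\<lambda>s. isolated2_count s * catalan (card A - s) ^ 2"] B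
      by (simp add: card_nceq)
  qed
  have pos: "card A > 0" using less.prems by (simp add: card_gt_0_iff)
  have "{1..card A} \<noteq> {}" using pos by auto
  then have "card (isolated2 {1..card A}) = card (isolated2 A)"
    using rec[of A] rec[of "{1..card A}"] less.prems by simp
  then have 1: "card (isolated2 A) = isolated2_count (card A)"
    by (simp add: isolated2_count_def)
  \<comment> \<open>The isolated pairs themselves become the summand s = \<open>card A\<close>, with
    cofactor \<open>catalan 0\<close> squared.\<close>
  have "{1..card A} = insert (card A) {1..<card A}" using pos by auto
  then have "catalan (card A) ^ 2 = (\<Sum>s=1..card A. isolated2_count s * catalan (card A - s) ^ 2)"
    using rec[of A] less.prems 1 by simp
  with 1 show ?case ..
qed

lemma card_isolated2_eq:
  "finite A \<Longrightarrow> A \<noteq> {} \<Longrightarrow> card (isolated2 A) = isolated2_count (card A)"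
  using card_isolated2_catalan_square by blast

lemma catalan_square: "n > 0 \<Longrightarrow> catalan n ^ 2 = (\<Sum>s=1..n. isolated2_count s * catalan (n - s) ^ 2)"
  using card_isolated2_catalan_square[of "{1..n}"] by simp

section \<open>Counting points that are not extreme in their class\<close>

lemma seg_atLeastAtMost:
  "i \<in> {1..n} \<Longrightarrow> j \<in> {1..n} \<Longrightarrow> seg {1..n} i j = {i..<j}"
  by auto

text \<open>Wherever the segment lies, \<open>n - (j - i)\<close> points remain after the cut, so
  the count depends on the distance alone.\<close>

lemma card_consecutive_interval:
  assumes "i \<in> {1..n}" "j \<in> {1..n}" "i < j"
  shows "card {R \<in> nceq {1..n}. consecutive R i j} = catalan (j - i - 1) * catalan (n - (j - i))"
proof -
  have "card ({1..n} - {i..<j}) = n - (j - i)"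
    using assms by (subst card_Diff_subset) auto
  moreover have "{i..<j} \<noteq> {}"
    using assms by simp
  ultimately show ?thesis
    using card_consecutive[OF _ assms] unfolding seg_atLeastAtMost[OF assms(1,2)]
    by (simp add: card_nceq card_isolated_eq)
qed

lemma card_consecutive2_interval:
  assumes "i \<in> {1..n}" "j \<in> {1..n}" "i < j"
  shows "card {(R, Q) \<in> nceq {1..n} \<times> nceq {1..n}. consecutive (R \<inter> Q) i j} =
    isolated2_count (j - i) * catalan (n - (j - i)) ^ 2"
proof -
  have "card ({1..n} - {i..<j}) = n - (j - i)"
    using assms by (subst card_Diff_subset) auto
  moreover have "{i..<j} \<noteq> {}"
    using assms by simp
  ultimately show ?thesis
    using card_consecutive2[OF _ assms] unfolding seg_atLeastAtMost[OF assms(1,2)]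
    by (simp add: card_nceq card_isolated2_eq)
qed

text \<open>Such a point has a unique predecessor in its class; the index \<open>s\<close> is the
  distance to it.\<close>

lemma card_not_least:
  assumes "v \<in> {1..n}"
  shows "card {R \<in> nceq {1..n}. \<exists>k<v. (k, v) \<in> R} = (\<Sum>s=1..<v. catalan (s - 1) * catalan (n - s))"
proof -
  have "{R \<in> nceq {1..n}. \<exists>k<v. (k, v) \<in> R} = (\<Union>i\<in>{1..<v}. {R \<in> nceq {1..n}. consecutive R i v})"
  proof (intro set_eqI iffI)
    fix R assume "R \<in> {R \<in> nceq {1..n}. \<exists>k<v. (k, v) \<in> R}"
    then obtain i where R: "R \<in> nceq {1..n}" and i: "consecutive R i v"
      using consecutive_ex_left by blast
    then have "i \<in> {1..<v}" using nceq_subset[OF R] by (auto simp: consecutive_def)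
    then show "R \<in> (\<Union>i\<in>{1..<v}. {R \<in> nceq {1..n}. consecutive R i v})"
      using R i by blast
  qed (auto simp: consecutive_def)
  also have "card \<dots> = (\<Sum>i=1..<v. card {R \<in> nceq {1..n}. consecutive R i v})"
    by (intro card_UN_disjoint) (auto simp: finite_nceq dest: consecutive_unique_left)
  also have "\<dots> = (\<Sum>i=1..<v. catalan (v - i - 1) * catalan (n - (v - i)))"
    using assms by (intro sum.cong card_consecutive_interval) auto
  also have "\<dots> = (\<Sum>s=1..<v. catalan (s - 1) * catalan (n - s))"
    by (rule sum.reindex_bij_witness[of _ "\<lambda>s. v - s" "\<lambda>i. v - i"]) auto
  finally show ?thesis .
qed

lemma card_not_greatest:
  assumes "v \<in> {1..n}"
  shows "card {R \<in> nceq {1..n}. \<exists>k>v. (v, k) \<in> R} = (\<Sum>s=1..n-v. catalan (s - 1) * catalan (n - s))"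
proof -
  have "{R \<in> nceq {1..n}. \<exists>k>v. (v, k) \<in> R} = (\<Union>j\<in>{v<..n}. {R \<in> nceq {1..n}. consecutive R v j})"
  proof (intro set_eqI iffI)
    fix R assume "R \<in> {R \<in> nceq {1..n}. \<exists>k>v. (v, k) \<in> R}"
    then obtain j where R: "R \<in> nceq {1..n}" and j: "consecutive R v j"
      using consecutive_ex by blast
    then have "j \<in> {v<..n}" using nceq_subset[OF R] by (auto simp: consecutive_def)
    then show "R \<in> (\<Union>j\<in>{v<..n}. {R \<in> nceq {1..n}. consecutive R v j})"
      using R j by blast
  qed (auto simp: consecutive_def)
  also have "card \<dots> = (\<Sum>j\<in>{v<..n}. card {R \<in> nceq {1..n}. consecutive R v j})"
    by (intro card_UN_disjoint) (auto simp: finite_nceq dest: consecutive_unique)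
  also have "\<dots> = (\<Sum>j\<in>{v<..n}. catalan (j - v - 1) * catalan (n - (j - v)))"
    using assms by (intro sum.cong card_consecutive_interval) auto
  also have "\<dots> = (\<Sum>s=1..n-v. catalan (s - 1) * catalan (n - s))"
    by (rule sum.reindex_bij_witness[of _ "\<lambda>s. v + s" "\<lambda>j. j - v"]) auto
  finally show ?thesis .
qed

lemma card_not_least2:
  assumes "v \<in> {1..n}"
  shows "card {(R, Q) \<in> nceq {1..n} \<times> nceq {1..n}. \<exists>k<v. (k, v) \<in> R \<inter> Q} =
    (\<Sum>s=1..<v. isolated2_count s * catalan (n - s) ^ 2)"
proof -
  let ?N = "nceq {1..n} \<times> nceq {1..n}"
  let ?P = "\<lambda>i. {(R, Q) \<in> ?N. consecutive (R \<inter> Q) i v}"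
  have fin: "finite ?N" by (simp add: finite_nceq)
  have "{(R, Q) \<in> ?N. \<exists>k<v. (k, v) \<in> R \<inter> Q} = (\<Union>i\<in>{1..<v}. ?P i)"
  proof
    show "{(R, Q) \<in> ?N. \<exists>k<v. (k, v) \<in> R \<inter> Q} \<subseteq> (\<Union>i\<in>{1..<v}. ?P i)"
    proof clarify
      fix R Q k assume R: "R \<in> nceq {1..n}" "Q \<in> nceq {1..n}" and k: "k < v" "(k, v) \<in> R" "(k, v) \<in> Q"
      then obtain i where i: "consecutive (R \<inter> Q) i v"
        using consecutive_ex_left[OF Int_nceq[OF R], of k v] by blast
      then have "i \<in> {1..<v}" using nceq_subset[OF R(1)] by (auto simp: consecutive_def)
      then show "(R, Q) \<in> (\<Union>i\<in>{1..<v}. ?P i)"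
        using R i by blast
    qed
  qed (auto simp: consecutive_def)
  also have "card \<dots> = (\<Sum>i=1..<v. card (?P i))"
  proof (rule card_UN_disjoint)
    show "\<forall>i\<in>{1..<v}. finite (?P i)"
      by (intro ballI finite_subset[OF _ fin]) auto
    have "i = j" if "(R, Q) \<in> ?P i" "(R, Q) \<in> ?P j" for i j R Q
      using consecutive_unique_left[of "R \<inter> Q"] Int_nceq that by blast
    then show "\<forall>i\<in>{1..<v}. \<forall>j\<in>{1..<v}. i \<noteq> j \<longrightarrow> ?P i \<inter> ?P j = {}"
      by fast
  qed simp
  also have "\<dots> = (\<Sum>i=1..<v. isolated2_count (v - i) * catalan (n - (v - i)) ^ 2)"
    using assms by (intro sum.cong card_consecutive2_interval) auto
  also have "\<dots> = (\<Sum>s=1..<v. isolated2_count s * catalan (n - s) ^ 2)"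
    by (rule sum.reindex_bij_witness[of _ "\<lambda>s. v - s" "\<lambda>i. v - i"]) auto
  finally show ?thesis .
qed

section \<open>Catalan numbers\<close>

lemma catalan_fps:
  defines "C \<equiv> Abs_fps (\<lambda>n. real (catalan n))"
  shows "C = 1 + fps_X * C ^ 2"
proof (rule fps_ext)
  fix n
  have "fps_nth (C ^ 2) m = real (catalan (Suc m))" for m
    by (simp add: C_def power2_eq_square fps_mult_nth atLeast0AtMost)
  then show "fps_nth C n = fps_nth (1 + fps_X * C ^ 2) n"
    by (cases n) (simp_all add: C_def del: catalan.simps(2))
qed

declare catalan.simps(2) [simp del]

text \<open>With \<open>D = 1 - 2XC\<close> the functional equation becomes \<open>D\<^sup>2 = 1 - 4X\<close>, and
  differentiating gives the linear equation \<open>(1 - 4X) D' = -2D\<close>.\<close>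

lemma catalan_Suc: "(real n + 2) * real (catalan (Suc n)) = (4 * real n + 2) * real (catalan n)"
proof -
  define C where "C = Abs_fps (\<lambda>n. real (catalan n))"
  define D where "D = 1 - 2 * fps_X * C"
  have C: "C = 1 + fps_X * C ^ 2"
    using catalan_fps by (simp add: C_def)
  have "D ^ 2 = 1 - 4 * fps_X * C + 4 * fps_X * (fps_X * C ^ 2)"
    by (simp add: D_def power2_eq_square algebra_simps)
  also have "fps_X * C ^ 2 = C - 1"
    using C by (simp add: algebra_simps)
  finally have D2: "D ^ 2 = 1 - 4 * fps_X"
    by (simp add: algebra_simps)
  have "fps_deriv (D ^ 2) = fps_deriv (1 - 4 * fps_X)"
    by (simp only: D2)
  moreover have "fps_deriv (D ^ 2) = 2 * D * fps_deriv D"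
    by (simp add: power2_eq_square algebra_simps)
  moreover have "fps_deriv (1 - 4 * fps_X :: real fps) = - 4"
    by (simp add: fps_deriv_mult numeral_fps_const)
  ultimately have "2 * (D * fps_deriv D) = 2 * (- 2)"
    by (simp add: mult.assoc)
  then have "D * fps_deriv D = - 2"
    by (metis mult_cancel_left zero_neq_numeral)
  then have "D * (D * fps_deriv D) = D * (- 2)"
    by simp
  then have "D ^ 2 * fps_deriv D = - 2 * D"
    by (simp add: power2_eq_square mult.assoc)
  then have "(1 - 4 * fps_X) * fps_deriv D = - 2 * D"
    by (simp only: D2)
  then have "fps_deriv D - fps_const 4 * (fps_X * fps_deriv D) = fps_const (- 2) * D"
    by (simp add: algebra_simps numeral_fps_const flip: fps_const_neg)
  then have "fps_nth (fps_deriv D - fps_const 4 * (fps_X * fps_deriv D)) (Suc n) =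
      fps_nth (fps_const (- 2) * D) (Suc n)"
    by (simp only:)
  moreover have "fps_nth D (Suc m) = - 2 * real (catalan m)" for m
  proof -
    have "D = 1 - fps_const 2 * (fps_X * C)"
      by (simp add: D_def numeral_fps_const mult.assoc)
    then show ?thesis
      by (simp add: C_def)
  qed
  ultimately show ?thesis
    by (simp add: algebra_simps)
qed

lemma catalan_pos: "catalan n > 0"
  by (induction n rule: less_induct) (metis card_nceq card_nceq_pos card_atLeastAtMost diff_Suc_1 finite_atLeastAtMost)

text \<open>The closed form of the Catalan numbers; it allows \<open>catalan 60\<close> to be
  evaluated from factorials instead of by unfolding the recursion.\<close>

lemma catalan_fact: "catalan n * (fact n * fact (Suc n)) = fact (2 * n)"
proof (induction n)
  case (Suc n)
  have "real (catalan (Suc n) * (fact (Suc n) * fact (Suc (Suc n)))) =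
      ((real n + 2) * real (catalan (Suc n))) * (real n + 1) * (fact n * fact (Suc n))"
    by (simp add: algebra_simps)
  also have "\<dots> = (4 * real n + 2) * (real n + 1) * real (catalan n * (fact n * fact (Suc n)))"
    unfolding catalan_Suc by (simp add: algebra_simps)
  also have "\<dots> = real (fact (2 * Suc n))"
    unfolding Suc.IH by (simp add: algebra_simps)
  finally show ?case
    by (simp only: of_nat_eq_iff)
qed simp

text \<open>By \<open>catalan_Suc\<close> the quotient of neighbours is (n + 2) / (4 n + 2), with
  limit 1/4; the claim is about a product of \<open>s\<close> such quotients.\<close>

lemma catalan_ratio_tendsto: "(\<lambda>n. real (catalan (n - s)) / real (catalan n)) \<longlonglongrightarrow> (1 / 4) ^ s"
proof -
  have "(\<lambda>n. real (catalan n) / real (catalan (n + s))) \<longlonglongrightarrow> (1 / 4) ^ s"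
  proof (induction s)
    case 0
    have "real (catalan n) / real (catalan n) = 1" for n using catalan_pos[of n] by simp
    then show ?case by simp
  next
    case (Suc s)
    have "real (catalan (n + s)) / real (catalan (n + Suc s)) = (real n + real s + 2) / (4 * (real n + real s) + 2)" for n
      using catalan_Suc[of "n + s"] catalan_pos[of "Suc (n + s)"]
      by (simp add: field_simps)
    moreover have "(\<lambda>n. (real n + real s + 2) / (4 * (real n + real s) + 2)) \<longlonglongrightarrow> 1 / 4"
      by real_asymp
    ultimately have "(\<lambda>n. real (catalan n) / real (catalan (n + s)) * (real (catalan (n + s)) / real (catalan (n + Suc s)))) \<longlonglongrightarrow> (1 / 4) ^ s * (1 / 4)"
      using Suc.IH by (intro tendsto_mult) simp_all
    moreover have "real (catalan n) / real (catalan (n + s)) * (real (catalan (n + s)) / real (catalan (n + Suc s))) =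
        real (catalan n) / real (catalan (n + Suc s))" for n
      using catalan_pos[of "n + s"] by simp
    ultimately show ?case by (simp only: power_Suc2)
  qed
  then have "(\<lambda>n. real (catalan (n + s - s)) / real (catalan (n + s))) \<longlonglongrightarrow> (1 / 4) ^ s"
    by simp
  then show ?thesis
    by (rule LIMSEQ_offset)
qed

text \<open>The summands are hypergeometric and their sum telescopes. With catalan N ~ 4^N / sqrt
  (Pi N^3) the right-hand side tends to 16 / Pi - 4.\<close>

lemma catalan_square_partial_sum:
  "(\<Sum>n<N. real (catalan n) ^ 2 / 16 ^ n) =
    (real N + 1) ^ 2 * (16 * real N + 4) * (real (catalan N) ^ 2 / 16 ^ N) - 4"
proof (induction N)
  case (Suc N)
  have "(real N + 2) ^ 2 * real (catalan (Suc N)) ^ 2 = (4 * real N + 2) ^ 2 * real (catalan N) ^ 2"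
    using catalan_Suc[of N] by (metis power_mult_distrib)
  have "(real (Suc N) + 1) ^ 2 * (16 * real (Suc N) + 4) * (real (catalan (Suc N)) ^ 2 / 16 ^ Suc N) =
      (16 * real N + 20) * ((real N + 2) ^ 2 * real (catalan (Suc N)) ^ 2 / (16 * 16 ^ N))"
  proof -
    have "real (Suc N) + 1 = real N + 2" "16 * real (Suc N) + 4 = 16 * real N + 20" by simp_all
    then show ?thesis by (simp only: power_Suc times_divide_eq_right mult_ac)
  qed
  also have "\<dots> = (16 * real N + 20) * ((4 * real N + 2) ^ 2 * real (catalan N) ^ 2 / (16 * 16 ^ N))"
    by (simp only: \<open>(real N + 2) ^ 2 * real (catalan (Suc N)) ^ 2 = _\<close>)
  also have "\<dots> = (16 * real N + 20) * (4 * real N + 2) ^ 2 / 16 * (real (catalan N) ^ 2 / 16 ^ N)"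
    by simp
  finally show ?case
    unfolding sum.lessThan_Suc Suc.IH by (simp only:) (simp add: algebra_simps power2_eq_square)
qed simp

text \<open>Let A_S and B_S be the two partial sums. Summing the convolution identity up to
  \<open>S\<close> gives A_S - 1 as the sum of b_s A_(S-s), which is at most B_S A_S because partial
  sums of nonnegative terms increase. Division by A_S truncates B = 1 - 1 / A to an inequality in
  the useful direction.\<close>

lemma isolated2_count_partial_sum:
  "1 - 1 / (\<Sum>n\<le>S. real (catalan n) ^ 2 / 16 ^ n) \<le> (\<Sum>s=1..S. real (isolated2_count s) / 16 ^ s)"
proof -
  define a where "a n = real (catalan n) ^ 2 / 16 ^ n" for n
  define b where "b s = real (isolated2_count s) / 16 ^ s" for s
  have rec: "a n = (\<Sum>s=1..n. b s * a (n - s))" if "n > 0" for n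
  proof -
    have "a n = (\<Sum>s=1..n. real (isolated2_count s) * real (catalan (n - s)) ^ 2) / 16 ^ n"
      unfolding a_def using catalan_square[OF that] by (metis (mono_tags, lifting) of_nat_mult of_nat_power of_nat_sum sum.cong)
    also have "\<dots> = (\<Sum>s=1..n. b s * a (n - s))"
      unfolding sum_divide_distrib by (intro sum.cong) (auto simp: a_def b_def power_diff)
    finally show ?thesis .
  qed
  have nn: "a n \<ge> 0" "b n \<ge> 0" for n by (simp_all add: a_def b_def)
  have a0: "a 0 = 1" by (simp add: a_def)
  define A where "A = (\<Sum>n\<le>S. a n)"
  have A: "A \<ge> 1"
    unfolding A_def using member_le_sum[of 0 "{..S}" a] nn a0 by simp
  have "{..S} = insert 0 {1..S}" by auto
  then have "A - 1 = (\<Sum>n=1..S. a n)"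
    by (simp add: A_def a0)
  also have "\<dots> = (\<Sum>n=1..S. \<Sum>s=1..n. b s * a (n - s))"
    by (intro sum.cong rec) auto
  also have "\<dots> = (\<Sum>s=1..S. \<Sum>n=s..S. b s * a (n - s))"
    by (simp add: sum.Sigma)
      (rule sum.reindex_bij_witness[of _ "\<lambda>(s, n). (n, s)" "\<lambda>(n, s). (s, n)"], auto)
  also have "\<dots> \<le> (\<Sum>s=1..S. b s * A)"
  proof (rule sum_mono)
    fix s assume "s \<in> {1..S}"
    have "(\<Sum>n=s..S. a (n - s)) = (\<Sum>k\<le>S - s. a k)"
      using \<open>s \<in> {1..S}\<close> by (intro sum.reindex_bij_witness[of _ "\<lambda>k. k + s" "\<lambda>n. n - s"]) auto
    also have "\<dots> \<le> A"
      unfolding A_def by (rule sum_mono2) (auto simp: nn)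
    finally show "(\<Sum>n=s..S. b s * a (n - s)) \<le> b s * A"
      unfolding sum_distrib_left[symmetric] by (intro mult_left_mono nn)
  qed
  also have "\<dots> = (\<Sum>s=1..S. b s) * A"
    by (simp add: sum_distrib_right)
  finally have "(A - 1) / A \<le> (\<Sum>s=1..S. b s)"
    using A by (simp add: pos_divide_le_eq)
  then show ?thesis
    using A by (simp add: A_def a_def b_def diff_divide_distrib)
qed

text \<open>The partial sums of \<open>Cat\<^sub>n\<^sup>2 / 16\<^sup>n\<close> increase to \<open>16 / \<pi> - 4\<close>, and
  \<open>1 - 1 / (16 / \<pi> - 4) = 0.08508...\<close>; about fifty terms are needed to get beyond \<open>0.085\<close>.\<close>

lemma isolated2_count_sum_gt: "(\<Sum>s=1..59. real (isolated2_count s) / 16 ^ s) > 0.085"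
proof -
  let ?A = "\<Sum>n\<le>59. real (catalan n) ^ 2 / 16 ^ n"
  have c: "real (catalan 60) = fact 120 / (fact 60 * fact 61)"
    using catalan_fact[of 60, THEN arg_cong[where f = real]] by (simp add: divide_simps)
  have e: "?A = (\<Sum>n<60. real (catalan n) ^ 2 / 16 ^ n)"
    by (rule sum.cong) auto
  \<comment> \<open>200 / 183 is 1 / 0.915, the value of A at which 1 - 1 / A equals 0.085.\<close>
  have "?A > 200 / 183"
    unfolding e catalan_square_partial_sum by (simp add: c fact_numeral)
  then have "1 - 1 / ?A > 0.085"
    by (simp add: field_simps)
  then show ?thesis
    using isolated2_count_partial_sum[of 59] by linarith
qed

section \<open>Averages over non-crossing relations\<close>

text \<open>A truncated Catalan convolution, normalised by the full one. It is the probability that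
  a point with \<open>m\<close> points to its left has a predecessor in its class, and equally that
  a point with \<open>m\<close> points to its right has a successor.\<close>

definition catalan_conv :: "nat \<Rightarrow> nat \<Rightarrow> real" where
  "catalan_conv n m = (\<Sum>s=1..m. real (catalan (s - 1)) * real (catalan (n - s))) / real (catalan n)"

lemma catalan_conv_nonneg: "catalan_conv n m \<ge> 0"
  by (auto simp: catalan_conv_def intro!: divide_nonneg_nonneg sum_nonneg)

lemma catalan_conv_mono: "l \<le> m \<Longrightarrow> catalan_conv n l \<le> catalan_conv n m"
  by (auto simp: catalan_conv_def intro!: divide_right_mono sum_mono2)

lemma catalan_conv_self: "n > 0 \<Longrightarrow> catalan_conv n n = 1"
proof (cases n)
  case (Suc k)
  have "(\<Sum>s=1..Suc k. real (catalan (s - 1)) * real (catalan (Suc k - s))) = (\<Sum>j\<le>k. real (catalan j) * real (catalan (k - j)))"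
    by (rule sum.reindex_bij_witness[of _ Suc "\<lambda>s. s - 1"]) auto
  also have "\<dots> = real (catalan (Suc k))"
    by (simp add: catalan.simps(2))
  finally show ?thesis
    using catalan_pos[of "Suc k"] by (simp add: catalan_conv_def Suc)
qed simp

text \<open>Reflecting s to n + 1 - s exchanges the two Catalan factors, so the last n - m summands
  of the full convolution are the first n - m in reverse.\<close>

lemma catalan_conv_symmetric:
  assumes "m \<le> n" "n > 0"
  shows "catalan_conv n m + catalan_conv n (n - m) = 1"
proof -
  let ?f = "\<lambda>s. real (catalan (s - 1)) * real (catalan (n - s))"
  have "(\<Sum>s=1..n. ?f s) = (\<Sum>s=1..m. ?f s) + (\<Sum>s=m+1..n. ?f s)"
    using assms sum.ub_add_nat[of 1 m ?f "n - m"] by simp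
  also have "(\<Sum>s=m+1..n. ?f s) = (\<Sum>s=1..n-m. ?f s)"
    by (rule sum.reindex_bij_witness[of _ "\<lambda>s. n + 1 - s" "\<lambda>s. n + 1 - s"]) auto
  finally show ?thesis
    using catalan_conv_self[OF assms(2)] by (simp add: catalan_conv_def add_divide_distrib)
qed

lemma sum_catalan_conv: "n > 0 \<Longrightarrow> (\<Sum>m\<le>n. catalan_conv n m) = (real n + 1) / 2"
proof -
  assume n: "n > 0"
  have "(\<Sum>m\<le>n. catalan_conv n m) = (\<Sum>m\<le>n. catalan_conv n (n - m))"
    by (rule sum.reindex_bij_witness[of _ "\<lambda>m. n - m" "\<lambda>m. n - m"]) auto
  then have "2 * (\<Sum>m\<le>n. catalan_conv n m) = (\<Sum>m\<le>n. catalan_conv n m + catalan_conv n (n - m))"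
    by (simp add: sum.distrib)
  also have "\<dots> = (\<Sum>m\<le>n. 1)"
    using n by (intro sum.cong catalan_conv_symmetric) auto
  finally show ?thesis by simp
qed

lemma catalan_Suc_normalized:
  "(real n + 2) * (real (catalan (Suc n)) / 4 ^ Suc n) = (real n + 1 / 2) * (real (catalan n) / 4 ^ n)"
proof -
  have "(real n + 2) * (real (catalan (Suc n)) / 4 ^ Suc n) = ((real n + 2) * real (catalan (Suc n))) / (4 * 4 ^ n)"
    by simp
  also have "\<dots> = (real n + 1 / 2) * (real (catalan n) / 4 ^ n)"
    unfolding catalan_Suc by (simp add: field_simps)
  finally show ?thesis .
qed

text \<open>Since (L + 1) catalan L is the central binomial coefficient (2L choose L), the remainder
  is half of (2L choose L) / 4^L; the full series has the value 1/2.\<close>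

lemma catalan_weighted_sum:
  "(\<Sum>s=1..L. real (catalan (s - 1)) / 4 ^ s) = 1 / 2 - (real L + 1) * (real (catalan L) / 4 ^ L) / 2"
proof (induction L)
  case (Suc L)
  define u where "u = real (catalan L) / 4 ^ L"
  have a: "(real (Suc L) + 1) * (real (catalan (Suc L)) / 4 ^ Suc L) = (real L + 1 / 2) * u"
    using catalan_Suc_normalized[of L] unfolding u_def by (simp add: add.commute)
  have b: "real (catalan L) / 4 ^ Suc L = u / 4"
    by (simp add: u_def)
  have c: "(\<Sum>s=1..Suc L. real (catalan (s - 1)) / 4 ^ s) =
      (\<Sum>s=1..L. real (catalan (s - 1)) / 4 ^ s) + real (catalan L) / 4 ^ Suc L"
    by simp
  show ?case
    unfolding a b c Suc.IH[folded u_def] by (simp add: field_simps)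
qed simp

text \<open>A Wallis-type bound for (2L choose L) / 4^L. The growth factor (2L + 1) / (2L + 2) and
  the inequality (2L + 1) (2L + 3) <= (2L + 2)^2 show that the left-hand side never rises above its
  value 1 at L = 0.\<close>

lemma catalan_bound: "((real L + 1) * (real (catalan L) / 4 ^ L)) ^ 2 * (2 * real L + 1) \<le> 1"
proof (induction L)
  case (Suc L)
  let ?r = "\<lambda>L. (real L + 1) * (real (catalan L) / 4 ^ L)"
  have "?r (Suc L) = (real L + 1 / 2) * (real (catalan L) / 4 ^ L)"
    using catalan_Suc_normalized[of L] by (simp add: add.commute)
  also have "real L + 1 / 2 = (2 * real L + 1) / (2 * real L + 2) * (real L + 1)"
    by (simp add: divide_simps) (simp add: algebra_simps)
  also have "\<dots> * (real (catalan L) / 4 ^ L) = (2 * real L + 1) / (2 * real L + 2) * ?r L"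
    by (simp only: mult.assoc)
  finally have r: "?r (Suc L) = (2 * real L + 1) / (2 * real L + 2) * ?r L" .
  have "((2 * real L + 1) / (2 * real L + 2)) ^ 2 * (2 * real (Suc L) + 1) \<le> 2 * real L + 1"
    by (simp add: divide_simps power2_eq_square) (simp add: algebra_simps)
  then have "?r L ^ 2 * (((2 * real L + 1) / (2 * real L + 2)) ^ 2 * (2 * real (Suc L) + 1))
      \<le> ?r L ^ 2 * (2 * real L + 1)"
    by (intro mult_left_mono) auto
  then have "(?r (Suc L)) ^ 2 * (2 * real (Suc L) + 1) \<le> ?r L ^ 2 * (2 * real L + 1)"
    unfolding r power_mult_distrib by (simp only: mult_ac)
  with Suc.IH show ?case by linarith
qed simp

lemma catalan_weighted_sum_gt:
  assumes "\<epsilon> > 0"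
  shows "\<exists>L. (\<Sum>s=1..L. real (catalan (s - 1)) / 4 ^ s) > 1 / 2 - \<epsilon>"
proof -
  \<comment> \<open>By \<open>catalan_bound\<close>, a remainder of at least \<epsilon> would force
    \<epsilon>^2 L <= 1/8.\<close>
  obtain L :: nat where L: "real L > 1 / \<epsilon> ^ 2"
    using reals_Archimedean2 by blast
  define r where "r = (real L + 1) * (real (catalan L) / 4 ^ L) / 2"
  have "r < \<epsilon>"
  proof (rule ccontr)
    assume "\<not> r < \<epsilon>"
    then have "\<epsilon> ^ 2 \<le> r ^ 2" using assms by (intro power_mono) auto
    then have "\<epsilon> ^ 2 * (2 * real L + 1) \<le> r ^ 2 * (2 * real L + 1)"
      by (intro mult_right_mono) auto
    also have "\<dots> \<le> 1 / 4"
      using catalan_bound[of L] by (simp add: r_def power_divide)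
    finally have "2 * (\<epsilon> ^ 2 * real L) + \<epsilon> ^ 2 \<le> 1 / 4"
      by (simp add: algebra_simps)
    moreover have "\<epsilon> ^ 2 * real L > 1"
      using L assms by (simp add: field_simps)
    ultimately show False using zero_le_power2[of \<epsilon>] by linarith
  qed
  then show ?thesis
    using catalan_weighted_sum[of L] unfolding r_def by (intro exI[of _ L]) linarith
qed

lemma catalan_conv_tendsto:
  "(\<lambda>n. catalan_conv n L) \<longlonglongrightarrow> (\<Sum>s=1..L. real (catalan (s - 1)) / 4 ^ s)"
proof -
  have "(\<lambda>n. \<Sum>s=1..L. real (catalan (s - 1)) * (real (catalan (n - s)) / real (catalan n)))
      \<longlonglongrightarrow> (\<Sum>s=1..L. real (catalan (s - 1)) * (1 / 4) ^ s)"
    by (intro tendsto_intros catalan_ratio_tendsto)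
  then show ?thesis
    by (simp add: catalan_conv_def sum_divide_distrib power_one_over)
qed

text \<open>Away from the ends the probabilities are close to 1/2. By monotony and reflection, the
  lower bound at the single index \<open>L\<close> becomes the upper bound 1/2 + e for all m <= n -
  L; the remaining \<open>L\<close> summands are at most 1.\<close>

lemma sum_catalan_conv_square_le:
  assumes "\<epsilon> > 0"
  shows "\<exists>N. \<forall>n\<ge>N. 2 * (\<Sum>m\<le>n. catalan_conv n m ^ 2) \<le> (1 / 2 + \<epsilon>) * real n"
proof -
  \<comment> \<open>With e <= 1, (1/2 + e)^2 is at most 1/4 + 2 e. After doubling, the error 4 e
    uses up \<epsilon> / 2; the other half of \<epsilon> absorbs the boundary terms through the
    choice of \<open>N1\<close>.\<close>
  define e where "e = min 1 (\<epsilon> / 8)"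
  have e: "e > 0" "e \<le> 1" "8 * e \<le> \<epsilon>" using assms by (auto simp: e_def)
  obtain L where L: "(\<Sum>s=1..L. real (catalan (s - 1)) / 4 ^ s) > 1 / 2 - e"
    using catalan_weighted_sum_gt[OF e(1)] by blast
  have "\<forall>\<^sub>F n in sequentially. catalan_conv n L > 1 / 2 - e"
    using catalan_conv_tendsto L by (rule order_tendstoD)
  then obtain N0 where N0: "\<And>n. n \<ge> N0 \<Longrightarrow> catalan_conv n L > 1 / 2 - e"
    by (auto simp: eventually_sequentially)
  obtain N1 :: nat where N1: "real N1 > (4 * real L + 2) / (\<epsilon> / 2) + 1"
    using reals_Archimedean2 by blast
  show ?thesis
  proof (intro exI allI impI)
    fix n assume n: "n \<ge> max (max N0 N1) (max 1 (2 * L))"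
    have le1: "catalan_conv n m \<le> 1" if "m \<le> n" for m
      using catalan_conv_symmetric[OF that] catalan_conv_nonneg[of n "n - m"] n by simp
    have mid: "catalan_conv n m \<le> 1 / 2 + e" if "m \<le> n - L" for m
    proof -
      have "catalan_conv n L \<le> catalan_conv n (n - m)"
        using that n by (intro catalan_conv_mono) auto
      then show ?thesis
        using catalan_conv_symmetric[of m n] N0[of n] n order_trans[OF that diff_le_self] by simp
    qed
    have "(\<Sum>m\<le>n. catalan_conv n m ^ 2) = (\<Sum>m\<le>n-L. catalan_conv n m ^ 2) + (\<Sum>m=n-L+1..n. catalan_conv n m ^ 2)"
      using n sum.ub_add_nat[of 0 "n - L" "\<lambda>m. catalan_conv n m ^ 2" L] by (simp add: atMost_atLeast0)
    also have "\<dots> \<le> (\<Sum>m\<le>n-L. (1 / 2 + e) ^ 2) + (\<Sum>m=n-L+1..n. 1)"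
      using mid le1 catalan_conv_nonneg by (intro add_mono sum_mono power_mono power_le_one) auto
    also have "\<dots> = real (n - L + 1) * (1 / 2 + e) ^ 2 + real L"
      using n by simp
    also have "\<dots> \<le> (real n + 1) * (1 / 4 + 2 * e) + real L"
    proof -
      have "(1 / 2 + e) ^ 2 \<le> 1 / 4 + 2 * e"
        using e by (simp add: power2_eq_square algebra_simps mult_left_le)
      then show ?thesis
        by (intro add_mono mult_mono) auto
    qed
    finally have "2 * (\<Sum>m\<le>n. catalan_conv n m ^ 2) \<le> (real n + 1) * (1 / 2 + 4 * e) + 2 * real L"
      by (simp add: algebra_simps)
    also have "\<dots> \<le> (real n + 1) * (1 / 2 + \<epsilon> / 2) + 2 * real L"
      using e by (intro add_mono mult_left_mono) auto
    also have "\<dots> \<le> (1 / 2 + \<epsilon>) * real n"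
    proof -
      have "real n > (4 * real L + 2) / (\<epsilon> / 2) + 1"
        using N1 n by (simp add: less_le_trans)
      then have "\<epsilon> / 2 * real n > 4 * real L + 2 + \<epsilon> / 2" using assms by (simp add: field_simps)
      then show ?thesis by (simp add: algebra_simps add_divide_distrib)
    qed
    finally show "2 * (\<Sum>m\<le>n. catalan_conv n m ^ 2) \<le> (1 / 2 + \<epsilon>) * real n" .
  qed
qed

section \<open>Double counting over points and relations\<close>

lemma sum_card_swap:
  assumes "finite N" "finite V"
  shows "(\<Sum>R\<in>N. card {v \<in> V. P R v}) = (\<Sum>v\<in>V. card {R \<in> N. P R v})"
proof -
  have "(\<Sum>R\<in>N. card {v \<in> V. P R v}) = (\<Sum>R\<in>N. \<Sum>v\<in>V. if P R v then 1 else 0)"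
    using assms by (simp add: sum.If_cases Int_def)
  also have "\<dots> = (\<Sum>v\<in>V. \<Sum>R\<in>N. if P R v then 1 else 0)"
    by (rule sum.swap)
  also have "\<dots> = (\<Sum>v\<in>V. card {R \<in> N. P R v})"
    using assms by (simp add: sum.If_cases Int_def)
  finally show ?thesis .
qed

text \<open>It contains one point per class, so its cardinality is the number of blocks. Counting
  blocks by points allows sums over relations to be exchanged with sums over points.\<close>

definition least_elems :: "nat set \<Rightarrow> (nat \<times> nat) set \<Rightarrow> nat set" where
  "least_elems A R = {v \<in> A. \<forall>k<v. (k, v) \<notin> R}"

definition greatest_elems :: "nat set \<Rightarrow> (nat \<times> nat) set \<Rightarrow> nat set" where
  "greatest_elems A R = {v \<in> A. \<forall>k>v. (v, k) \<notin> R}"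

lemma card_Collect_compl:
  assumes "finite N"
  shows "real (card {R \<in> N. \<not> P R}) = real (card N) - real (card {R \<in> N. P R})"
proof -
  have "{R \<in> N. \<not> P R} = N - {R \<in> N. P R}" by auto
  then show ?thesis
    using assms by (simp add: card_Diff_subset of_nat_diff card_mono)
qed

lemma card_least_elem:
  assumes v: "v \<in> {1..n}"
  shows "real (card {R \<in> nceq {1..n}. v \<in> least_elems {1..n} R}) = catalan_conv n (n + 1 - v) * real (catalan n)"
proof -
  have n: "n > 0" using v by auto
  have "{R \<in> nceq {1..n}. v \<in> least_elems {1..n} R} = {R \<in> nceq {1..n}. \<not> (\<exists>k<v. (k, v) \<in> R)}"
    using v by (auto simp: least_elems_def)
  then have "real (card {R \<in> nceq {1..n}. v \<in> least_elems {1..n} R}) =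
      real (catalan n) - real (\<Sum>s=1..<v. catalan (s - 1) * catalan (n - s))"
    using card_Collect_compl[of "nceq {1..n}" "\<lambda>R. \<exists>k<v. (k, v) \<in> R"] card_not_least[OF v]
    by (simp add: card_nceq finite_nceq)
  also have "{1..<v} = {1..v - 1}" using v by auto
  also have "real (catalan n) - real (\<Sum>s=1..v-1. catalan (s - 1) * catalan (n - s)) =
      (1 - catalan_conv n (v - 1)) * real (catalan n)"
    using catalan_pos[of n] by (simp add: catalan_conv_def algebra_simps)
  also have "1 - catalan_conv n (v - 1) = catalan_conv n (n + 1 - v)"
    using catalan_conv_symmetric[of "v - 1" n] v n order_trans[OF diff_le_self, of v n] by simp
  finally show ?thesis .
qed

lemma card_not_greatest_elem:
  assumes v: "v \<in> {1..n}"
  shows "real (card {R \<in> nceq {1..n}. v \<notin> greatest_elems {1..n} R}) = catalan_conv n (n - v) * real (catalan n)"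
proof -
  have "{R \<in> nceq {1..n}. v \<notin> greatest_elems {1..n} R} = {R \<in> nceq {1..n}. \<exists>k>v. (v, k) \<in> R}"
    using v by (auto simp: greatest_elems_def)
  then show ?thesis
    using card_not_greatest[OF v] catalan_pos[of n] by (simp add: catalan_conv_def)
qed

lemma sum_card_least_elems:
  assumes "n > 0"
  shows "(\<Sum>R\<in>nceq {1..n}. real (card (least_elems {1..n} R))) = (real n + 1) / 2 * real (catalan n)"
proof -
  have "(\<Sum>R\<in>nceq {1..n}. real (card (least_elems {1..n} R))) =
      real (\<Sum>R\<in>nceq {1..n}. card {v \<in> {1..n}. v \<in> least_elems {1..n} R})"
    by (simp only: least_elems_def mem_Collect_eq of_nat_sum conj_assoc[symmetric] conj_absorb)
  also have "\<dots> = (\<Sum>v=1..n. real (card {R \<in> nceq {1..n}. v \<in> least_elems {1..n} R}))"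
    by (subst sum_card_swap) (simp_all add: finite_nceq)
  also have "\<dots> = (\<Sum>v=1..n. catalan_conv n (n + 1 - v) * real (catalan n))"
    by (intro sum.cong card_least_elem) auto
  also have "\<dots> = (\<Sum>m=1..n. catalan_conv n m * real (catalan n))"
    by (rule sum.reindex_bij_witness[of _ "\<lambda>m. n + 1 - m" "\<lambda>m. n + 1 - m"]) auto
  also have "\<dots> = (\<Sum>m\<le>n. catalan_conv n m) * real (catalan n)"
  proof -
    have "{..n} = insert 0 {1..n}" by auto
    moreover have "catalan_conv n 0 = 0" by (simp add: catalan_conv_def)
    ultimately show ?thesis by (simp add: sum_distrib_right)
  qed
  finally show ?thesis using sum_catalan_conv[OF assms] by simp
qed

text \<open>From all points, those with a predecessor in their class of the meet are subtracted. A
  predecessor at distance \<open>s\<close> can occur for the n - s points v = s + 1, ..., n, with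
  the same count for each; hence the factor n - s.\<close>

lemma sum_card_least_elems_Int:
  "(\<Sum>R\<in>nceq {1..n}. \<Sum>Q\<in>nceq {1..n}. real (card (least_elems {1..n} (R \<inter> Q)))) =
    real n * real (catalan n) ^ 2 - (\<Sum>s=1..n. (real n - real s) * (real (isolated2_count s) * real (catalan (n - s)) ^ 2))"
proof -
  let ?N = "nceq {1..n}"
  let ?g = "\<lambda>s. real (isolated2_count s) * real (catalan (n - s)) ^ 2"
  have "(\<Sum>R\<in>?N. \<Sum>Q\<in>?N. real (card (least_elems {1..n} (R \<inter> Q)))) =
      (\<Sum>p\<in>?N \<times> ?N. real (card {v \<in> {1..n}. \<not> (\<exists>k<v. (k, v) \<in> fst p \<inter> snd p)}))"
    unfolding sum.cartesian_product split_def
    by (intro sum.cong refl arg_cong[where f = "\<lambda>A. real (card A)"]) (auto simp: least_elems_def)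
  also have "\<dots> = (\<Sum>p\<in>?N \<times> ?N. real n - real (card {v \<in> {1..n}. \<exists>k<v. (k, v) \<in> fst p \<inter> snd p}))"
    by (intro sum.cong refl, subst card_Collect_compl) auto
  also have "\<dots> = real n * real (catalan n) ^ 2 -
      real (\<Sum>p\<in>?N \<times> ?N. card {v \<in> {1..n}. \<exists>k<v. (k, v) \<in> fst p \<inter> snd p})"
    by (simp add: sum_subtractf card_nceq card_cartesian_product power2_eq_square)
  also have "(\<Sum>p\<in>?N \<times> ?N. card {v \<in> {1..n}. \<exists>k<v. (k, v) \<in> fst p \<inter> snd p}) =
      (\<Sum>v=1..n. card {p \<in> ?N \<times> ?N. \<exists>k<v. (k, v) \<in> fst p \<inter> snd p})"
    by (rule sum_card_swap) (simp_all add: finite_nceq)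
  also have "\<dots> = (\<Sum>v=1..n. \<Sum>s=1..<v. isolated2_count s * catalan (n - s) ^ 2)"
  proof (rule sum.cong)
    fix v assume "v \<in> {1..n}"
    then show "card {p \<in> ?N \<times> ?N. \<exists>k<v. (k, v) \<in> fst p \<inter> snd p} = (\<Sum>s=1..<v. isolated2_count s * catalan (n - s) ^ 2)"
      by (subst card_not_least2[symmetric]) (auto intro!: arg_cong[where f = card])
  qed simp
  also have "real \<dots> = (\<Sum>v=1..n. \<Sum>s=1..<v. ?g s)"
    by simp
  also have "\<dots> = (\<Sum>s=1..n. \<Sum>v=s+1..n. ?g s)"
    unfolding sum.Sigma[OF finite_atLeastAtMost ballI[OF finite_atLeastLessThan]]
      sum.Sigma[OF finite_atLeastAtMost ballI[OF finite_atLeastAtMost]]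
    by (rule sum.reindex_bij_witness[of _ "\<lambda>(s, v). (v, s)" "\<lambda>(v, s). (s, v)"]) auto
  also have "\<dots> = (\<Sum>s=1..n. (real n - real s) * ?g s)"
    by (intro sum.cong) (auto simp: of_nat_diff)
  finally show ?thesis .
qed

text \<open>After division by n Cat_n^2 the s-th subtracted term tends to
  \<open>isolated2_count s / 16 ^ s\<close>. The terms are nonnegative, so the first 59 bound the
  subtracted sum from below; 0.915 = 1 - 0.085.\<close>

lemma sum_card_least_elems_Int_le:
  "\<exists>N. \<forall>n\<ge>N. (\<Sum>R\<in>nceq {1..n}. \<Sum>Q\<in>nceq {1..n}. real (card (least_elems {1..n} (R \<inter> Q))))
    \<le> 0.915 * real n * real (catalan n) ^ 2"
proof -
  have ratio: "(\<lambda>n. (real n - real s) / real n * (real (catalan (n - s)) / real (catalan n)) ^ 2) \<longlonglongrightarrow> (1 / 16) ^ s" for s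
  proof -
    have "(\<lambda>n. (real n - real s) / real n) \<longlonglongrightarrow> 1" by real_asymp
    then have "(\<lambda>n. (real n - real s) / real n * (real (catalan (n - s)) / real (catalan n)) ^ 2) \<longlonglongrightarrow> 1 * ((1 / 4) ^ s) ^ 2"
      by (intro tendsto_intros catalan_ratio_tendsto)
    moreover have "((1 / 4 :: real) ^ s) ^ 2 = (1 / 16) ^ s"
      by (simp add: power_mult[symmetric] mult.commute[of s]) (simp add: power_mult power2_eq_square)
    ultimately show ?thesis by simp
  qed
  have "(\<lambda>n. \<Sum>s=1..59. real (isolated2_count s) * ((real n - real s) / real n * (real (catalan (n - s)) / real (catalan n)) ^ 2))
      \<longlonglongrightarrow> (\<Sum>s=1..59. real (isolated2_count s) * (1 / 16) ^ s)"
    by (intro tendsto_intros ratio)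
  moreover have "(\<Sum>s=1..59. real (isolated2_count s) * (1 / 16) ^ s) > 0.085"
    using isolated2_count_sum_gt by (simp add: power_one_over)
  ultimately have "\<forall>\<^sub>F n in sequentially. (\<Sum>s=1..59. real (isolated2_count s) *
      ((real n - real s) / real n * (real (catalan (n - s)) / real (catalan n)) ^ 2)) > 0.085"
    by (rule order_tendstoD)
  then obtain N where N: "\<And>n. n \<ge> N \<Longrightarrow> (\<Sum>s=1..59. real (isolated2_count s) *
      ((real n - real s) / real n * (real (catalan (n - s)) / real (catalan n)) ^ 2)) > 0.085"
    by (auto simp: eventually_sequentially)
  show ?thesis
  proof (intro exI allI impI)
    fix n assume n: "n \<ge> max N 60"
    let ?c = "real (catalan n)"
    have c: "?c > 0" using catalan_pos by simp
    have "0.085 * (real n * ?c ^ 2) \<le> (\<Sum>s=1..59. real (isolated2_count s) *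
      ((real n - real s) / real n * (real (catalan (n - s)) / ?c) ^ 2)) * (real n * ?c ^ 2)"
      using N[of n] n by (intro mult_right_mono) auto
    also have "\<dots> = (\<Sum>s=1..59. (real n - real s) * (real (isolated2_count s) * real (catalan (n - s)) ^ 2))"
      unfolding sum_distrib_right using n c
      by (intro sum.cong) (auto simp: power_divide)
    also have "\<dots> \<le> (\<Sum>s=1..n. (real n - real s) * (real (isolated2_count s) * real (catalan (n - s)) ^ 2))"
      using n by (intro sum_mono2) auto
    finally show "(\<Sum>R\<in>nceq {1..n}. \<Sum>Q\<in>nceq {1..n}. real (card (least_elems {1..n} (R \<inter> Q))))
        \<le> 0.915 * real n * real (catalan n) ^ 2"
      unfolding sum_card_least_elems_Int by simp
  qed
qed

section \<open>Paths in the Hasse diagram\<close>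

lemma quotient_rel_eq:
  assumes "equiv A R"
  shows "{(x, y). \<exists>B\<in>A // R. x \<in> B \<and> y \<in> B} = R"
proof (intro set_eqI, clarify)
  fix x y
  show "(x, y) \<in> {(x, y). \<exists>B\<in>A // R. x \<in> B \<and> y \<in> B} \<longleftrightarrow> (x, y) \<in> R"
  proof
    assume "(x, y) \<in> {(x, y). \<exists>B\<in>A // R. x \<in> B \<and> y \<in> B}"
    then show "(x, y) \<in> R"
      using in_quotient_imp_in_rel[OF assms, of _ x y] by auto
  next
    assume xy: "(x, y) \<in> R"
    then have "x \<in> A" using assms equiv_type by blast
    then have "R `` {x} \<in> A // R" "x \<in> R `` {x}" "y \<in> R `` {x}"
      using xy equiv_class_self[OF assms] by (auto intro: quotientI)
    then show "(x, y) \<in> {(x, y). \<exists>B\<in>A // R. x \<in> B \<and> y \<in> B}" by blast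
  qed
qed

lemma quotient_in_NC:
  assumes R: "R \<in> nceq {1..n}"
  shows "{1..n} // R \<in> NC n"
proof -
  note e = nceq_equiv[OF R]
  have "noncrossing ({1..n} // R)"
    unfolding noncrossing_def
  proof (intro notI, elim bexE conjE exE)
    fix V W a b c d
    assume h: "V \<in> {1..n} // R" "W \<in> {1..n} // R" "V \<noteq> W" "a < b" "b < c" "c < d"
      "a \<in> V" "c \<in> V" "b \<in> W" "d \<in> W"
    have "(a, c) \<in> R" "(b, d) \<in> R"
      using in_quotient_imp_in_rel[OF e, of V a c] in_quotient_imp_in_rel[OF e, of W b d] h by auto
    then have "(a, b) \<in> R"
      using nceq_noncrossing[OF R] h by blast
    then show False
      using quotient_eqI[OF e h(1,2), of a b] h by blast
  qed
  then show ?thesis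
    using partition_on_quotient[OF e] by (simp add: NC_def)
qed

lemma bij_betw_quotient: "bij_betw (\<lambda>R. {1..n} // R) (nceq {1..n}) (NC n)"
proof (rule bij_betw_byWitness[where f' = "\<lambda>P. {(x, y). \<exists>B\<in>P. x \<in> B \<and> y \<in> B}"])
  show "\<forall>R\<in>nceq {1..n}. {(x, y). \<exists>B\<in>{1..n} // R. x \<in> B \<and> y \<in> B} = R"
    by (intro ballI quotient_rel_eq nceq_equiv)
  show "\<forall>P\<in>NC n. {1..n} // {(x, y). \<exists>B\<in>P. x \<in> B \<and> y \<in> B} = P"
    unfolding NC_def using partition_on_eq_quotient by blast
  show "(\<lambda>R. {1..n} // R) ` nceq {1..n} \<subseteq> NC n"
    using quotient_in_NC by blast
  show "(\<lambda>P. {(x, y). \<exists>B\<in>P. x \<in> B \<and> y \<in> B}) ` NC n \<subseteq> nceq {1..n}"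
  proof clarify
    fix P assume P: "P \<in> NC n"
    then have "partition_on {1..n} P" and nc: "noncrossing P" by (auto simp: NC_def)
    have e: "equiv {1..n} {(x, y). \<exists>B\<in>P. x \<in> B \<and> y \<in> B}"
      using equiv_partition_on[OF \<open>partition_on {1..n} P\<close>] .
    have nc: "(a, b) \<in> {(x, y). \<exists>B\<in>P. x \<in> B \<and> y \<in> B}"
      if h: "a < b" "b < c" "c < d" "(a, c) \<in> {(x, y). \<exists>B\<in>P. x \<in> B \<and> y \<in> B}"
        "(b, d) \<in> {(x, y). \<exists>B\<in>P. x \<in> B \<and> y \<in> B}" for a b c d
    proof -
      obtain V W where "V \<in> P" "W \<in> P" "a \<in> V" "c \<in> V" "b \<in> W" "d \<in> W" using h by blast
      moreover from this have "V = W" using nc h(1-3) unfolding noncrossing_def by blast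
      ultimately show ?thesis by blast
    qed
    show "{(x, y). \<exists>B\<in>P. x \<in> B \<and> y \<in> B} \<in> nceq {1..n}"
      using nc by (rule nceq_equivI[OF e])
  qed
qed

lemma refines_quotient_iff:
  assumes R: "equiv A R" and Q: "equiv A Q"
  shows "refines A (A // R) (A // Q) \<longleftrightarrow> R \<subseteq> Q"
proof
  assume h: "refines A (A // R) (A // Q)"
  show "R \<subseteq> Q"
  proof clarify
    fix x y assume xy: "(x, y) \<in> R"
    then have x: "x \<in> A" using R equiv_type by blast
    then obtain Y where "Y \<in> A // Q" "R `` {x} \<subseteq> Y"
      using h quotientI[OF x, of R] unfolding refines_def by blast
    moreover have "x \<in> R `` {x}" "y \<in> R `` {x}" using xy x equiv_class_self[OF R] by auto
    ultimately show "(x, y) \<in> Q" using in_quotient_imp_in_rel[OF Q, of Y x y] by blast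
  qed
next
  assume "R \<subseteq> Q"
  then have "\<forall>X\<in>A // R. \<exists>Y\<in>A // Q. X \<subseteq> Y"
    unfolding quotient_def by blast
  then show "refines A (A // R) (A // Q)"
    using partition_on_quotient[OF R] partition_on_quotient[OF Q] by (simp add: refines_def)
qed

lemma nc_less_quotient_iff:
  assumes "R \<in> nceq {1..n}" "Q \<in> nceq {1..n}"
  shows "nc_less n ({1..n} // R) ({1..n} // Q) \<longleftrightarrow> R \<subset> Q"
  using refines_quotient_iff[OF nceq_equiv nceq_equiv, OF assms]
    inj_onD[OF bij_betw_imp_inj_on[OF bij_betw_quotient], of n R Q] assms
  unfolding nc_less_def by blast

lemma nc_covers_quotient_iff:
  assumes "R \<in> nceq {1..n}" "Q \<in> nceq {1..n}"
  shows "nc_covers n ({1..n} // Q) ({1..n} // R) \<longleftrightarrow>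
    R \<subset> Q \<and> \<not> (\<exists>S\<in>nceq {1..n}. R \<subset> S \<and> S \<subset> Q)"
proof -
  have "(\<exists>\<sigma>\<in>NC n. nc_less n ({1..n} // R) \<sigma> \<and> nc_less n \<sigma> ({1..n} // Q)) \<longleftrightarrow>
      (\<exists>S\<in>nceq {1..n}. R \<subset> S \<and> S \<subset> Q)"
    unfolding bij_betw_imp_surj_on[OF bij_betw_quotient, symmetric]
    using nc_less_quotient_iff assms by auto
  then show ?thesis
    unfolding nc_covers_def nc_less_quotient_iff[OF assms] by (simp only:)
qed

text \<open>Among the pairs of \<open>Q\<close> missing in \<open>R\<close> one of least distance is
  taken. A relative in between would give two closer pairs, both in \<open>R\<close> by minimality,
  and transitivity would put the pair itself into \<open>R\<close>.\<close>

lemma adjacent_pair_exists: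
  assumes R: "R \<in> nceq A" and Q: "Q \<in> nceq A" and "R \<subset> Q"
  obtains x y where "consecutive Q x y" "(x, y) \<notin> R"
proof -
  define D where "D = {(x, y). (x, y) \<in> Q \<and> (x, y) \<notin> R \<and> x < y}"
  obtain a b where "(a, b) \<in> Q" "(a, b) \<notin> R" using assms(3) by auto
  then have "(a, b) \<in> D \<or> (b, a) \<in> D"
    unfolding D_def using nceq_sym[OF Q] nceq_sym[OF R] nceq_refl[OF R] nceq_subset[OF Q]
    by (metis (mono_tags, lifting) linorder_neqE_nat mem_Collect_eq case_prod_conv)
  then obtain p where "p \<in> D" by blast
  then have "\<exists>q. q \<in> D \<and> (\<forall>r. r \<in> D \<longrightarrow> snd q - fst q \<le> snd r - fst r)"
    by (rule ex_has_least_nat)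
  then obtain x y where xy: "(x, y) \<in> D" and min: "\<And>u v. (u, v) \<in> D \<Longrightarrow> y - x \<le> v - u"
    by force
  have "(x, k) \<notin> Q" if k: "x < k" "k < y" for k
  proof
    assume xk: "(x, k) \<in> Q"
    have "(k, y) \<in> Q"
      using nceq_trans[OF Q nceq_sym[OF Q xk]] xy by (auto simp: D_def)
    have "\<not> y - x \<le> k - x" "\<not> y - x \<le> y - k"
      using k by auto
    then have "(x, k) \<in> R" "(k, y) \<in> R"
      using min[of x k] min[of k y] xk \<open>(k, y) \<in> Q\<close> k unfolding D_def by blast+
    then show False
      using nceq_trans[OF R, of x k y] xy by (simp add: D_def)
  qed
  then show ?thesis
    using that[of x y] xy by (auto simp: D_def consecutive_def)
qed

text \<open>A class of \<open>R\<close> with a point strictly between \<open>x\<close> and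
  \<open>y\<close> and one outside [x, y] would cross the chord from \<open>x\<close> to
  \<open>y\<close> in \<open>Q\<close>. It would then lie in the \<open>Q\<close>-class of
  \<open>x\<close>, which has no point between consecutive elements.\<close>

lemma glue_consecutive:
  assumes R: "R \<in> nceq A" and Q: "Q \<in> nceq A" and "R \<subset> Q" and xy: "consecutive Q x y" "(x, y) \<notin> R"
  shows "glue R x y \<in> nceq A" "glue R x y \<subseteq> Q" "R \<subset> glue R x y"
proof -
  have Qxy: "(x, y) \<in> Q" "x < y" and adj: "\<And>k. x < k \<Longrightarrow> k < y \<Longrightarrow> (x, k) \<notin> Q"
    using xy by (auto simp: consecutive_def)
  then have A: "x \<in> A" "y \<in> A" using nceq_subset[OF Q] by auto
  show "glue R x y \<subseteq> Q"
    using glue_least[OF _ Q Qxy(1)] assms(3) by blast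
  show "R \<subset> glue R x y"
    using glue_mem[OF R A] xy(2) subset_glue[of R x y] by blast
  show "glue R x y \<in> nceq A"
  proof (rule glue_nceq[OF R A Qxy(2)])
    fix a b assume ab: "(a, b) \<in> R" "x < a" "a < y"
    then have Qab: "(a, b) \<in> Q" "(b, a) \<in> Q" using assms(3) nceq_sym[OF Q] by blast+
    show "x \<le> b \<and> b \<le> y"
    proof (rule ccontr)
      assume "\<not> (x \<le> b \<and> b \<le> y)"
      then consider "b < x" | "y < b" by linarith
      then have "(x, a) \<in> Q"
      proof cases
        case 1
        then have "(b, x) \<in> Q"
          using nceq_noncrossing[OF Q Qab(2) Qxy(1)] ab by blast
        then show ?thesis using nceq_trans[OF Q nceq_sym[OF Q]] Qab(2) by blast
      next
        case 2
        then show ?thesis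
          using nceq_noncrossing[OF Q Qxy(1) Qab(1)] ab by blast
      qed
      then show False using adj ab by blast
    qed
  qed
qed

text \<open>Any pair beyond \<open>R\<close> already links the two classes to be merged, and
  transitivity then links them completely. So a merging is always a covering step.\<close>

lemma glue_no_between:
  assumes R: "R \<in> nceq A" and S: "S \<in> nceq A" "R \<subset> S" "S \<subseteq> glue R x y"
  shows "S = glue R x y"
proof
  obtain a b where ab: "(a, b) \<in> S" "(a, b) \<notin> R" using S(2) by auto
  then have "(x, a) \<in> R \<and> (y, b) \<in> R \<or> (y, a) \<in> R \<and> (x, b) \<in> R"
    using S(3) by (auto simp: glue_def)
  then have "(x, y) \<in> S"
    using ab(1) S(2) nceq_sym[OF S(1)] nceq_trans[OF S(1)] by (meson psubset_imp_subset subsetD)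
  then show "glue R x y \<subseteq> S"
    using S by (intro glue_least[OF _ S(1)]) auto
qed (rule S(3))

lemma least_elem_exists:
  assumes R: "R \<in> nceq A" and x: "x \<in> A"
  obtains m where "m \<in> least_elems A R" "(m, x) \<in> R" "\<And>k. (k, x) \<in> R \<Longrightarrow> m \<le> k"
proof -
  let ?m = "LEAST k. (k, x) \<in> R"
  have m: "(?m, x) \<in> R" by (rule LeastI[of _ x]) (rule nceq_refl[OF R x])
  have l: "?m \<le> k" if "(k, x) \<in> R" for k by (rule Least_le) (rule that)
  have "(k, ?m) \<notin> R" if "k < ?m" for k
    using l[of k] nceq_trans[OF R, of k ?m x] m that by linarith
  then have "?m \<in> least_elems A R"
    using nceq_subset[OF R m] by (simp add: least_elems_def)
  then show ?thesis using that m l by blast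
qed

text \<open>Of the two class minima exactly the larger one ceases to be least.\<close>

lemma card_least_elems_glue:
  assumes A: "finite A" and R: "R \<in> nceq A" and J: "glue R x y \<in> nceq A"
    and xy: "x \<in> A" "y \<in> A" "(x, y) \<notin> R"
  shows "card (least_elems A R) = Suc (card (least_elems A (glue R x y)))"
proof -
  obtain a where a: "a \<in> least_elems A R" "(a, x) \<in> R" "\<And>k. (k, x) \<in> R \<Longrightarrow> a \<le> k"
    using least_elem_exists[OF R xy(1)] by blast
  obtain b where b: "b \<in> least_elems A R" "(b, y) \<in> R" "\<And>k. (k, y) \<in> R \<Longrightarrow> b \<le> k"
    using least_elem_exists[OF R xy(2)] by blast
  have "a \<noteq> b"
    using a(2) b(2) xy(3) nceq_sym[OF R] nceq_trans[OF R] by blast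
  have Jab: "(a, b) \<in> glue R x y" "(b, a) \<in> glue R x y"
    using nceq_sym[OF R a(2)] nceq_sym[OF R b(2)] by (auto simp: glue_def)
  have uniq: "v = a" if "v \<in> least_elems A R" "(x, v) \<in> R" for v
  proof -
    have "(v, x) \<in> R" "(a, v) \<in> R" using that nceq_sym[OF R] nceq_trans[OF R a(2)] by blast+
    then show ?thesis using a(3)[of v] that(1) by (auto simp: least_elems_def le_less)
  qed
  have uniq': "v = b" if "v \<in> least_elems A R" "(y, v) \<in> R" for v
  proof -
    have "(v, y) \<in> R" "(b, v) \<in> R" using that nceq_sym[OF R] nceq_trans[OF R b(2)] by blast+
    then show ?thesis using b(3)[of v] that(1) by (auto simp: least_elems_def le_less)
  qed
  have "least_elems A (glue R x y) = least_elems A R - {max a b}"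
  proof (intro set_eqI iffI)
    fix v assume v: "v \<in> least_elems A (glue R x y)"
    have "v \<noteq> max a b"
      using v Jab \<open>a \<noteq> b\<close> by (auto simp: least_elems_def max_def split: if_splits)
    moreover have "v \<in> least_elems A R"
      using v subset_glue[of R x y] by (auto simp: least_elems_def)
    ultimately show "v \<in> least_elems A R - {max a b}" by blast
  next
    fix v assume v: "v \<in> least_elems A R - {max a b}"
    have "(k, v) \<notin> glue R x y" if k: "k < v" for k
    proof
      assume kv: "(k, v) \<in> glue R x y"
      have "(k, v) \<notin> R" using v k by (auto simp: least_elems_def)
      then consider "(x, k) \<in> R" "(y, v) \<in> R" | "(y, k) \<in> R" "(x, v) \<in> R"
        using kv by (auto simp: glue_def)
      then have "v = max a b"
      proof cases
        case 1
        then have "v = b" "a \<le> k" using uniq' v a(3) nceq_sym[OF R] by blast+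
        then show ?thesis using k by auto
      next
        case 2
        then have "v = a" "b \<le> k" using uniq v b(3) nceq_sym[OF R] by blast+
        then show ?thesis using k by auto
      qed
      then show False using v by blast
    qed
    then show "v \<in> least_elems A (glue R x y)"
      using v by (auto simp: least_elems_def)
  qed
  moreover have "max a b \<in> least_elems A R" using a b by (auto simp: max_def)
  moreover have "finite (least_elems A R)" using A by (auto simp: least_elems_def)
  ultimately show ?thesis
    using card_Suc_Diff1 by metis
qed

lemma sym_hasse: "sym (hasse n)"
  by (auto simp: hasse_def sym_def)

text \<open>Consecutive points of \<open>Q\<close> are merged pair by pair. Every merging is a cover
  and removes one block, so the length is the difference of the block numbers.\<close>

lemma hasse_path:
  assumes "R \<in> nceq {1..n}" "Q \<in> nceq {1..n}" "R \<subseteq> Q"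
  shows "({1..n} // R, {1..n} // Q) \<in>
    hasse n ^^ (card (least_elems {1..n} R) - card (least_elems {1..n} Q))"
  using assms
proof (induction "card (least_elems {1..n} R)" arbitrary: R rule: less_induct)
  case less
  show ?case
  proof (cases "R = Q")
    case False
    then have "R \<subset> Q" using less.prems by blast
    then obtain x y where xy: "consecutive Q x y" "(x, y) \<notin> R"
      using adjacent_pair_exists[OF less.prems(1,2)] by blast
    let ?J = "glue R x y"
    note J = glue_consecutive[OF less.prems(1,2) \<open>R \<subset> Q\<close> xy]
    have A: "x \<in> {1..n}" "y \<in> {1..n}"
      using nceq_subset[OF less.prems(2)] xy(1) by (auto simp: consecutive_def)
    have c: "card (least_elems {1..n} R) = Suc (card (least_elems {1..n} ?J))"
      by (rule card_least_elems_glue[OF _ less.prems(1) J(1) A xy(2)]) simp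
    have "\<not> (\<exists>S\<in>nceq {1..n}. R \<subset> S \<and> S \<subset> ?J)"
      using glue_no_between[OF less.prems(1)] by blast
    then have "({1..n} // R, {1..n} // ?J) \<in> hasse n"
      using nc_covers_quotient_iff[OF less.prems(1) J(1)] J(3) quotient_in_NC less.prems(1) J(1)
      by (simp add: hasse_def)
    moreover have "({1..n} // ?J, {1..n} // Q) \<in>
        hasse n ^^ (card (least_elems {1..n} ?J) - card (least_elems {1..n} Q))"
      using c by (intro less.hyps J less.prems) auto
    ultimately have "({1..n} // R, {1..n} // Q) \<in>
        hasse n ^^ Suc (card (least_elems {1..n} ?J) - card (least_elems {1..n} Q))"
      by (rule relpow_Suc_I2)
    moreover have "card (least_elems {1..n} Q) \<le> card (least_elems {1..n} ?J)"
      using J(2) by (intro card_mono) (auto simp: least_elems_def)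
    ultimately show ?thesis using c by (simp add: Suc_diff_le)
  qed simp
qed

lemma sym_relpow:
  assumes "sym r" "(x, y) \<in> r ^^ k"
  shows "(y, x) \<in> r ^^ k"
  using assms(2)
proof (induction k arbitrary: y)
  case (Suc k)
  then obtain z where z: "(x, z) \<in> r ^^ k" "(z, y) \<in> r" by auto
  then show ?case
    using Suc.IH[OF z(1)] symD[OF assms(1) z(2)] by (rule_tac relpow_Suc_I2)
qed simp

lemma hasse_path_via_meet:
  assumes R: "R \<in> nceq {1..n}" and Q: "Q \<in> nceq {1..n}"
  shows "({1..n} // R, {1..n} // Q) \<in> hasse n ^^
    ((card (least_elems {1..n} (R \<inter> Q)) - card (least_elems {1..n} R)) +
     (card (least_elems {1..n} (R \<inter> Q)) - card (least_elems {1..n} Q)))"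
  unfolding relpow_add
  using sym_relpow[OF sym_hasse hasse_path[OF Int_nceq[OF R Q] R]] hasse_path[OF Int_nceq[OF R Q] Q]
  by auto

text \<open>The path through the meet shows that some walk exists, so the \<open>LEAST\<close> in
  the distance is attained.\<close>

lemma hasse_dist_path:
  assumes R: "R \<in> nceq {1..n}" and Q: "Q \<in> nceq {1..n}"
  shows "({1..n} // R, {1..n} // Q) \<in> hasse n ^^ hasse_dist n ({1..n} // R) ({1..n} // Q)"
  unfolding hasse_dist_def by (rule LeastI) (rule hasse_path_via_meet[OF assms])

lemma hasse_dist_le:
  assumes R: "R \<in> nceq {1..n}" and Q: "Q \<in> nceq {1..n}"
  shows "real (hasse_dist n ({1..n} // R) ({1..n} // Q)) \<le>
    2 * real (card (least_elems {1..n} (R \<inter> Q))) - real (card (least_elems {1..n} R))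
      - real (card (least_elems {1..n} Q))"
proof -
  have "hasse_dist n ({1..n} // R) ({1..n} // Q) \<le>
    ((card (least_elems {1..n} (R \<inter> Q)) - card (least_elems {1..n} R)) +
     (card (least_elems {1..n} (R \<inter> Q)) - card (least_elems {1..n} Q)))"
    unfolding hasse_dist_def by (rule Least_le) (rule hasse_path_via_meet[OF assms])
  \<comment> \<open>The meet has at least as many blocks as either relation, so the natural-number
    subtractions are genuine ones.\<close>
  moreover have "card (least_elems {1..n} R) \<le> card (least_elems {1..n} (R \<inter> Q))"
    "card (least_elems {1..n} Q) \<le> card (least_elems {1..n} (R \<inter> Q))"
    by (intro card_mono; auto simp: least_elems_def)+
  ultimately show ?thesis by linarith
qed

section \<open>Fattening a non-crossing partition to a matching\<close>

text \<open>The permutation whose cycles run through the classes in increasing order: the greatest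
  element returns to the least, and singletons are fixed points.\<close>

definition cyc_next :: "(nat \<times> nat) set \<Rightarrow> nat \<Rightarrow> nat \<Rightarrow> bool" where
  "cyc_next R i j \<longleftrightarrow> consecutive R i j \<or> (i, j) \<in> R \<and> j \<le> i \<and> (\<forall>k. (i, k) \<in> R \<longrightarrow> j \<le> k \<and> k \<le> i)"

text \<open>Point \<open>i\<close> is doubled to \<open>2i - 1\<close> and \<open>2i\<close>, and the arcs are the boundary curves of the thickened
  blocks: they run from the right copy of \<open>i\<close> to the left copy of its cyclic successor in the block.\<close>

definition fatten :: "(nat \<times> nat) set \<Rightarrow> nat set set" where
  "fatten R = {{2 * i, 2 * j - 1} | i j. cyc_next R i j}"

lemma cyc_next_rel: "cyc_next R i j \<Longrightarrow> (i, j) \<in> R"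
  by (auto simp: cyc_next_def consecutive_def)

lemma cyc_next_exists:
  assumes R: "R \<in> nceq A" and i: "i \<in> A"
  shows "\<exists>j. cyc_next R i j"
proof (cases "\<exists>k>i. (i, k) \<in> R")
  case True
  then show ?thesis using consecutive_ex unfolding cyc_next_def by blast
next
  case False
  obtain m where m: "(m, i) \<in> R" "\<And>k. (k, i) \<in> R \<Longrightarrow> m \<le> k"
    using least_elem_exists[OF R i] by blast
  have "m \<le> k \<and> k \<le> i" if "(i, k) \<in> R" for k
    using m(2)[OF nceq_sym[OF R that]] False that by (meson not_le)
  moreover have "m \<le> i" using m(2)[OF nceq_refl[OF R i]] .
  ultimately show ?thesis
    using nceq_sym[OF R m(1)] unfolding cyc_next_def by blast
qed

lemma cyc_next_exists_left:
  assumes R: "R \<in> nceq A" and A: "finite A" and j: "j \<in> A"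
  shows "\<exists>i. cyc_next R i j"
proof (cases "\<exists>k<j. (k, j) \<in> R")
  case True
  then show ?thesis using consecutive_ex_left[OF R] unfolding cyc_next_def by blast
next
  case False
  define M where "M = Max (R `` {j})"
  have fin: "finite (R `` {j})"
    using finite_subset[OF _ A, of "R `` {j}"] nceq_subset[OF R] by blast
  have "M \<in> R `` {j}"
    unfolding M_def using fin nceq_refl[OF R j] by (intro Max_in) auto
  then have M: "(j, M) \<in> R" by simp
  have "j \<le> k \<and> k \<le> M" if "(M, k) \<in> R" for k
  proof -
    have jk: "(j, k) \<in> R" using nceq_trans[OF R M that] .
    then have "k \<le> M" unfolding M_def using fin by (intro Max_ge) auto
    moreover have "j \<le> k" using False nceq_sym[OF R jk] by (meson not_le)
    ultimately show ?thesis by simp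
  qed
  moreover from this have "j \<le> M" using nceq_sym[OF R M] by blast
  ultimately show ?thesis
    using nceq_sym[OF R M] unfolding cyc_next_def by blast
qed

lemma cyc_next_unique:
  assumes "cyc_next R i j" "cyc_next R i k"
  shows "j = k"
proof -
  have False if "consecutive R i a" "(i, b) \<in> R" "\<forall>k. (i, k) \<in> R \<longrightarrow> b \<le> k \<and> k \<le> i" for a b
    using that unfolding consecutive_def by (meson not_le)
  then show ?thesis
    using assms consecutive_unique[of R i j k] unfolding cyc_next_def by (meson antisym)
qed

lemma cyc_next_unique_left:
  assumes R: "R \<in> nceq A" and ij: "cyc_next R i j" and kj: "cyc_next R k j"
  shows "i = k"
proof -
  have ik: "(i, k) \<in> R" "(k, i) \<in> R"
    using cyc_next_rel[OF ij] cyc_next_rel[OF kj] nceq_sym[OF R] nceq_trans[OF R] by blast+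
  have False if "consecutive R a j" "(b, j) \<in> R" "\<forall>k. (b, k) \<in> R \<longrightarrow> j \<le> k \<and> k \<le> b" for a b
  proof -
    have "(b, a) \<in> R" "a < j"
      using that nceq_sym[OF R] nceq_trans[OF R] unfolding consecutive_def by blast+
    then show False using that by (meson not_le)
  qed
  then show ?thesis
    using ij kj ik consecutive_unique_left[OF R, of i j k] unfolding cyc_next_def by (meson antisym)
qed

lemma fatten_elem:
  assumes "R \<in> nceq {1..n}" "X \<in> fatten R"
  obtains i j where "X = {2 * i, 2 * j - 1}" "cyc_next R i j" "1 \<le> i" "i \<le> n" "1 \<le> j" "j \<le> n"
proof -
  obtain i j where "X = {2 * i, 2 * j - 1}" "cyc_next R i j" using assms(2) by (auto simp: fatten_def)
  then show ?thesis using that[of i j] nceq_subset[OF assms(1) cyc_next_rel] by auto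
qed

text \<open>\<open>cyc_next\<close> is a permutation, so every even point \<open>2 * i\<close> and
  every odd point \<open>2 * j - 1\<close> is the end of exactly one arc.\<close>

lemma fatten_partition:
  assumes R: "R \<in> nceq {1..n}"
  shows "partition_on {1..2 * n} (fatten R)"
proof (rule partition_onI)
  show "\<Union> (fatten R) = {1..2 * n}"
  proof
    show "\<Union> (fatten R) \<subseteq> {1..2 * n}"
    proof
      fix p assume "p \<in> \<Union> (fatten R)"
      then obtain X where X: "X \<in> fatten R" "p \<in> X" by blast
      obtain i j where "X = {2 * i, 2 * j - 1}" "cyc_next R i j" "1 \<le> i" "i \<le> n" "1 \<le> j" "j \<le> n"
        using R X(1) by (rule fatten_elem)
      then show "p \<in> {1..2 * n}" using X(2) by auto
    qed
    show "{1..2 * n} \<subseteq> \<Union> (fatten R)"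
    proof
      fix p assume p: "p \<in> {1..2 * n}"
      show "p \<in> \<Union> (fatten R)"
      proof (cases "even p")
        case True
        then obtain i where i: "p = 2 * i" by blast
        then have "i \<in> {1..n}" using p by auto
        then obtain j where "cyc_next R i j" using cyc_next_exists[OF R] by blast
        then have "{2 * i, 2 * j - 1} \<in> fatten R" unfolding fatten_def by blast
        then show ?thesis using i by blast
      next
        case False
        then obtain k where "p = 2 * k + 1" by (rule oddE)
        then have j: "p = 2 * Suc k - 1" by simp
        then have "Suc k \<in> {1..n}" using p by auto
        then obtain i where "cyc_next R i (Suc k)" using cyc_next_exists_left[OF R] by blast
        then have "{2 * i, 2 * Suc k - 1} \<in> fatten R" unfolding fatten_def by blast
        then show ?thesis using j by blast
      qed
    qed
  qed
  show "{} \<notin> fatten R" by (auto simp: fatten_def)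
  fix X Y assume XY: "X \<in> fatten R" "Y \<in> fatten R" "X \<noteq> Y"
  obtain i j where X: "X = {2 * i, 2 * j - 1}" "cyc_next R i j" "1 \<le> i" "i \<le> n" "1 \<le> j" "j \<le> n"
    using R XY(1) by (rule fatten_elem)
  obtain k l where Y: "Y = {2 * k, 2 * l - 1}" "cyc_next R k l" "1 \<le> k" "k \<le> n" "1 \<le> l" "l \<le> n"
    using R XY(2) by (rule fatten_elem)
  have "i \<noteq> k" using cyc_next_unique[of R i j l] X Y XY(3) by blast
  moreover have "j \<noteq> l" using cyc_next_unique_left[OF R, of i j k] X Y XY(3) by blast
  ultimately show "disjnt X Y"
    using X(1,5) Y(1,5) by (auto simp: disjnt_def; presburger)
qed

lemma card_fatten_elem:
  assumes "R \<in> nceq {1..n}" "X \<in> fatten R"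
  shows "card X = 2"
proof -
  obtain i j where "X = {2 * i, 2 * j - 1}" "cyc_next R i j" "1 \<le> i" "i \<le> n" "1 \<le> j" "j \<le> n"
    using assms by (rule fatten_elem)
  moreover from this have "2 * i \<noteq> 2 * j - 1" by presburger
  ultimately show ?thesis by simp
qed

text \<open>An arc is either a step to the next element, with no relative in between
  (\<open>mono\<close>), or the closing arc from the greatest to the least element
  (\<open>maxi\<close>). In each of the four combinations, crossing arcs force a relative into a
  forbidden place.\<close>

lemma noncrossing_fatten:
  assumes R: "R \<in> nceq {1..n}"
  shows "noncrossing (fatten R)"
proof -
  have nc: "(a, b) \<in> R" if "(a, c) \<in> R" "(b, d) \<in> R" "a < b" "b < c" "c < d" for a b c d
    using R that by (rule nceq_noncrossing)
  have s: "(b, a) \<in> R" if "(a, b) \<in> R" for a b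
    using R that by (rule nceq_sym)
  have t: "(a, c) \<in> R" if "(a, b) \<in> R" "(b, c) \<in> R" for a b c
    using R that by (rule nceq_trans)
  have "False" if X: "X \<in> fatten R" and Y: "Y \<in> fatten R" and ord: "a < b" "b < c" "c < d"
    and m: "a \<in> X" "c \<in> X" "b \<in> Y" "d \<in> Y" for X Y a b c d
  proof -
    obtain i j where Xe: "X = {2 * i, 2 * j - 1}" "cyc_next R i j" "1 \<le> i" "i \<le> n" "1 \<le> j" "j \<le> n"
      using R X by (rule fatten_elem)
    obtain k l where Ye: "Y = {2 * k, 2 * l - 1}" "cyc_next R k l" "1 \<le> k" "k \<le> n" "1 \<le> l" "l \<le> n"
      using R Y by (rule fatten_elem)
    have r: "(i, j) \<in> R" "(k, l) \<in> R" using cyc_next_rel Xe Ye by blast+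
    have ac: "a = 2 * i \<and> c = 2 * j - 1 \<and> i < j \<or> a = 2 * j - 1 \<and> c = 2 * i \<and> j \<le> i"
      using m(1,2) ord Xe by auto
    have bd: "b = 2 * k \<and> d = 2 * l - 1 \<and> k < l \<or> b = 2 * l - 1 \<and> d = 2 * k \<and> l \<le> k"
      using m(3,4) ord Ye by auto
    have mono: "(i, k) \<notin> R" if "i < k" "k < j" for k
      using Xe(2) that unfolding cyc_next_def consecutive_def by (meson less_le_trans not_less_iff_gr_or_eq)
    have maxi: "k \<le> i" if "j \<le> i" "(i, k) \<in> R" for k
      using Xe(2) that unfolding cyc_next_def consecutive_def by (meson not_le)
    from ac bd show False
    proof (elim disjE conjE)
      assume "a = 2 * i" "c = 2 * j - 1" "b = 2 * k" "d = 2 * l - 1"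
      then have "i < k" "k < j" "j < l" using ord by linarith+
      then show False using nc[OF r] mono by blast
    next
      assume "a = 2 * i" "c = 2 * j - 1" "b = 2 * l - 1" "d = 2 * k"
      then have o: "i < l" "l < j" "j \<le> k" using ord by linarith+
      \<comment> \<open>The left copy of a point precedes its right copy, so crossing arcs allow
        \<open>j = k\<close> here; transitivity handles this boundary case.\<close>
      have "(i, l) \<in> R"
        using nc[OF r(1) s[OF r(2)]] t[of i j l] r o by (cases "j = k") auto
      then show False using mono o by blast
    next
      assume "a = 2 * j - 1" "c = 2 * i" "b = 2 * k" "d = 2 * l - 1" "j \<le> i"
      then have o: "j \<le> k" "k < i" "i < l" "j \<le> i" using ord by linarith+
      have "(j, k) \<in> R"
        using nc[OF s[OF r(1)] r(2)] t[OF s[OF r(1)] r(1)] o by (cases "j = k") auto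
      then have "(i, l) \<in> R" using t r by blast
      then show False using maxi o by fastforce
    next
      assume "a = 2 * j - 1" "c = 2 * i" "b = 2 * l - 1" "d = 2 * k" "j \<le> i"
      then have o: "j < l" "l \<le> i" "i < k" "j \<le> i" using ord by linarith+
      have "(i, l) \<in> R"
        using nc[OF s[OF r(1)] s[OF r(2)]] t[OF r(1)] t[OF r(1) s[OF r(1)]] o by (cases "l = i") auto
      then have "(i, k) \<in> R" using t s r by blast
      then show False using maxi o by fastforce
    qed
  qed
  then show ?thesis unfolding noncrossing_def by blast
qed

lemma fatten_in_nc_matchings: "R \<in> nceq {1..n} \<Longrightarrow> fatten R \<in> nc_matchings n"
  using fatten_partition card_fatten_elem noncrossing_fatten by (simp add: nc_matchings_def NC_def)

lemma noncrossingD: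
  "noncrossing \<pi> \<Longrightarrow> V \<in> \<pi> \<Longrightarrow> W \<in> \<pi> \<Longrightarrow> a < b \<Longrightarrow> b < c \<Longrightarrow> c < d \<Longrightarrow>
    a \<in> V \<Longrightarrow> c \<in> V \<Longrightarrow> b \<in> W \<Longrightarrow> d \<in> W \<Longrightarrow> V = W"
  unfolding noncrossing_def by blast

text \<open>The points below an arc are matched among themselves, so their number is even. Hence
  every arc joins a right copy with a left copy, as \<open>fatten\<close> requires.\<close>

lemma arc_parity:
  assumes \<mu>: "\<mu> \<in> nc_matchings n" and pq: "{p, q} \<in> \<mu>" "p < q"
  shows "odd p \<longleftrightarrow> even q"
proof -
  have part: "partition_on {1..2 * n} \<mu>" and nc: "noncrossing \<mu>" and two: "\<And>e. e \<in> \<mu> \<Longrightarrow> card e = 2"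
    using \<mu> by (auto simp: nc_matchings_def NC_def)
  let ?I = "{p<..<q}"
  let ?C = "{e \<in> \<mu>. e \<subseteq> ?I}"
  have disj: "e = f" if "e \<in> \<mu>" "f \<in> \<mu>" "x \<in> e" "x \<in> f" for e f x
    using partition_onD2[OF part] that unfolding disjoint_def by blast
  have "?I \<subseteq> \<Union>?C"
  proof
    fix u assume u: "u \<in> ?I"
    have "q \<in> {1..2 * n}" using pq partition_onD1[OF part] by blast
    then have "u \<in> \<Union>\<mu>" using u partition_onD1[OF part] by auto
    then obtain e where e: "e \<in> \<mu>" "u \<in> e" by blast
    have "e \<noteq> {p, q}" using e u by auto
    have "e \<subseteq> ?I"
    proof
      fix v assume v: "v \<in> e"
      have "v \<noteq> p" "v \<noteq> q" using disj[OF e(1) pq(1) v] \<open>e \<noteq> {p, q}\<close> by auto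
      moreover have "\<not> v < p"
      proof
        assume "v < p"
        then show False
          using noncrossingD[OF nc e(1) pq(1), of v p u q] u v e \<open>e \<noteq> {p, q}\<close> by auto
      qed
      moreover have "\<not> q < v"
      proof
        assume "q < v"
        then show False
          using noncrossingD[OF nc pq(1) e(1), of p u q v] u v e \<open>e \<noteq> {p, q}\<close> by auto
      qed
      ultimately show "v \<in> ?I" by auto
    qed
    then show "u \<in> \<Union>?C" using e by blast
  qed
  then have U: "\<Union>?C = ?I" by blast
  have "2 * card ?C = card (\<Union>?C)"
  proof (rule card_partition)
    show "finite (\<Union>?C)" unfolding U by simp
    then show "finite ?C" by (rule finite_UnionD)
    show "c1 \<inter> c2 = {}" if "c1 \<in> ?C" "c2 \<in> ?C" "c1 \<noteq> c2" for c1 c2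
      using disj that by blast
  qed (use two in blast)
  then have "even (q - Suc p)" unfolding U by (simp add: dvd_def) (metis card_greaterThanLessThan)
  then show ?thesis using pq(2) by presburger
qed

text \<open>The arc at \<open>2 * y - 1\<close> reveals the predecessor of \<open>y\<close> in its
  class, and induction on \<open>y\<close> recovers the class from the predecessors.\<close>

lemma fatten_inj: "inj_on fatten (nceq {1..n})"
proof -
  have sub: "(x, y) \<in> Q"
    if R: "R \<in> nceq {1..n}" and Q: "Q \<in> nceq {1..n}" and eq: "fatten R = fatten Q"
      and xy: "(x, y) \<in> R" "x < y" for R Q x y
    using xy
  proof (induction y rule: less_induct)
    case (less y)
    have y: "y \<in> {1..n}" using nceq_subset[OF R less.prems(1)] by simp
    obtain p where p: "consecutive R p y"
      using consecutive_ex_left[OF R less.prems] by blast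
    have p': "(p, y) \<in> R" "p < y" "\<And>k. p < k \<Longrightarrow> k < y \<Longrightarrow> (p, k) \<notin> R"
      using p by (auto simp: consecutive_def)
    have px: "(p, x) \<in> R"
      using nceq_trans[OF R p'(1) nceq_sym[OF R less.prems(1)]] .
    have "{2 * p, 2 * y - 1} \<in> fatten R" using p unfolding fatten_def cyc_next_def by blast
    then have "{2 * p, 2 * y - 1} \<in> fatten Q" using eq by simp
    then obtain i j where ij: "{2 * p, 2 * y - 1} = {2 * i, 2 * j - 1}" "cyc_next Q i j" "1 \<le> i" "i \<le> n" "1 \<le> j" "j \<le> n"
      by (rule fatten_elem[OF Q])
    then have "p = i" "y = j" using y by (auto simp: doubleton_eq_iff; presburger)+
    then have py: "(p, y) \<in> Q" using cyc_next_rel ij by blast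
    have "x \<le> p" using p'(3)[of x] px less.prems(2) by (meson not_le)
    then show ?case
    proof (cases "x = p")
      case False
      then have "(x, p) \<in> Q"
        using less.IH[of p] p'(2) nceq_sym[OF R px] \<open>x \<le> p\<close> by simp
      then show ?thesis using nceq_trans[OF Q] py by blast
    qed (use py in simp)
  qed
  have "R \<subseteq> Q" if R: "R \<in> nceq {1..n}" and Q: "Q \<in> nceq {1..n}" and eq: "fatten R = fatten Q" for R Q
  proof clarify
    fix x y assume xy: "(x, y) \<in> R"
    consider "x < y" | "x = y" | "y < x" by linarith
    then show "(x, y) \<in> Q"
    proof cases
      case 1
      then show ?thesis using sub[OF that xy] by simp
    next
      case 2
      then show ?thesis using nceq_refl[OF Q] nceq_subset[OF R xy] by simp
    next
      case 3
      then show ?thesis using sub[OF that nceq_sym[OF R xy]] nceq_sym[OF Q] by simp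
    qed
  qed
  then show ?thesis by (intro inj_onI equalityI) auto
qed

text \<open>An arc covers the segment between the points \<open>2i - 1\<close> and \<open>2i\<close>; two such segments belong to the
  same block iff the same arcs cover them, i.e. iff they bound the same region of the half plane.\<close>

definition covers :: "nat \<Rightarrow> nat \<Rightarrow> nat \<Rightarrow> bool" where
  "covers p q i \<longleftrightarrow> p < 2 * i \<and> 2 * i \<le> q"

definition unfatten :: "nat \<Rightarrow> nat set set \<Rightarrow> (nat \<times> nat) set" where
  "unfatten n \<mu> = {(i, j). i \<in> {1..n} \<and> j \<in> {1..n} \<and>
     (\<forall>p q. {p, q} \<in> \<mu> \<longrightarrow> p < q \<longrightarrow> covers p q i = covers p q j)}"

text \<open>The segments covered by an arc form an interval, and when a < b < c < d no interval
  contains one of the pairs \<open>a\<close>, \<open>c\<close> and \<open>b\<close>,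
  \<open>d\<close> while missing the other.\<close>

lemma unfatten_nceq: "unfatten n \<mu> \<in> nceq {1..n}"
proof (rule nceq_equivI)
  show "equiv {1..n} (unfatten n \<mu>)"
  proof (rule equivI)
    show "unfatten n \<mu> \<subseteq> {1..n} \<times> {1..n}" by (auto simp: unfatten_def)
    show "refl_on {1..n} (unfatten n \<mu>)" by (auto simp: unfatten_def refl_on_def)
    show "sym (unfatten n \<mu>)" by (auto simp: unfatten_def sym_def)
    show "trans (unfatten n \<mu>)" unfolding unfatten_def trans_def by blast
  qed
  fix a b c d
  assume h: "a < b" "b < c" "c < d" "(a, c) \<in> unfatten n \<mu>" "(b, d) \<in> unfatten n \<mu>"
  have "covers p q a = covers p q b" if "{p, q} \<in> \<mu>" "p < q" for p q
  proof -
    have "covers p q a = covers p q c" "covers p q b = covers p q d"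
      using h(4,5) that unfolding unfatten_def by blast+
    then show ?thesis using h(1-3) unfolding covers_def by linarith
  qed
  then show "(a, b) \<in> unfatten n \<mu>" using h(4,5) by (simp add: unfatten_def)
qed

text \<open>No second arc covers exactly one end of the given arc (\<open>other\<close>), so the
  segments at its two ends are covered alike by all other arcs. If \<open>p\<close> is even, these
  segments lie just outside the arc, which covers everything between them: they are consecutive in
  their class. If \<open>p\<close> is odd, they are the first and last segments below the arc, which
  confines their class: the arc is the closing one.\<close>

lemma arc_in_fatten_unfatten:
  assumes \<mu>: "\<mu> \<in> nc_matchings n" and e: "{p, q} \<in> \<mu>" "p < q"
  shows "{p, q} \<in> fatten (unfatten n \<mu>)"
proof -
  have part: "partition_on {1..2 * n} \<mu>" and nc: "noncrossing \<mu>"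
    using \<mu> by (auto simp: nc_matchings_def NC_def)
  have disj: "f = g" if "f \<in> \<mu>" "g \<in> \<mu>" "x \<in> f" "x \<in> g" for f g x
    using partition_onD2[OF part] that unfolding disjoint_def by blast
  have pq: "1 \<le> p" "q \<le> 2 * n" using e partition_onD1[OF part] by auto
  have other: "u \<noteq> p \<and> u \<noteq> q \<and> v \<noteq> p \<and> v \<noteq> q \<and> (u < p \<and> p < v \<longleftrightarrow> u < q \<and> q < v)"
    if "{u, v} \<in> \<mu>" "u < v" "{u, v} \<noteq> {p, q}" for u v
  proof -
    have ne: "u \<noteq> p" "u \<noteq> q" "v \<noteq> p" "v \<noteq> q"
      using disj[OF that(1) e(1)] that(3) by blast+
    have "\<not> (u < p \<and> p < v \<and> v < q)" "\<not> (p < u \<and> u < q \<and> q < v)"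
      using noncrossingD[OF nc that(1) e(1), of u p v q] noncrossingD[OF nc e(1) that(1), of p u q v] that(3)
      by auto
    then show ?thesis using ne that(2) e(2) by linarith
  qed
  show ?thesis
  proof (cases "even p")
    case True
    then have "odd q" using arc_parity[OF \<mu> e] by simp
    then obtain k where "q = 2 * k + 1" by (rule oddE)
    moreover from True obtain i where i: "p = 2 * i" by (rule evenE)
    ultimately obtain j where j: "q = 2 * j - 1" "j \<ge> 1" by (metis add.commute diff_Suc_1 mult_Suc_right add_2_eq_Suc le_add1 plus_1_eq_Suc)
    have ij: "i \<in> {1..n}" "j \<in> {1..n}" "i < j" using pq e(2) i j by auto
    have "covers u v i = covers u v j" if "{u, v} \<in> \<mu>" "u < v" for u v
    proof (cases "{u, v} = {p, q}")
      case True
      then have "u = p" "v = q" using that(2) e(2) by (auto simp: doubleton_eq_iff)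
      then show ?thesis using i j ij(3) by (auto simp: covers_def)
    next
      case False
      then show ?thesis using other[OF that False] i j that(2) unfolding covers_def by linarith
    qed
    then have ijR: "(i, j) \<in> unfatten n \<mu>" using ij by (simp add: unfatten_def)
    have "(i, k) \<notin> unfatten n \<mu>" if "i < k" "k < j" for k
    proof
      assume "(i, k) \<in> unfatten n \<mu>"
      then have "covers p q i = covers p q k" using e unfolding unfatten_def by blast
      then show False using that i j by (auto simp: covers_def)
    qed
    then have "cyc_next (unfatten n \<mu>) i j" using ijR ij(3) by (simp add: cyc_next_def consecutive_def)
    then show ?thesis using i j(1) unfolding fatten_def by blast
  next
    case False
    then obtain k where "p = 2 * k + 1" by (rule oddE)
    then obtain j where j: "p = 2 * j - 1" "j \<ge> 1" by (metis add.commute diff_Suc_1 mult_Suc_right add_2_eq_Suc le_add1 plus_1_eq_Suc)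
    have "even q" using arc_parity[OF \<mu> e] False by simp
    then obtain i where i: "q = 2 * i" by (rule evenE)
    have ij: "i \<in> {1..n}" "j \<in> {1..n}" "j \<le> i" using pq e(2) i j by auto
    have "covers u v i = covers u v j" if "{u, v} \<in> \<mu>" "u < v" for u v
    proof (cases "{u, v} = {p, q}")
      case True
      then have "u = p" "v = q" using that(2) e(2) by (auto simp: doubleton_eq_iff)
      then show ?thesis using i j ij(3) by (auto simp: covers_def)
    next
      case False
      then show ?thesis using other[OF that False] i j that(2) ij(3) unfolding covers_def by linarith
    qed
    then have ijR: "(i, j) \<in> unfatten n \<mu>" using ij by (simp add: unfatten_def)
    have "j \<le> k \<and> k \<le> i" if "(i, k) \<in> unfatten n \<mu>" for k
    proof -
      have "covers p q i = covers p q k" using e that unfolding unfatten_def by blast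
      then show ?thesis using i j ij by (auto simp: covers_def)
    qed
    then have "cyc_next (unfatten n \<mu>) i j" using ijR ij(3) by (simp add: cyc_next_def)
    then have "{2 * i, 2 * j - 1} \<in> fatten (unfatten n \<mu>)" unfolding fatten_def by blast
    then show ?thesis using i j(1) by (simp add: insert_commute)
  qed
qed

lemma partition_on_subset_eq:
  assumes "partition_on A P" "partition_on A Q" "P \<subseteq> Q"
  shows "P = Q"
proof
  show "Q \<subseteq> P"
  proof
    fix X assume X: "X \<in> Q"
    then obtain x where x: "x \<in> X" using partition_onD3[OF assms(2)] by (metis all_not_in_conv)
    then have "x \<in> \<Union>P" using X partition_onD1[OF assms(1)] partition_onD1[OF assms(2)] by blast
    then obtain Y where Y: "Y \<in> P" "x \<in> Y" by blast
    then have "X = Y" using X x partition_onD2[OF assms(2)] assms(3) unfolding disjoint_def by blast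
    then show "X \<in> P" using Y by simp
  qed
qed (rule assms(3))

text \<open>It suffices that every arc of \<open>\<mu>\<close> reappears, since both sides are
  partitions of the same set.\<close>

lemma fatten_unfatten:
  assumes \<mu>: "\<mu> \<in> nc_matchings n"
  shows "fatten (unfatten n \<mu>) = \<mu>"
proof -
  have part: "partition_on {1..2 * n} \<mu>" and two: "\<And>e. e \<in> \<mu> \<Longrightarrow> card e = 2"
    using \<mu> by (auto simp: nc_matchings_def NC_def)
  have "\<mu> \<subseteq> fatten (unfatten n \<mu>)"
  proof
    fix e assume e: "e \<in> \<mu>"
    then obtain u v where uv: "e = {u, v}" "u \<noteq> v" using two[OF e] by (meson card_2_iff)
    then obtain p q where "e = {p, q}" "p < q"
      by (metis insert_commute linorder_neqE_nat)
    then show "e \<in> fatten (unfatten n \<mu>)" using arc_in_fatten_unfatten[OF \<mu>] e by blast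
  qed
  then show ?thesis
    using partition_on_subset_eq[OF part fatten_partition[OF unfatten_nceq], of \<mu>] by simp
qed

lemma bij_betw_fatten: "bij_betw fatten (nceq {1..n}) (nc_matchings n)"
proof -
  have "fatten ` nceq {1..n} = nc_matchings n"
  proof
    show "fatten ` nceq {1..n} \<subseteq> nc_matchings n" using fatten_in_nc_matchings by blast
    show "nc_matchings n \<subseteq> fatten ` nceq {1..n}"
      using fatten_unfatten unfatten_nceq by (metis image_eqI subsetI)
  qed
  then show ?thesis using fatten_inj by (simp add: bij_betw_def)
qed

section \<open>Components along Hasse paths\<close>

text \<open>Non-crossing puts one of the two merged classes into a gap of the other or beside it, so
  the new cyclic order differs from the old ones only in the arrows out of \<open>x\<close> and into
  \<open>y\<close>. In terms of permutations, this is a product with a transposition.\<close>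

lemma cyc_next_glue_other:
  assumes R: "R \<in> nceq A" and J: "consecutive (glue R x y) x y" and xy: "(x, y) \<notin> R"
    and q: "cyc_next R q y" and ij: "cyc_next R i j" "i \<noteq> x" "i \<noteq> q"
  shows "cyc_next (glue R x y) i j"
proof -
  have nc: "(a, b) \<in> R" if "(a, c) \<in> R" "(b, d) \<in> R" "a < b" "b < c" "c < d" for a b c d
    using R that by (rule nceq_noncrossing)
  have s: "(b, a) \<in> R" if "(a, b) \<in> R" for a b
    using R that by (rule nceq_sym)
  have t: "(a, c) \<in> R" if "(a, b) \<in> R" "(b, c) \<in> R" for a b c
    using R that by (rule nceq_trans)
  have "x < y" and adj: "\<And>k. x < k \<Longrightarrow> k < y \<Longrightarrow> (x, k) \<notin> glue R x y"
    using J by (auto simp: consecutive_def)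
  have adjx: "\<not> (x < k \<and> k < y)" if "(x, k) \<in> R" for k
    using adj[of k] that by (auto simp: glue_def)
  have A: "x \<in> A" "y \<in> A"
    using J nceq_subset[OF R] by (auto simp: consecutive_def glue_def)
  have adjy: "\<not> (x < k \<and> k < y)" if "(y, k) \<in> R" for k
    using adj[of k] that nceq_refl[OF R A(1)] by (auto simp: glue_def)
  have jn: "j \<noteq> y" using cyc_next_unique_left[OF R, of i j q] ij q by blast
  have r: "(i, j) \<in> R" using cyc_next_rel[OF ij(1)] .
  have Jij: "(i, j) \<in> glue R x y" using r by (simp add: glue_def)
  have Jcase: "(i, k) \<in> R \<or> (x, i) \<in> R \<and> (y, k) \<in> R \<or> (y, i) \<in> R \<and> (x, k) \<in> R"
    if "(i, k) \<in> glue R x y" for k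
    using that by (auto simp: glue_def)
  \<comment> \<open>Elements of the class of \<open>x\<close> to the right of \<open>x\<close> lie
    beyond the whole class of \<open>y\<close>.\<close>
  have right: "y < i \<and> (\<forall>k. (y, k) \<in> R \<longrightarrow> k < i)" if "(x, i) \<in> R" "x < i" for i
  proof -
    have "i \<noteq> y" using that xy by auto
    then have "y < i" using adjx[OF that(1)] that(2) by linarith
    moreover have "k < i" if "(y, k) \<in> R" for k
      using nc[OF \<open>(x, i) \<in> R\<close> that \<open>x < y\<close> \<open>y < i\<close>] xy that s t \<open>(x, i) \<in> R\<close> by (metis linorder_neqE_nat)
    ultimately show ?thesis by blast
  qed
  from ij(1) consider (step) "consecutive R i j"
    | (wrap) "j \<le> i" "\<forall>k. (i, k) \<in> R \<longrightarrow> j \<le> k \<and> k \<le> i"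
    unfolding cyc_next_def by blast
  then show ?thesis
  proof cases
    case step
    then have o: "i < j" "\<And>k. i < k \<Longrightarrow> k < j \<Longrightarrow> (i, k) \<notin> R" by (auto simp: consecutive_def)
    have "(i, k) \<notin> glue R x y" if k: "i < k" "k < j" for k
    proof
      assume "(i, k) \<in> glue R x y"
      then consider "(x, i) \<in> R" "(y, k) \<in> R" | "(y, i) \<in> R" "(x, k) \<in> R"
        using Jcase o(2)[OF k] by blast
      then show False
      proof cases
        case 1
        show False
        proof (cases "x < i")
          case True
          then show False using right[OF 1(1)] 1(2) k by fastforce
        next
          case False
          then have "i < x" using ij(2) by simp
          then have "j \<le> x" using o(2)[of x] s[OF 1(1)] by (meson not_le)
          then have "(i, k) \<in> R" using nc[of i x k y] s 1 k \<open>x < y\<close> by simp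
          then show False using o(2) k by blast
        qed
      next
        case 2
        have yj: "(y, j) \<in> R" using t 2(1) r by blast
        have "\<not> (i < y \<and> y < j)" using o(2)[of y] s[OF 2(1)] by blast
        then consider "y \<le> i" | "j < y" using jn by linarith
        then show False
        proof cases
          case 1
          then have "(x, y) \<in> R" using nc[OF 2(2) yj] \<open>x < y\<close> k by simp
          then show False using xy by blast
        next
          case 22: 2
          have "j \<noteq> x" using yj xy s by blast
          then have "j < x" using adjy[OF yj] 22 by linarith
          then have "(i, k) \<in> R" using nc[OF r s[OF 2(2)]] k by simp
          then show False using o(2) k by blast
        qed
      qed
    qed
    then show ?thesis using Jij o(1) unfolding cyc_next_def consecutive_def by blast
  next
    case wrap
    have "j \<le> k \<and> k \<le> i" if ik: "(i, k) \<in> glue R x y" for k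
    proof (cases "(i, k) \<in> R")
      case True
      then show ?thesis using wrap by blast
    next
      case False
      then consider "(x, i) \<in> R" "(y, k) \<in> R" | "(y, i) \<in> R" "(x, k) \<in> R"
        using Jcase[OF ik] by blast
      then show ?thesis
      proof cases
        case 1
        then have "j \<le> x" "x < i" using wrap(2) s[OF 1(1)] ij(2) by (auto simp: le_less)
        then have "y < i" "k < i" using right[OF 1(1)] 1(2) by auto
        have "\<not> k < x"
          using nc[OF s[OF 1(2)] 1(1)] \<open>x < y\<close> \<open>y < i\<close> False t s 1(1) by blast
        then show ?thesis using \<open>j \<le> x\<close> \<open>k < i\<close> by simp
      next
        case 2
        have yj: "(y, j) \<in> R" using t 2(1) r by blast
        have "j \<le> y" "y \<le> i" using wrap(2) s[OF 2(1)] by auto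
        have "j \<noteq> x" using yj xy s by blast
        then have "j < x" using adjy[OF yj] \<open>j \<le> y\<close> jn by linarith
        have "(x, j) \<notin> R" using xy t s yj by blast
        have "k \<noteq> j" using \<open>(x, j) \<notin> R\<close> 2(2) by blast
        moreover have "\<not> k < j"
          using nc[OF s[OF 2(2)] s[OF yj]] \<open>j < x\<close> \<open>x < y\<close> \<open>(x, j) \<notin> R\<close> t 2(2) by blast
        moreover have "\<not> i < k"
          using nc[OF s[OF r] 2(2)] \<open>j < x\<close> \<open>x < y\<close> \<open>y \<le> i\<close> \<open>(x, j) \<notin> R\<close> s by (meson less_le_trans)
        ultimately show ?thesis by simp
      qed
    qed
    then show ?thesis using Jij wrap(1) unfolding cyc_next_def by blast
  qed
qed

text \<open>With the new arrow from \<open>x\<close> to \<open>y\<close>, the arrow out of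
  \<open>q\<close> has to return to \<open>p\<close>. The cases are the possible positions: the
  class of \<open>y\<close> in the gap between \<open>x\<close> and \<open>p\<close>, the class of
  \<open>x\<close> in the gap between \<open>q\<close> and \<open>y\<close>, or the class of
  \<open>y\<close> wholly to the right of that of \<open>x\<close>.\<close>

lemma cyc_next_glue_ends:
  assumes R: "R \<in> nceq A" and J: "consecutive (glue R x y) x y" and xy: "(x, y) \<notin> R"
    and p: "cyc_next R x p" and q: "cyc_next R q y"
  shows "cyc_next (glue R x y) q p"
proof -
  have nc: "(a, b) \<in> R" if "(a, c) \<in> R" "(b, d) \<in> R" "a < b" "b < c" "c < d" for a b c d
    using R that by (rule nceq_noncrossing)
  have s: "(b, a) \<in> R" if "(a, b) \<in> R" for a b
    using R that by (rule nceq_sym)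
  have t: "(a, c) \<in> R" if "(a, b) \<in> R" "(b, c) \<in> R" for a b c
    using R that by (rule nceq_trans)
  have "x < y" and adj: "\<And>k. x < k \<Longrightarrow> k < y \<Longrightarrow> (x, k) \<notin> glue R x y"
    using J by (auto simp: consecutive_def)
  have A: "x \<in> A" "y \<in> A"
    using J nceq_subset[OF R] by (auto simp: consecutive_def glue_def)
  have adjx: "\<not> (x < k \<and> k < y)" if "(x, k) \<in> R" for k
    using adj[of k] that by (auto simp: glue_def)
  have adjy: "\<not> (x < k \<and> k < y)" if "(y, k) \<in> R" for k
    using adj[of k] that nceq_refl[OF R A(1)] by (auto simp: glue_def)
  have r: "(x, p) \<in> R" "(q, y) \<in> R" using cyc_next_rel p q by blast+
  have Jqp: "(q, p) \<in> glue R x y" using r s by (auto simp: glue_def)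
  have Jcase: "(x, k) \<in> R \<or> (q, k) \<in> R" if "(q, k) \<in> glue R x y" for k
  proof -
    have "(q, k) \<in> R \<or> (x, q) \<in> R \<and> (y, k) \<in> R \<or> (y, q) \<in> R \<and> (x, k) \<in> R"
      using that by (auto simp: glue_def)
    then show ?thesis using xy t[of x q y] r by blast
  qed
  have ne: "p \<noteq> q" "p \<noteq> y" "q \<noteq> x" using r xy s t by blast+
  from p consider (px) "consecutive R x p"
    | (pw) "p \<le> x" "\<And>k. (x, k) \<in> R \<Longrightarrow> p \<le> k \<and> k \<le> x" unfolding cyc_next_def by blast
  then show ?thesis
  proof cases
    case px
    then have px': "y < p" "\<And>k. x < k \<Longrightarrow> k < p \<Longrightarrow> (x, k) \<notin> R" "x < p"
      using adjx[OF r(1)] ne unfolding consecutive_def by auto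
    have "\<not> consecutive R q y"
    proof
      assume "consecutive R q y"
      then have "q < y" by (simp add: consecutive_def)
      then have "q < x" using adjy[OF s[OF r(2)]] ne by linarith
      then have "(q, x) \<in> R" using nc[OF r(2,1)] \<open>x < y\<close> px' by simp
      then show False using r(2) xy s t by blast
    qed
    then have w: "y \<le> q" "\<And>k. (q, k) \<in> R \<Longrightarrow> y \<le> k \<and> k \<le> q" using q unfolding cyc_next_def by blast+
    have "q < p"
    proof (rule ccontr)
      assume "\<not> q < p"
      then have "p < q" using ne by simp
      then show False using nc[OF r(1) s[OF r(2)]] \<open>x < y\<close> px' xy by simp
    qed
    have "(q, k) \<notin> glue R x y" if "q < k" "k < p" for k
      using Jcase[of k] px'(2)[of k] w that \<open>x < y\<close> by fastforce
    then show ?thesis using Jqp \<open>q < p\<close> by (simp add: cyc_next_def consecutive_def)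
  next
    case pw
    show ?thesis
    proof (cases "consecutive R q y")
      case True
      then have qy: "q < y" "\<And>k. q < k \<Longrightarrow> k < y \<Longrightarrow> (q, k) \<notin> R" by (auto simp: consecutive_def)
      then have "q < x" using adjy[OF s[OF r(2)]] ne by linarith
      have "q < p"
      proof (rule ccontr)
        assume "\<not> q < p"
        then have "p < q" using ne by simp
        then have "(p, q) \<in> R" using nc[OF s[OF r(1)] r(2)] \<open>x < y\<close> \<open>q < x\<close> by simp
        then show False using r xy t by blast
      qed
      have "(q, k) \<notin> glue R x y" if "q < k" "k < p" for k
        using Jcase[of k] pw(2)[of k] pw(1) qy(2)[of k] that \<open>x < y\<close> by fastforce
      then show ?thesis using Jqp \<open>q < p\<close> by (simp add: cyc_next_def consecutive_def)
    next
      case False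
      then have w: "y \<le> q" "\<And>k. (q, k) \<in> R \<Longrightarrow> y \<le> k \<and> k \<le> q" using q unfolding cyc_next_def by blast+
      have "p \<le> k \<and> k \<le> q" if "(q, k) \<in> glue R x y" for k
        using Jcase[OF that] pw w \<open>x < y\<close> by fastforce
      then show ?thesis using Jqp pw(1) w(1) \<open>x < y\<close> by (simp add: cyc_next_def)
    qed
  qed
qed

lemma cyc_next_glue:
  assumes R: "R \<in> nceq A" and "finite A" and J: "consecutive (glue R x y) x y" and xy: "(x, y) \<notin> R"
  obtains p q where "cyc_next R x p" "cyc_next R q y" "cyc_next (glue R x y) x y" "cyc_next (glue R x y) q p"
    "\<And>i j. i \<noteq> x \<Longrightarrow> i \<noteq> q \<Longrightarrow> cyc_next (glue R x y) i j \<longleftrightarrow> cyc_next R i j"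
proof -
  have A: "x \<in> A" "y \<in> A"
    using J nceq_subset[OF R] by (auto simp: consecutive_def glue_def)
  obtain p where p: "cyc_next R x p" using cyc_next_exists[OF R A(1)] by blast
  obtain q where q: "cyc_next R q y" using cyc_next_exists_left[OF R \<open>finite A\<close> A(2)] by blast
  have "cyc_next (glue R x y) i j \<longleftrightarrow> cyc_next R i j" if i: "i \<noteq> x" "i \<noteq> q" for i j
  proof
    assume J': "cyc_next (glue R x y) i j"
    then have "i \<in> A"
      using cyc_next_rel nceq_subset[OF R] by (fastforce simp: glue_def)
    then obtain k where k: "cyc_next R i k" using cyc_next_exists[OF R] by blast
    then have "cyc_next (glue R x y) i k" using cyc_next_glue_other[OF R J xy q] i by blast
    then show "cyc_next R i j" using cyc_next_unique J' k by blast
  qed (use cyc_next_glue_other[OF R J xy q] i in blast)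
  moreover have "cyc_next (glue R x y) x y" using J by (simp add: cyc_next_def)
  ultimately show ?thesis
    using that[OF p q _ cyc_next_glue_ends[OF R J xy p q]] by blast
qed

section \<open>Numbers of classes under coarsening\<close>

lemma Image_equiv_class:
  assumes "equiv UNIV r" "equiv UNIV s" "r \<subseteq> s"
  shows "s `` (r `` {a}) = s `` {a}"
proof -
  have "(a, a) \<in> r"
    using equiv_class_self[OF assms(1), of a] by simp
  moreover have "(a, c) \<in> s" if "(a, b) \<in> r" "(b, c) \<in> s" for b c
    using assms that by (meson equiv_def subsetD transD)
  ultimately show ?thesis by blast
qed

text \<open>The relations live on \<open>UNIV\<close> because the closure in
  \<open>components_of\<close> is reflexive everywhere; only the classes of points of
  \<open>A\<close> are counted.\<close>

lemma card_quotient_antimono: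
  assumes "equiv UNIV r" "equiv UNIV s" "r \<subseteq> s" "finite A"
  shows "card (A // s) \<le> card (A // r)"
proof -
  have "A // s = (\<lambda>X. s `` X) ` (A // r)"
    unfolding quotient_def using Image_equiv_class[OF assms(1-3)] by auto
  moreover have "finite (A // r)" using assms(4) by (simp add: quotient_def)
  ultimately show ?thesis by (simp add: card_image_le)
qed

text \<open>Once the class of \<open>v\<close> is set aside, distinct classes remain distinct after
  glueing, so at most one class is lost.\<close>

lemma card_quotient_glue:
  assumes r: "equiv UNIV r" and "finite A"
  shows "card (A // r) \<le> card (A // glue r u v) + 1"
proof -
  let ?s = "glue r u v"
  have fin: "finite (A // r)" "finite (A // ?s)" using assms(2) by (simp_all add: quotient_def)
  have sub: "r \<subseteq> ?s" by (rule subset_glue)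
  have s: "equiv UNIV ?s" using equiv_glue[OF r] by simp
  have sr: "?s `` (r `` {a}) = ?s `` {a}" for a
    by (rule Image_equiv_class[OF r s sub])
  have "inj_on (\<lambda>X. ?s `` X) (A // r - {r `` {v}})"
  proof (rule inj_onI)
    fix X Y assume X: "X \<in> A // r - {r `` {v}}" and Y: "Y \<in> A // r - {r `` {v}}" and eq: "?s `` X = ?s `` Y"
    obtain a where a: "X = r `` {a}" using X by (auto simp: quotient_def)
    obtain b where b: "Y = r `` {b}" using Y by (auto simp: quotient_def)
    have "(a, b) \<in> ?s"
      using eq unfolding a b sr using eq_equiv_class[OF _ s] by blast
    moreover have "(v, a) \<notin> r" "(v, b) \<notin> r"
      using X Y equiv_class_eq[OF r] unfolding a b by blast+
    ultimately have "(a, b) \<in> r" by (auto simp: glue_def)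
    then show "X = Y" unfolding a b by (rule equiv_class_eq[OF r])
  qed
  moreover have "(\<lambda>X. ?s `` X) ` (A // r - {r `` {v}}) \<subseteq> A // ?s"
    using sr by (auto simp: quotient_def)
  ultimately have "card (A // r - {r `` {v}}) \<le> card (A // ?s)"
    using fin by (metis card_inj_on_le)
  moreover have "card (A // r) \<le> card (A // r - {r `` {v}}) + 1"
    using card_Diff1_le[of "A // r"] by (cases "r `` {v} \<in> A // r") (simp_all add: fin card_Diff_singleton)
  ultimately show ?thesis by linarith
qed

lemma equiv_rtrancl: "sym r \<Longrightarrow> equiv UNIV (r\<^sup>*)"
  by (intro equivI) (auto simp: refl_on_def sym_rtrancl trans_rtrancl)

lemma rtrancl_subset_equiv:
  assumes "equiv UNIV s" "r \<subseteq> s"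
  shows "r\<^sup>* \<subseteq> s"
proof clarify
  fix a b assume "(a, b) \<in> r\<^sup>*"
  then show "(a, b) \<in> s"
  proof induction
    case base
    then show ?case using equiv_class_self[OF assms(1), of a] by simp
  next
    case (step b c)
    then show ?case using assms unfolding equiv_def by (meson subsetD transD)
  qed
qed

definition num_comps :: "nat \<Rightarrow> (nat \<times> nat) set \<Rightarrow> (nat \<times> nat) set \<Rightarrow> nat" where
  "num_comps n R Q = card (components_of n (fatten R, fatten Q))"

lemma sym_arc_rel: "sym (arc_rel M)"
  by (auto simp: arc_rel_def sym_def)

lemma equiv_arc_rel: "equiv UNIV ((arc_rel M)\<^sup>*)"
  by (rule equiv_rtrancl[OF sym_arc_rel])

text \<open>The glued relation mediates between the two systems: it has at most one class less than
  connectivity for \<open>R\<close>, and, being coarser, no more classes than connectivity for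
  \<open>S\<close>.\<close>

lemma num_comps_le_Suc:
  assumes "\<And>i j. cyc_next S i j \<Longrightarrow> (2 * i, 2 * j - 1) \<in> glue ((arc_rel (fatten R, fatten Q))\<^sup>*) u v"
  shows "num_comps n R Q \<le> num_comps n S Q + 1"
proof -
  let ?r = "(arc_rel (fatten R, fatten Q))\<^sup>*"
  let ?s = "glue ?r u v"
  have s: "equiv UNIV ?s" using equiv_glue[OF equiv_arc_rel] by simp
  have refl: "(a, a) \<in> ?s" for a using equiv_class_self[OF s, of a] by simp
  have sym: "(b, a) \<in> ?s" if "(a, b) \<in> ?s" for a b using s that unfolding equiv_def by (meson symD)
  have "arc_rel (fatten S, fatten Q) \<subseteq> ?s"
  proof clarify
    fix a b assume "(a, b) \<in> arc_rel (fatten S, fatten Q)"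
    then consider (S) e where "e \<in> fatten S" "a \<in> e" "b \<in> e" | (Q) "(a, b) \<in> arc_rel (fatten R, fatten Q)"
      unfolding arc_rel_def by auto
    then show "(a, b) \<in> ?s"
    proof cases
      case S
      then obtain i j where ij: "e = {2 * i, 2 * j - 1}" "cyc_next S i j" by (auto simp: fatten_def)
      then show ?thesis using assms[OF ij(2)] S refl sym by blast
    next
      case Q
      then show ?thesis using subset_glue[of ?r u v] by blast
    qed
  qed
  then have "(arc_rel (fatten S, fatten Q))\<^sup>* \<subseteq> ?s"
    by (rule rtrancl_subset_equiv[OF s])
  then have "card ({1..2 * n} // ?s) \<le> card ({1..2 * n} // (arc_rel (fatten S, fatten Q))\<^sup>*)"
    using card_quotient_antimono[OF equiv_arc_rel s] by simp
  moreover have "card ({1..2 * n} // ?r) \<le> card ({1..2 * n} // ?s) + 1"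
    using card_quotient_glue[OF equiv_arc_rel] by simp
  ultimately show ?thesis by (simp add: num_comps_def components_of_def)
qed

lemma arc_in_closure:
  assumes "cyc_next R i j"
  shows "(2 * i, 2 * j - 1) \<in> (arc_rel (fatten R, fatten Q))\<^sup>*"
proof -
  have "{2 * i, 2 * j - 1} \<in> fatten R \<union> fatten Q"
    using assms unfolding fatten_def by blast
  then have "(2 * i, 2 * j - 1) \<in> arc_rel (fatten R, fatten Q)"
    unfolding arc_rel_def fst_conv snd_conv by (intro CollectI case_prodI bexI[of _ "{2 * i, 2 * j - 1}"]) auto
  then show ?thesis by (rule r_into_rtrancl)
qed

text \<open>Merging two blocks re-glues two arcs on the same four points; both matchings generate the same relation
  once a single additional pair of these points is identified.\<close>

lemma num_comps_glue:
  assumes R: "R \<in> nceq A" "finite A" and J: "consecutive (glue R x y) x y" and xy: "(x, y) \<notin> R"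
  shows "num_comps n R Q \<le> num_comps n (glue R x y) Q + 1" "num_comps n (glue R x y) Q \<le> num_comps n R Q + 1"
proof -
  obtain p q where nx: "cyc_next R x p" "cyc_next R q y" "cyc_next (glue R x y) x y" "cyc_next (glue R x y) q p"
    and other: "\<And>i j. i \<noteq> x \<Longrightarrow> i \<noteq> q \<Longrightarrow> cyc_next (glue R x y) i j \<longleftrightarrow> cyc_next R i j"
    using cyc_next_glue[OF R J xy] by blast
  \<comment> \<open>Merging replaces the arcs {2x, 2p - 1} and {2q, 2y - 1} by {2x, 2y - 1} and {2q,
    2p - 1}; identifying \<open>2 * x\<close> with \<open>2 * q\<close> makes the two pairs of arcs
    interchangeable.\<close>
  have link: "(2 * x, b) \<in> glue r (2 * x) (2 * q)" if "(2 * q, b) \<in> r" "equiv UNIV r" for b r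
    using that equiv_class_self[OF that(2), of "2 * x"] by (auto simp: glue_def)
  have link': "(2 * q, b) \<in> glue r (2 * x) (2 * q)" if "(2 * x, b) \<in> r" "equiv UNIV r" for b r
    using that equiv_class_self[OF that(2), of "2 * q"] by (auto simp: glue_def)
  show "num_comps n R Q \<le> num_comps n (glue R x y) Q + 1"
  proof (rule num_comps_le_Suc[of _ _ _ "2 * x" "2 * q"])
    fix i j assume ij: "cyc_next (glue R x y) i j"
    show "(2 * i, 2 * j - 1) \<in> glue ((arc_rel (fatten R, fatten Q))\<^sup>*) (2 * x) (2 * q)"
    proof (cases "i = x \<or> i = q")
      case True
      then show ?thesis
        using cyc_next_unique[OF ij] nx link[OF arc_in_closure[OF nx(2)] equiv_arc_rel]
          link'[OF arc_in_closure[OF nx(1)] equiv_arc_rel] by metis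
    next
      case False
      then have "cyc_next R i j" using other ij by blast
      then show ?thesis by (rule subsetD[OF subset_glue arc_in_closure])
    qed
  qed
  show "num_comps n (glue R x y) Q \<le> num_comps n R Q + 1"
  proof (rule num_comps_le_Suc[of _ _ _ "2 * x" "2 * q"])
    fix i j assume ij: "cyc_next R i j"
    show "(2 * i, 2 * j - 1) \<in> glue ((arc_rel (fatten (glue R x y), fatten Q))\<^sup>*) (2 * x) (2 * q)"
    proof (cases "i = x \<or> i = q")
      case True
      then show ?thesis
        using cyc_next_unique[OF ij] nx link[OF arc_in_closure[OF nx(4)] equiv_arc_rel]
          link'[OF arc_in_closure[OF nx(3)] equiv_arc_rel] by metis
    next
      case False
      then have "cyc_next (glue R x y) i j" using other ij by blast
      then show ?thesis by (rule subsetD[OF subset_glue arc_in_closure])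
    qed
  qed
qed

lemma num_comps_cover:
  assumes R: "R \<in> nceq {1..n}" and S: "S \<in> nceq {1..n}"
    and cov: "nc_covers n ({1..n} // S) ({1..n} // R)"
  shows "num_comps n R Q \<le> num_comps n S Q + 1" "num_comps n S Q \<le> num_comps n R Q + 1"
proof -
  have sub: "R \<subset> S" and no: "\<not> (\<exists>T\<in>nceq {1..n}. R \<subset> T \<and> T \<subset> S)"
    using cov nc_covers_quotient_iff[OF R S] by auto
  obtain x y where xy: "consecutive S x y" "(x, y) \<notin> R"
    using adjacent_pair_exists[OF R S sub] .
  note J = glue_consecutive[OF R S sub xy]
  have "S = glue R x y" using no J by blast
  then show "num_comps n R Q \<le> num_comps n S Q + 1" "num_comps n S Q \<le> num_comps n R Q + 1"
    using num_comps_glue[OF R _ _ xy(2), of n Q] xy(1) by auto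
qed

lemma num_comps_hasse_path:
  assumes R: "R \<in> nceq {1..n}"
  shows "S \<in> nceq {1..n} \<Longrightarrow> ({1..n} // R, {1..n} // S) \<in> hasse n ^^ k \<Longrightarrow> num_comps n R Q \<le> num_comps n S Q + k"
proof (induction k arbitrary: S)
  case 0
  then have "R = S"
    using inj_onD[OF bij_betw_imp_inj_on[OF bij_betw_quotient]] R by simp
  then show ?case by simp
next
  case (Suc k)
  then obtain \<tau> where \<tau>: "({1..n} // R, \<tau>) \<in> hasse n ^^ k" "(\<tau>, {1..n} // S) \<in> hasse n" by auto
  then have "\<tau> \<in> NC n" by (auto simp: hasse_def)
  then obtain T where T: "T \<in> nceq {1..n}" "\<tau> = {1..n} // T"
    using bij_betw_imp_surj_on[OF bij_betw_quotient] by blast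
  have "num_comps n T Q \<le> num_comps n S Q + 1"
    using \<tau>(2) num_comps_cover[OF T(1) Suc.prems(1)] num_comps_cover[OF Suc.prems(1) T(1)]
    unfolding T(2) hasse_def by auto
  moreover have "num_comps n R Q \<le> num_comps n T Q + k"
    using Suc.IH[OF T(1)] \<tau>(1) T(2) by simp
  ultimately show ?case by simp
qed

text \<open>With equal matchings, connectivity is contained in the relation \<open>s\<close> of
  being equal or on a common arc, and the \<open>n\<close> arcs are classes of
  \<open>s\<close>.\<close>

lemma num_comps_self_ge:
  assumes R: "R \<in> nceq {1..n}"
  shows "n \<le> num_comps n R R"
proof -
  note part = fatten_partition[OF R]
  define s where "s = Id \<union> {(a, b). \<exists>X\<in>fatten R. a \<in> X \<and> b \<in> X}"
  have disj: "X = Y" if "X \<in> fatten R" "Y \<in> fatten R" "x \<in> X" "x \<in> Y" for X Y x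
    using partition_onD2[OF part] that unfolding disjoint_def by blast
  have s: "equiv UNIV s"
  proof (rule equivI)
    show "sym s" by (auto simp: s_def sym_def)
    show "trans s"
    proof (rule transI)
      fix a b c assume "(a, b) \<in> s" "(b, c) \<in> s"
      then show "(a, c) \<in> s" using disj unfolding s_def by blast
    qed
  qed (auto simp: s_def refl_on_def)
  have "(arc_rel (fatten R, fatten R))\<^sup>* \<subseteq> s"
    by (rule rtrancl_subset_equiv[OF s]) (auto simp: arc_rel_def s_def)
  then have "card ({1..2 * n} // s) \<le> num_comps n R R"
    unfolding num_comps_def components_of_def using card_quotient_antimono[OF equiv_arc_rel s] by simp
  moreover have "fatten R \<subseteq> {1..2 * n} // s"
  proof
    fix X assume X: "X \<in> fatten R"
    then obtain a where a: "a \<in> X" using partition_onD3[OF part] by (metis all_not_in_conv)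
    then have "a \<in> {1..2 * n}" using X partition_onD1[OF part] by blast
    moreover have "X = s `` {a}"
      using X a disj by (auto simp: s_def)
    ultimately show "X \<in> {1..2 * n} // s" by (auto intro: quotientI)
  qed
  then have "card (fatten R) \<le> card ({1..2 * n} // s)"
    by (intro card_mono) (auto simp: quotient_def)
  moreover have "2 * card (fatten R) = card (\<Union>(fatten R))"
  proof (rule card_partition)
    show "finite (\<Union>(fatten R))" using partition_onD1[OF part] by (metis finite_atLeastAtMost)
    then show "finite (fatten R)" by (rule finite_UnionD)
    show "X \<inter> Y = {}" if "X \<in> fatten R" "Y \<in> fatten R" "X \<noteq> Y" for X Y using disj that by blast
  qed (rule card_fatten_elem[OF R])
  then have "card (fatten R) = n" using partition_onD1[OF part] by (metis card_atLeastAtMost diff_Suc_1 mult_left_cancel zero_neq_numeral)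
  ultimately show ?thesis by simp
qed

lemma num_comps_plus_dist_ge:
  assumes R: "R \<in> nceq {1..n}" and Q: "Q \<in> nceq {1..n}"
  shows "n \<le> num_comps n R Q + hasse_dist n ({1..n} // R) ({1..n} // Q)"
proof -
  have "num_comps n Q Q \<le> num_comps n R Q + hasse_dist n ({1..n} // R) ({1..n} // Q)"
    by (rule num_comps_hasse_path[OF Q R sym_relpow[OF sym_hasse hasse_dist_path[OF R Q]]])
  then show ?thesis using num_comps_self_ge[OF Q] by simp
qed

section \<open>Expected values\<close>

text \<open>The left ends of the arcs of \<open>fatten R\<close>: the left copy of a least element
  begins the closing arc of its class, and the right copy of an element with a successor begins the
  arc to that successor.\<close>

definition openers :: "nat \<Rightarrow> (nat \<times> nat) set \<Rightarrow> nat set" where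
  "openers n R = (\<lambda>v. 2 * v - 1) ` least_elems {1..n} R \<union> (\<lambda>v. 2 * v) ` ({1..n} - greatest_elems {1..n} R)"

lemma opener_of_arc:
  assumes R: "R \<in> nceq {1..n}" and m: "m \<in> {1..2 * n}"
    and min: "\<And>X b. X \<in> fatten R \<Longrightarrow> m \<in> X \<Longrightarrow> b \<in> X \<Longrightarrow> m \<le> b"
  shows "m \<in> openers n R"
proof -
  have "m \<in> \<Union>(fatten R)" 
    by (subst partition_onD1[OF fatten_partition[OF R], symmetric]) (rule m)
  then obtain X where X: "X \<in> fatten R" "m \<in> X" by blast
  obtain i j where ij: "X = {2 * i, 2 * j - 1}" "cyc_next R i j" "1 \<le> i" "i \<le> n" "1 \<le> j" "j \<le> n"
    using R X(1) by (rule fatten_elem)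
  show ?thesis
  proof (cases "m = 2 * i")
    case True
    then have "2 * i \<le> 2 * j - 1" using min[OF X(1), of "2 * j - 1"] X(2) ij(1) by simp
    then have "i < j" using ij(5) by linarith
    then have "i \<notin> greatest_elems {1..n} R" using cyc_next_rel[OF ij(2)] by (auto simp: greatest_elems_def)
    then show ?thesis using True ij(3,4) unfolding openers_def by auto
  next
    case False
    then have m': "m = 2 * j - 1" using X(2) ij(1) by simp
    then have "2 * j - 1 \<le> 2 * i" using min[OF X(1), of "2 * i"] X(2) ij(1) by simp
    then have "j \<le> i" by linarith
    then have "\<And>k. (i, k) \<in> R \<Longrightarrow> j \<le> k" using ij(2) unfolding cyc_next_def consecutive_def by auto
    then have "(k, j) \<notin> R" if "k < j" for k
      using that nceq_trans[OF R cyc_next_rel[OF ij(2)] nceq_sym[OF R, of k j]] by (meson not_le)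
    then have "j \<in> least_elems {1..n} R" using ij(5,6) by (auto simp: least_elems_def)
    then show ?thesis using m' unfolding openers_def by blast
  qed
qed

lemma components_subset:
  assumes "R \<in> nceq {1..n}" "Q \<in> nceq {1..n}" "X \<in> components_of n (fatten R, fatten Q)"
  shows "X \<subseteq> {1..2 * n}"
proof -
  have sub: "arc_rel (fatten R, fatten Q) \<subseteq> {1..2 * n} \<times> {1..2 * n}"
    using partition_onD1[OF fatten_partition[OF assms(1)]] partition_onD1[OF fatten_partition[OF assms(2)]]
    unfolding arc_rel_def by auto
  obtain a where "a \<in> {1..2 * n}" "X = (arc_rel (fatten R, fatten Q))\<^sup>* `` {a}"
    using assms(3) by (auto simp: components_of_def quotient_def)
  moreover have "b \<in> {1..2 * n}" if "(a, b) \<in> (arc_rel (fatten R, fatten Q))\<^sup>*" "a \<in> {1..2 * n}" for a b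
    using that by (induction) (use sub in auto)
  ultimately show ?thesis by auto
qed

text \<open>The leftmost point of a component is the left end of both of its arcs.\<close>

lemma num_comps_le_common_openers:
  assumes R: "R \<in> nceq {1..n}" and Q: "Q \<in> nceq {1..n}"
  shows "num_comps n R Q \<le> card (openers n R \<inter> openers n Q)"
proof -
  let ?C = "components_of n (fatten R, fatten Q)"
  let ?r = "(arc_rel (fatten R, fatten Q))\<^sup>*"
  have sub: "X \<subseteq> {1..2 * n}" if "X \<in> ?C" for X
    using components_subset[OF R Q that] .
  then have fin: "finite X" if "X \<in> ?C" for X using that finite_subset by blast
  have ne: "X \<noteq> {}" if "X \<in> ?C" for X
    using that unfolding components_of_def quotient_def by auto
  have MinX: "Min X \<in> X" if "X \<in> ?C" for X using Min_in[OF fin ne] that by blast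
  have cls: "X = ?r `` {m}" if X: "X \<in> ?C" and m: "m \<in> X" for X m
  proof -
    obtain a where "X = ?r `` {a}"
      using X unfolding components_of_def quotient_def by blast
    then show ?thesis using m equiv_class_eq[OF equiv_arc_rel, of a m] by auto
  qed
  have "inj_on Min ?C"
  proof (rule inj_onI)
    fix X Y assume "X \<in> ?C" "Y \<in> ?C" "Min X = Min Y"
    then show "X = Y" using cls[of X "Min X"] cls[of Y "Min X"] MinX[of X] MinX[of Y] by simp
  qed
  moreover have "Min ` ?C \<subseteq> openers n R \<inter> openers n Q"
  proof clarify
    fix X assume X: "X \<in> ?C"
    let ?m = "Min X"
    have le: "?m \<le> b" if "(?m, b) \<in> ?r" for b
    proof -
      have "b \<in> ?r `` {?m}" using that by simp
      then have "b \<in> X" by (simp only: cls[OF X MinX[OF X], symmetric])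
      then show ?thesis by (rule Min_le[OF fin[OF X]])
    qed
    have m: "?m \<in> {1..2 * n}" using MinX[OF X] sub[OF X] by blast
    have "(?m, b) \<in> ?r" if "Y \<in> fatten R \<union> fatten Q" "?m \<in> Y" "b \<in> Y" for Y b
      using that by (intro r_into_rtrancl) (auto simp: arc_rel_def)
    then show "?m \<in> openers n R \<inter> openers n Q"
      using opener_of_arc[OF R m] opener_of_arc[OF Q m] le by blast
  qed
  moreover have "finite (openers n R \<inter> openers n Q)"
    by (auto simp: openers_def least_elems_def)
  ultimately show ?thesis
    unfolding num_comps_def by (rule card_inj_on_le)
qed

text \<open>By parity, a common opener is a left copy for both relations or a right copy for
  both.\<close>

lemma card_common_openers:
  "card (openers n R \<inter> openers n Q) \<le>
    card {v \<in> {1..n}. v \<in> least_elems {1..n} R \<and> v \<in> least_elems {1..n} Q} +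
    card {v \<in> {1..n}. v \<notin> greatest_elems {1..n} R \<and> v \<notin> greatest_elems {1..n} Q}"
proof -
  let ?A = "{v \<in> {1..n}. v \<in> least_elems {1..n} R \<and> v \<in> least_elems {1..n} Q}"
  let ?B = "{v \<in> {1..n}. v \<notin> greatest_elems {1..n} R \<and> v \<notin> greatest_elems {1..n} Q}"
  have "openers n R \<inter> openers n Q \<subseteq> (\<lambda>v. 2 * v - 1) ` ?A \<union> (\<lambda>v. 2 * v) ` ?B"
  proof
    fix m assume m: "m \<in> openers n R \<inter> openers n Q"
    have par: "2 * v - 1 \<noteq> 2 * w" if "v \<ge> 1" for v w :: nat using that by presburger
    have odd: "v = w" if "2 * v - 1 = 2 * w - 1" "v \<ge> 1" "w \<ge> 1" for v w :: nat using that by presburger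
    from m consider (o) v w where "m = 2 * v - 1" "m = 2 * w - 1" "v \<in> least_elems {1..n} R" "w \<in> least_elems {1..n} Q"
      | (e) v w where "m = 2 * v" "m = 2 * w" "v \<in> {1..n} - greatest_elems {1..n} R" "w \<in> {1..n} - greatest_elems {1..n} Q"
      | (x) v w where "m = 2 * v - 1" "m = 2 * w" "v \<in> {1..n}"
      unfolding openers_def least_elems_def by blast
    then show "m \<in> (\<lambda>v. 2 * v - 1) ` ?A \<union> (\<lambda>v. 2 * v) ` ?B"
    proof cases
      case o
      then have "v \<in> {1..n}" "w \<in> {1..n}" by (auto simp: least_elems_def)
      then have "v = w" using odd[of v w] o by simp
      then show ?thesis using o \<open>v \<in> {1..n}\<close> by blast
    next
      case e
      then have "v = w" by simp
      then show ?thesis using e by blast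
    next
      case x
      then show ?thesis using par[of v w] by simp
    qed
  qed
  then have "card (openers n R \<inter> openers n Q) \<le> card ((\<lambda>v. 2 * v - 1) ` ?A \<union> (\<lambda>v. 2 * v) ` ?B)"
    by (intro card_mono) auto
  also have "\<dots> \<le> card ?A + card ?B"
    by (intro order_trans[OF card_Un_le] add_mono card_image_le) auto
  finally show ?thesis .
qed

text \<open>For fixed \<open>v\<close> the two relations are chosen independently, so the favourable
  pairs form a square.\<close>

lemma sum_card_common:
  assumes "finite N"
  shows "(\<Sum>R\<in>N. \<Sum>Q\<in>N. real (card {v \<in> {1..n :: nat}. P R v \<and> P Q v})) =
    (\<Sum>v=1..n. real (card {R \<in> N. P R v}) ^ 2)"
proof -
  have "(\<Sum>R\<in>N. \<Sum>Q\<in>N. real (card {v \<in> {1..n}. P R v \<and> P Q v})) =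
      real (\<Sum>p\<in>N \<times> N. card {v \<in> {1..n}. P (fst p) v \<and> P (snd p) v})"
    by (simp add: sum.cartesian_product split_def)
  also have "\<dots> = (\<Sum>v=1..n. real (card {p \<in> N \<times> N. P (fst p) v \<and> P (snd p) v}))"
    using assms by (subst sum_card_swap) auto
  also have "\<dots> = (\<Sum>v=1..n. real (card {R \<in> N. P R v}) ^ 2)"
  proof (rule sum.cong)
    fix v
    have "{p \<in> N \<times> N. P (fst p) v \<and> P (snd p) v} = {R \<in> N. P R v} \<times> {R \<in> N. P R v}" by auto
    then show "real (card {p \<in> N \<times> N. P (fst p) v \<and> P (snd p) v}) = real (card {R \<in> N. P R v}) ^ 2"
      by (simp add: card_cartesian_product power2_eq_square)
  qed simp
  finally show ?thesis .
qed

text \<open>Least elements contribute the indices m = n + 1 - v, elements with a successor the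
  indices m = n - v. Both ranges are completed to 0, ..., n, which gives the same sum twice.\<close>

lemma sum_num_comps_le:
  "(\<Sum>R\<in>nceq {1..n}. \<Sum>Q\<in>nceq {1..n}. real (num_comps n R Q)) \<le>
    2 * (\<Sum>m\<le>n. catalan_conv n m ^ 2) * real (catalan n) ^ 2"
proof -
  let ?N = "nceq {1..n}"
  let ?L = "\<lambda>R v. v \<in> least_elems {1..n} R" and ?G = "\<lambda>R v. v \<notin> greatest_elems {1..n} R"
  have "(\<Sum>R\<in>?N. \<Sum>Q\<in>?N. real (num_comps n R Q)) \<le>
      (\<Sum>R\<in>?N. \<Sum>Q\<in>?N. real (card {v \<in> {1..n}. ?L R v \<and> ?L Q v}) + real (card {v \<in> {1..n}. ?G R v \<and> ?G Q v}))"
  proof (intro sum_mono)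
    fix R Q assume "R \<in> ?N" "Q \<in> ?N"
    then have "num_comps n R Q \<le> card {v \<in> {1..n}. ?L R v \<and> ?L Q v} + card {v \<in> {1..n}. ?G R v \<and> ?G Q v}"
      using order_trans[OF num_comps_le_common_openers card_common_openers] by blast
    then show "real (num_comps n R Q) \<le> real (card {v \<in> {1..n}. ?L R v \<and> ?L Q v}) + real (card {v \<in> {1..n}. ?G R v \<and> ?G Q v})"
      by linarith
  qed
  also have "\<dots> = (\<Sum>v=1..n. real (card {R \<in> ?N. ?L R v}) ^ 2) + (\<Sum>v=1..n. real (card {R \<in> ?N. ?G R v}) ^ 2)"
    unfolding sum.distrib using sum_card_common[OF finite_nceq, of "{1..n}" n ?L] sum_card_common[OF finite_nceq, of "{1..n}" n ?G]
    by simp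
  also have "(\<Sum>v=1..n. real (card {R \<in> ?N. ?L R v}) ^ 2) = (\<Sum>v=1..n. (catalan_conv n (n + 1 - v) * real (catalan n)) ^ 2)"
    by (intro sum.cong refl arg_cong[where f = "\<lambda>x. x ^ 2"] card_least_elem)
  also have "\<dots> = (\<Sum>m=1..n. (catalan_conv n m * real (catalan n)) ^ 2)"
    by (rule sum.reindex_bij_witness[of _ "\<lambda>m. n + 1 - m" "\<lambda>m. n + 1 - m"]) auto
  also have "\<dots> \<le> (\<Sum>m\<le>n. (catalan_conv n m * real (catalan n)) ^ 2)"
    by (intro sum_mono2) auto
  also have "(\<Sum>v=1..n. real (card {R \<in> ?N. ?G R v}) ^ 2) = (\<Sum>v=1..n. (catalan_conv n (n - v) * real (catalan n)) ^ 2)"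
    by (intro sum.cong refl arg_cong[where f = "\<lambda>x. x ^ 2"] card_not_greatest_elem)
  also have "\<dots> = (\<Sum>m<n. (catalan_conv n m * real (catalan n)) ^ 2)"
    by (rule sum.reindex_bij_witness[of _ "\<lambda>m. n - m" "\<lambda>m. n - m"]) auto
  also have "\<dots> \<le> (\<Sum>m\<le>n. (catalan_conv n m * real (catalan n)) ^ 2)"
    by (intro sum_mono2) auto
  finally show ?thesis
    by (simp add: power_mult_distrib mult_ac sum_distrib_left)
qed

lemma expected_hasse_dist_nceq:
  "expected_hasse_dist n =
    (\<Sum>R\<in>nceq {1..n}. \<Sum>Q\<in>nceq {1..n}. real (hasse_dist n ({1..n} // R) ({1..n} // Q))) / real (catalan n) ^ 2"
proof -
  have "card (NC n) = catalan n"
    using bij_betw_same_card[OF bij_betw_quotient] card_nceq[of "{1..n}"] by simp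
  then show ?thesis
    unfolding expected_hasse_dist_eq sum.reindex_bij_betw[OF bij_betw_quotient, symmetric] by simp
qed

lemma expected_components_nceq:
  "expected_components n = (\<Sum>R\<in>nceq {1..n}. \<Sum>Q\<in>nceq {1..n}. real (num_comps n R Q)) / real (catalan n) ^ 2"
proof -
  have card: "card (nc_matchings n) = catalan n"
    using bij_betw_same_card[OF bij_betw_fatten] card_nceq[of "{1..n}"] by simp
  have "expected_components n =
      (\<Sum>M\<in>meandric_systems n. real (card (components_of n M))) / real (card (meandric_systems n))"
    unfolding expected_components_def
    by (rule integral_pmf_of_set[OF meandric_systems_nonempty finite_meandric_systems])
  also have "(\<Sum>M\<in>meandric_systems n. real (card (components_of n M))) =
      (\<Sum>\<mu>\<in>nc_matchings n. \<Sum>\<nu>\<in>nc_matchings n. real (card (components_of n (\<mu>, \<nu>))))"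
    by (simp add: meandric_systems_def sum.cartesian_product)
  also have "\<dots> = (\<Sum>R\<in>nceq {1..n}. \<Sum>Q\<in>nceq {1..n}. real (num_comps n R Q))"
    unfolding sum.reindex_bij_betw[OF bij_betw_fatten, symmetric] num_comps_def ..
  finally show ?thesis
    by (simp add: meandric_systems_def card_cartesian_product card power2_eq_square)
qed

lemma expected_sum_ge: "real n \<le> expected_components n + expected_hasse_dist n"
proof -
  let ?N = "nceq {1..n}"
  have c: "real (catalan n) ^ 2 > 0" using catalan_pos[of n] by simp
  have "real n * real (catalan n) ^ 2 = (\<Sum>R\<in>?N. \<Sum>Q\<in>?N. real n)"
    by (simp add: card_nceq power2_eq_square)
  also have "\<dots> \<le> (\<Sum>R\<in>?N. \<Sum>Q\<in>?N. real (num_comps n R Q) + real (hasse_dist n ({1..n} // R) ({1..n} // Q)))"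
    by (intro sum_mono) (use num_comps_plus_dist_ge in \<open>simp flip: of_nat_add\<close>)
  also have "\<dots> = (expected_components n + expected_hasse_dist n) * real (catalan n) ^ 2"
    using c by (simp add: expected_components_nceq expected_hasse_dist_nceq sum.distrib distrib_right)
  finally show ?thesis using c by simp
qed

lemma expected_components_le:
  assumes "\<epsilon> > 0"
  shows "\<exists>N. \<forall>n\<ge>N. expected_components n \<le> (1 / 2 + \<epsilon>) * real n"
proof -
  have "expected_components n \<le> 2 * (\<Sum>m\<le>n. catalan_conv n m ^ 2)" for n
    using sum_num_comps_le[of n] catalan_pos[of n] by (simp add: expected_components_nceq pos_divide_le_eq)
  then show ?thesis
    using sum_catalan_conv_square_le[OF assms] by (meson order_trans)
qed

lemma expected_hasse_dist_le:
  "\<exists>N. \<forall>n\<ge>N. expected_hasse_dist n \<le> 0.83 * real n"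
proof -
  obtain N where N: "\<And>n. n \<ge> N \<Longrightarrow> (\<Sum>R\<in>nceq {1..n}. \<Sum>Q\<in>nceq {1..n}. real (card (least_elems {1..n} (R \<inter> Q))))
      \<le> 0.915 * real n * real (catalan n) ^ 2"
    using sum_card_least_elems_Int_le by blast
  show ?thesis
  proof (intro exI allI impI)
    fix n assume n: "n \<ge> max N 1"
    let ?N = "nceq {1..n}" and ?l = "\<lambda>R. real (card (least_elems {1..n} R))"
    have c: "real (catalan n) > 0" using catalan_pos[of n] by simp
    have l: "(\<Sum>R\<in>?N. ?l R) = (real n + 1) / 2 * real (catalan n)"
      using n by (intro sum_card_least_elems) auto
    have "(\<Sum>R\<in>?N. \<Sum>Q\<in>?N. real (hasse_dist n ({1..n} // R) ({1..n} // Q))) \<le>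
        (\<Sum>R\<in>?N. \<Sum>Q\<in>?N. 2 * ?l (R \<inter> Q) - ?l R - ?l Q)"
      by (intro sum_mono hasse_dist_le)
    also have "\<dots> = 2 * (\<Sum>R\<in>?N. \<Sum>Q\<in>?N. ?l (R \<inter> Q)) - 2 * real (catalan n) * (\<Sum>R\<in>?N. ?l R)"
      by (simp add: sum_subtractf card_nceq flip: sum_distrib_left)
    also have "\<dots> \<le> 2 * (0.915 * real n * real (catalan n) ^ 2) - 2 * real (catalan n) * ((real n + 1) / 2 * real (catalan n))"
      unfolding l using N[of n] n by simp
    \<comment> \<open>Here 0.83 = 2 * 0.915 - 1, the 1 coming from the two mean block numbers (n +
      1) / 2.\<close>
    also have "\<dots> = (0.83 * real n - 1) * real (catalan n) ^ 2"
      by (simp add: algebra_simps power2_eq_square)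
    also have "\<dots> \<le> 0.83 * real n * real (catalan n) ^ 2"
      by (intro mult_right_mono) auto
    finally show "expected_hasse_dist n \<le> 0.83 * real n"
      using c by (simp add: expected_hasse_dist_nceq pos_divide_le_eq)
  qed
qed

theorem corollary1p5:
  shows "(\<forall>\<epsilon>::real. \<epsilon> > 0 \<longrightarrow>
            (\<exists>N. \<forall>n\<ge>N. (0.5 - \<epsilon>) * real n \<le> expected_hasse_dist n
                      \<and> expected_hasse_dist n \<le> 0.83 * real n))
       \<and> (\<forall>\<epsilon>::real. \<epsilon> > 0 \<longrightarrow>
            (\<exists>N. \<forall>n\<ge>N. 0.17 * real n \<le> expected_components n
                      \<and> expected_components n \<le> (0.5 + \<epsilon>) * real n))"
proof -
  have "\<exists>N. \<forall>n\<ge>N. ((0.5 - \<epsilon>) * real n \<le> expected_hasse_dist n \<and> expected_hasse_dist n \<le> 0.83 * real n) \<and>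
      (0.17 * real n \<le> expected_components n \<and> expected_components n \<le> (0.5 + \<epsilon>) * real n)"
    if "\<epsilon> > 0" for \<epsilon> :: real
  proof -
    obtain N1 where N1: "\<And>n. n \<ge> N1 \<Longrightarrow> expected_components n \<le> (1 / 2 + \<epsilon>) * real n"
      using expected_components_le[OF \<open>\<epsilon> > 0\<close>] by blast
    obtain N2 where N2: "\<And>n. n \<ge> N2 \<Longrightarrow> expected_hasse_dist n \<le> 0.83 * real n"
      using expected_hasse_dist_le by blast
    show ?thesis
    proof (intro exI allI impI)
      fix n assume "n \<ge> max N1 N2"
      then show "((0.5 - \<epsilon>) * real n \<le> expected_hasse_dist n \<and> expected_hasse_dist n \<le> 0.83 * real n) \<and>
          (0.17 * real n \<le> expected_components n \<and> expected_components n \<le> (0.5 + \<epsilon>) * real n)"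
        using N1[of n] N2[of n] expected_sum_ge[of n] by (simp add: algebra_simps)
    qed
  qed
  then show ?thesis by meson
qed

end
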